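(* Let $p>1$ and consider the solution $\phi$ of the Cauchy problem in $\mathbb{R}^{1+1}$ $$-\partial_t^2\phi+\partial_x^2\phi=|\phi|^{p-1}\phi,\qquad \phi(0,x)=\phi_0(x),\qquad \partial_t\phi(0,x)=\phi_1(x),$$ with initial data satisfying $$\mathcal{E}_1[\phi]=\int_{\mathbb{R}}(1+|x|)\Big(|\partial_x\phi_0|^2+|\phi_1|^2+\frac{2}{p+1}|\phi_0|^{p+1}\Big)dx<+\infty .$$ Then the following decay estimates hold. (i) In the exterior region $|x|\ge |t|$, $$|\phi(t,x)|\le C(1+|t|+|x|)^{-\frac{1}{p+3}}(1+|x|-|t|)^{-\frac{1}{p+3}}.$$ (ii) In the interior region $|x|<|t|$, $$|\phi(t,x)|\le C(1+|t|+|x|)^{\frac{1-2\alpha}{p+3}}(1+|t|-|x|)^{\frac{1-2\beta}{p+3}}$$ for all constants $\alpha,\beta$ such that $$\Big(\frac1\alpha-1\Big)\Big(\frac1\beta-1\Big)=\frac{4}{(p+1)^2},\qquad \frac12\le\alpha<1 .$$ (iii) In particular, for all $t\in\mathbb{R}$, $$\|\phi(t,x)\|_{L_x^\infty(\mathbb{R})}\le C(1+|t|)^{-\frac{p-1}{(p+1)^2+4}} .$$ Here $C$ depends only on $p$, $\alpha$, $\beta$ and the weighted energy $\mathcal{E}_1[\phi]$.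
   Context: Functions are real-valued. For data with finite energy (in particular with $\mathcal{E}_1[\phi]<\infty$), a solution is understood in the energy space: $\phi$ is a continuous function of $(t,x)\in\mathbb{R}\times\mathbb{R}$ with $\phi\in C_t L_x^{p+1}(\mathbb{R})$, $\partial_x\phi,\partial_t\phi\in C_tL_x^2(\mathbb{R})$, solving the equation in the sense of distributions and attaining the initial data at $t=0$. *)

theory Defs
  imports "HOL-Analysis.Analysis" "HOL-Probability.Essential_Supremum"
begin

definition dir_deriv :: "'a::euclidean_space \<Rightarrow> ('a \<Rightarrow> real) \<Rightarrow> 'a \<Rightarrow> real" where
  "dir_deriv v f = (\<lambda>z. frechet_derivative f (at z) v)"

primrec C_k :: "nat \<Rightarrow> ('a::euclidean_space \<Rightarrow> real) \<Rightarrow> bool" where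
  "C_k 0 f \<longleftrightarrow> continuous_on UNIV f"
| "C_k (Suc k) f \<longleftrightarrow> (\<forall>z. f differentiable (at z)) \<and> (\<forall>v. C_k k (dir_deriv v f))"

definition test_function :: "('a::euclidean_space \<Rightarrow> real) \<Rightarrow> bool" where
  "test_function \<psi> \<longleftrightarrow> (\<forall>k. C_k k \<psi>) \<and> compact (closure {z. \<psi> z \<noteq> 0})"

definition locally_integrable :: "('a::euclidean_space \<Rightarrow> real) \<Rightarrow> bool" where
  "locally_integrable f \<longleftrightarrow>
     f \<in> borel_measurable lborel \<and> (\<forall>K. compact K \<longrightarrow> set_integrable lborel K f)"

(* "g is the distributional derivative of f in direction v"; g is determined up to null sets. *)
definition has_weak_deriv ::
    "'a::euclidean_space \<Rightarrow> ('a \<Rightarrow> real) \<Rightarrow> ('a \<Rightarrow> real) \<Rightarrow> bool" where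
  "has_weak_deriv v f g \<longleftrightarrow> locally_integrable f \<and> locally_integrable g \<and>
     (\<forall>\<psi>. test_function \<psi> \<longrightarrow>
        (LINT z|lborel. f z * dir_deriv v \<psi> z) = - (LINT z|lborel. g z * \<psi> z))"

definition in_Lq :: "real \<Rightarrow> (real \<Rightarrow> real) \<Rightarrow> bool" where
  "in_Lq q f \<longleftrightarrow> f \<in> borel_measurable lborel \<and> integrable lborel (\<lambda>x. \<bar>f x\<bar> powr q)"

definition Lq_norm :: "real \<Rightarrow> (real \<Rightarrow> real) \<Rightarrow> real" where
  "Lq_norm q f = (LINT x|lborel. \<bar>f x\<bar> powr q) powr (1 / q)"

(* Points of space-time are pairs (t, x): this is membership in C_t L^q_x over all times. *)
definition C_t_Lq :: "real \<Rightarrow> (real \<times> real \<Rightarrow> real) \<Rightarrow> bool" where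
  "C_t_Lq q u \<longleftrightarrow> (\<forall>t. in_Lq q (\<lambda>x. u (t, x))) \<and>
     (\<forall>t. ((\<lambda>s. Lq_norm q (\<lambda>x. u (s, x) - u (t, x))) \<longlongrightarrow> 0) (at t))"

abbreviation D_t :: "(real \<times> real \<Rightarrow> real) \<Rightarrow> real \<times> real \<Rightarrow> real" where
  "D_t \<equiv> dir_deriv (1, 0)"

abbreviation D_x :: "(real \<times> real \<Rightarrow> real) \<Rightarrow> real \<times> real \<Rightarrow> real" where
  "D_x \<equiv> dir_deriv (0, 1)"

(* -u_tt + u_xx = |u|^(p-1) u in the sense of distributions *)
definition distributional_nlw :: "real \<Rightarrow> (real \<times> real \<Rightarrow> real) \<Rightarrow> bool" where
  "distributional_nlw p u \<longleftrightarrow> (\<forall>\<psi>. test_function \<psi> \<longrightarrow>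
     (LINT z|lborel. u z * (- D_t (D_t \<psi>) z + D_x (D_x \<psi>) z))
       = (LINT z|lborel. \<bar>u z\<bar> powr (p - 1) * u z * \<psi> z))"

(* The data are elements of Lebesgue spaces, hence attained almost everywhere.
   The time-slice at 0 of u_t is meaningful because u_t is taken in C_t L^2_x. *)
definition energy_solution ::
    "real \<Rightarrow> (real \<Rightarrow> real) \<Rightarrow> (real \<Rightarrow> real) \<Rightarrow> (real \<times> real \<Rightarrow> real) \<Rightarrow> bool" where
  "energy_solution p \<phi>0 \<phi>1 \<phi> \<longleftrightarrow>
     continuous_on UNIV \<phi> \<and> C_t_Lq (p + 1) \<phi> \<and> distributional_nlw p \<phi> \<and>
     (AE x in lborel. \<phi> (0, x) = \<phi>0 x) \<and>
     (\<exists>\<phi>t \<phi>x. has_weak_deriv (1, 0) \<phi> \<phi>t \<and> has_weak_deriv (0, 1) \<phi> \<phi>x \<and>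
        C_t_Lq 2 \<phi>t \<and> C_t_Lq 2 \<phi>x \<and> (AE x in lborel. \<phi>t (0, x) = \<phi>1 x))"

(* The arguments stand for phi_0, its derivative, and phi_1. *)
definition weighted_energy ::
    "real \<Rightarrow> (real \<Rightarrow> real) \<Rightarrow> (real \<Rightarrow> real) \<Rightarrow> (real \<Rightarrow> real) \<Rightarrow> ennreal" where
  "weighted_energy p \<phi>0 d\<phi>0 \<phi>1 = (\<integral>\<^sup>+ x. ennreal ((1 + \<bar>x\<bar>) *
     (\<bar>d\<phi>0 x\<bar>\<^sup>2 + \<bar>\<phi>1 x\<bar>\<^sup>2 + 2 / (p + 1) * \<bar>\<phi>0 x\<bar> powr (p + 1))) \<partial>lborel)"

end

theory Submission
  imports Defs
begin

text \<open>
  In null coordinates \<open>u = t - x\<close>, \<open>v = t + x\<close> the equation reads \<open>\<Phi>\<^sub>u\<^sub>v = - |\<Phi>|\<^sup>p\<^sup>-\<^sup>1\<Phi> / 4\<close>; put \<open>P = \<Phi>\<^sub>v\<close>, \<open>Q = \<Phi>\<^sub>u\<close>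
  and \<open>V = 2 / (p + 1) |\<Phi>|\<^sup>p\<^sup>+\<^sup>1\<close>. Testing the distributional equation with products
  \<open>\<eta>\<^sub>1(u) \<eta>\<^sub>2(v)\<close> of approximate indicators shows that \<open>\<Phi>\<close> is a sum of two absolutely continuous
  profiles, determined by the data, and a Duhamel term. Hence, for every fixed value of the other
  coordinate, \<open>\<Phi>\<close> is absolutely continuous with density \<open>P\<close> resp. \<open>Q\<close>, \<open>P\<close> is continuously
  differentiable in \<open>u\<close> and \<open>Q\<close> in \<open>v\<close>. So multiplier identities hold by Fubini's theorem, without
  regularising the solution.

  For \<open>|x| \<ge> |t|\<close> the Lorentz boost is the multiplier: \<open>4 (1 + v) P\<^sup>2 + (1 - u) V\<close> and
  \<open>4 (1 - u) Q\<^sup>2 + (1 + v) V\<close> have zero divergence, which bounds the flux through every outgoing ray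
  by the weighted energy. For \<open>|x| < |t|\<close> the multiplier is
  \<open>\<beta> v\<^sup>\<alpha> u\<^sup>\<beta>\<^sup>-\<^sup>1 \<partial>\<^sub>v + \<alpha> u\<^sup>\<beta> v\<^sup>\<alpha>\<^sup>-\<^sup>1 \<partial>\<^sub>u + c v\<^sup>\<alpha>\<^sup>-\<^sup>1 u\<^sup>\<beta>\<^sup>-\<^sup>1\<close> (with \<open>1 + u\<close>, \<open>1 + v\<close> in place of \<open>u\<close>, \<open>v\<close>);
  the relation between \<open>\<alpha>\<close> and \<open>\<beta>\<close> says exactly that one constant \<open>c\<close> makes both the potential
  terms cancel and the quadratic form in \<open>(P, Q)\<close> degenerate, hence the divergence nonpositive.
  In both regions the flux bounds \<open>\<integral> a P\<^sup>2 + b V dv\<close> along an outgoing ray with \<open>a b\<close> increasing, and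
  integrating \<open>\<partial>\<^sub>v |\<Phi>|\<^bsup>(p+3)/2\<^esup>\<close>, which is bounded by \<open>(a P\<^sup>2 + b V) / \<surd>(a b)\<close>, from infinity gives
  the pointwise bounds.
\<close>

section \<open>Absolutely continuous functions on intervals\<close>

text \<open>On a fixed characteristic P or Q is only square integrable, so a derivative is stated as
  an increment equal to an integral over every subinterval; this is the form that Fubini's theorem
  consumes. Integrating from infinity presupposes that \<Phi> becomes small somewhere on the ray.
  The weight b of V is at least a multiple of 1 / (1 + v), which is not integrable, so a finite flux
  rules out a positive lower bound for |\<Phi>|. The interior rests on the exterior: its initial
  surface is the light cone u = 0 or v = 0. Replacing u, v by 1 + u, 1 + v keeps the weights regular
  there, but the flux through the cone still contains a \<Phi>^2 term. The exterior bound on \<Phi>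
  controls it, since its weight (1 + v) powr (\<alpha> - 2) is integrable for \<alpha> < 1.
  Cancelling the potential terms forces c = 8 \<alpha> \<beta> / (p + 1), and degeneracy of the
  quadratic form asks for c^2 = 16 \<alpha> \<beta> (1 - \<alpha>) (1 - \<beta>); eliminating c
  gives the relation between \<alpha> and \<beta>.\<close>

definition ac_deriv :: "(real \<Rightarrow> real) \<Rightarrow> (real \<Rightarrow> real) \<Rightarrow> real \<Rightarrow> real \<Rightarrow> bool" where
  "ac_deriv f f' a b \<longleftrightarrow> set_integrable lborel {a..b} f' \<and>
     (\<forall>x y. a \<le> x \<longrightarrow> x \<le> y \<longrightarrow> y \<le> b \<longrightarrow> f y - f x = (LBINT s:{x..y}. f' s))"

lemma set_integrable_mult_continuous:
  fixes f c :: "'a::euclidean_space \<Rightarrow> real"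
  assumes f: "set_integrable lborel K f" and K: "compact K" and c: "continuous_on K c"
  shows "set_integrable lborel K (\<lambda>x. c x * f x)"
proof -
  have "bounded (c ` K)"
    using compact_continuous_image[OF c K] compact_imp_bounded by blast
  then obtain B where B: "\<And>x. x \<in> K \<Longrightarrow> \<bar>c x\<bar> \<le> B"
    by (auto simp: bounded_iff)
  have Ks: "K \<in> sets borel" using K by (simp add: borel_compact)
  have m1: "(\<lambda>x. indicator K x *\<^sub>R c x) \<in> borel_measurable borel"
    by (rule borel_measurable_continuous_on_indicator[OF Ks c])
  have m2: "(\<lambda>x. indicator K x *\<^sub>R f x) \<in> borel_measurable borel"
    using f unfolding set_integrable_def by (auto dest: borel_measurable_integrable)
  have eq: "(\<lambda>x. indicator K x *\<^sub>R (c x * f x)) = (\<lambda>x. (indicator K x *\<^sub>R c x) * (indicator K x *\<^sub>R f x))"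
    by (auto simp: indicator_def fun_eq_iff)
  have i: "integrable lborel (\<lambda>x. B * (indicator K x *\<^sub>R f x))"
    using f unfolding set_integrable_def by (intro integrable_mult_right)
  show ?thesis unfolding set_integrable_def
  proof (rule Bochner_Integration.integrable_bound[OF i])
    show "(\<lambda>x. indicator K x *\<^sub>R (c x * f x)) \<in> borel_measurable lborel"
      unfolding eq using m1 m2 by simp
    show "AE x in lborel. norm (indicator K x *\<^sub>R (c x * f x)) \<le> norm (B * (indicator K x *\<^sub>R f x))"
    proof (rule AE_I2)
      fix x show "norm (indicator K x *\<^sub>R (c x * f x)) \<le> norm (B * (indicator K x *\<^sub>R f x))"
        using B[of x] by (auto simp: indicator_def abs_mult intro!: mult_right_mono)
    qed
  qed
qed

lemma set_integrable_continuous: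
  fixes c :: "'a::euclidean_space \<Rightarrow> real"
  assumes "compact K" "continuous_on K c"
  shows "set_integrable lborel K c"
  using borel_integrable_compact[OF assms] unfolding set_integrable_def
  by (simp add: indicator_def if_distrib cong: if_cong)

lemma set_integral_combine_Icc:
  fixes f :: "real \<Rightarrow> real"
  assumes "set_integrable lborel {x..z} f" "x \<le> y" "y \<le> z"
  shows "(LBINT s:{x..z}. f s) = (LBINT s:{x..y}. f s) + (LBINT s:{y..z}. f s)"
proof -
  have i: "set_integrable lborel {x..y} f" "set_integrable lborel {y..z} f"
    by (rule set_integrable_subset[OF assms(1)]; use assms in force)+
  show ?thesis
    using Henstock_Kurzweil_Integration.integral_combine[of x y z f] assms
      set_borel_integral_eq_integral[OF assms(1)] set_borel_integral_eq_integral[OF i(1)]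
      set_borel_integral_eq_integral[OF i(2)] by simp
qed

lemma ac_deriv_integrable: "ac_deriv f f' a b \<Longrightarrow> set_integrable lborel {a..b} f'"
  by (simp add: ac_deriv_def)

lemma ac_deriv_eq:
  "ac_deriv f f' a b \<Longrightarrow> a \<le> b \<Longrightarrow> f b - f a = (LBINT s:{a..b}. f' s)"
  by (simp add: ac_deriv_def)

lemma ac_deriv_subset:
  "ac_deriv f f' a b \<Longrightarrow> a \<le> c \<Longrightarrow> d \<le> b \<Longrightarrow> ac_deriv f f' c d"
  unfolding ac_deriv_def by (auto intro: set_integrable_subset)

lemma ac_deriv_continuous:
  assumes "ac_deriv f f' a b" shows "continuous_on {a..b} f"
proof (cases "a \<le> b")
  case True
  have i: "f' integrable_on {a..b}"
    using ac_deriv_integrable[OF assms] by (rule set_borel_integral_eq_integral)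
  have eq: "f x = f a + integral {a..x} f'" if "x \<in> {a..b}" for x
  proof -
    have "set_integrable lborel {a..x} f'"
      using that by (intro set_integrable_subset[OF ac_deriv_integrable[OF assms]]) auto
    from set_borel_integral_eq_integral(2)[OF this]
    have "f x - f a = integral {a..x} f'"
      using assms that by (simp add: ac_deriv_def)
    then show ?thesis by simp
  qed
  have "continuous_on {a..b} (\<lambda>x. f a + integral {a..x} f')"
    by (intro continuous_intros indefinite_integral_continuous_1 i)
  then show ?thesis using eq continuous_on_cong[OF refl, of "{a..b}" f "\<lambda>x. f a + integral {a..x} f'"] by blast
qed auto

lemma ac_deriv_cong:
  assumes "ac_deriv f f' a b" "\<And>x. x \<in> {a..b} \<Longrightarrow> f' x = g' x" "\<And>x. x \<in> {a..b} \<Longrightarrow> f x = g x"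
  shows "ac_deriv g g' a b"
  unfolding ac_deriv_def
proof (intro conjI allI impI)
  show "set_integrable lborel {a..b} g'"
    using ac_deriv_integrable[OF assms(1)] assms(2)
    by (subst set_integrable_cong[OF refl refl, of _ g' f']) auto
  fix x y assume xy: "a \<le> x" "x \<le> y" "y \<le> b"
  have "g y - g x = (LBINT s:{x..y}. f' s)"
    using assms(1,3) xy unfolding ac_deriv_def by force
  also have "\<dots> = (LBINT s:{x..y}. g' s)"
    using xy assms(2) by (intro set_lebesgue_integral_cong) auto
  finally show "g y - g x = (LBINT s:{x..y}. g' s)" .
qed

lemma ac_deriv_C1:
  assumes d: "\<And>x. x \<in> {a..b} \<Longrightarrow> (f has_real_derivative f' x) (at x)" and c: "continuous_on {a..b} f'"
  shows "ac_deriv f f' a b"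
  unfolding ac_deriv_def
proof (intro conjI allI impI)
  show "set_integrable lborel {a..b} f'" using c by (intro set_integrable_continuous) auto
  fix x y assume xy: "a \<le> x" "x \<le> y" "y \<le> b"
  have i: "set_integrable lborel {x..y} f'"
    using c xy by (intro set_integrable_continuous) (auto intro: continuous_on_subset)
  have "(f' has_integral (f y - f x)) {x..y}"
    using d xy by (intro fundamental_theorem_of_calculus)
      (auto simp: has_real_derivative_iff_has_vector_derivative[symmetric] intro: has_field_derivative_at_within)
  then show "f y - f x = (LBINT s:{x..y}. f' s)"
    using set_borel_integral_eq_integral(2)[OF i] by (simp add: integral_unique)
qed

lemma ac_deriv_add:
  assumes f: "ac_deriv f f' a b" and g: "ac_deriv g g' a b"
  shows "ac_deriv (\<lambda>x. f x + g x) (\<lambda>x. f' x + g' x) a b"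
  unfolding ac_deriv_def
proof (intro conjI allI impI)
  show "set_integrable lborel {a..b} (\<lambda>x. f' x + g' x)"
    using f g by (intro set_integral_add) (auto simp: ac_deriv_def)
  fix x y assume xy: "a \<le> x" "x \<le> y" "y \<le> b"
  have "set_integrable lborel {x..y} f'" "set_integrable lborel {x..y} g'"
    using xy ac_deriv_integrable[OF ac_deriv_subset[OF f, of x y]]
      ac_deriv_integrable[OF ac_deriv_subset[OF g, of x y]] by auto
  then have "(LBINT s:{x..y}. f' s + g' s) = (LBINT s:{x..y}. f' s) + (LBINT s:{x..y}. g' s)"
    by (rule set_integral_add)
  moreover have "f y - f x = (LBINT s:{x..y}. f' s)" "g y - g x = (LBINT s:{x..y}. g' s)"
    using f g xy by (auto simp: ac_deriv_def)
  ultimately show "f y + g y - (f x + g x) = (LBINT s:{x..y}. f' s + g' s)" by simp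
qed

lemma ac_deriv_cmult:
  assumes f: "ac_deriv f f' a b"
  shows "ac_deriv (\<lambda>x. c * f x) (\<lambda>x. c * f' x) a b"
  using assms unfolding ac_deriv_def
  by (auto simp: right_diff_distrib[symmetric])

text \<open>The defect \<open>D\<close> of the formula and the mass \<open>N\<close> of |f'| are
  both additive over adjacent intervals, so |D| <= e N holds on the whole interval once it holds on
  all short intervals around each point. Bolzano's subdivision principle replaces any pointwise
  differentiation of f.\<close>

lemma ac_deriv_chain:
  assumes f: "ac_deriv f f' a b" and h: "\<And>y. (h has_real_derivative h' y) (at y)"
    and h': "continuous_on UNIV h'"
  shows "ac_deriv (\<lambda>x. h (f x)) (\<lambda>x. h' (f x) * f' x) a b"
proof -
  have cf: "continuous_on {a..b} f" using f by (rule ac_deriv_continuous)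
  have chf: "continuous_on {a..b} (\<lambda>x. h' (f x))"
    using continuous_on_compose2[OF h' cf] by auto
  have f'i: "set_integrable lborel {a..b} f'" using f by (rule ac_deriv_integrable)
  have I: "set_integrable lborel {a..b} (\<lambda>x. h' (f x) * f' x)"
    by (rule set_integrable_mult_continuous[OF f'i _ chf]) auto
  have If: "set_integrable lborel {c..d} f'" if "a \<le> c" "d \<le> b" for c d
    using that by (intro set_integrable_subset[OF f'i]) auto
  have Ic: "set_integrable lborel {c..d} (\<lambda>x. h' (f x) * f' x)" if "a \<le> c" "d \<le> b" for c d
    using that by (intro set_integrable_subset[OF I]) auto
  have Ia: "set_integrable lborel {c..d} (\<lambda>x. \<bar>f' x\<bar>)" if "a \<le> c" "d \<le> b" for c d
    using If[OF that] by (rule set_integrable_abs)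
  define D where "D c d = h (f d) - h (f c) - (LBINT s:{c..d}. h' (f s) * f' s)" for c d
  define N where "N c d = (LBINT s:{c..d}. \<bar>f' s\<bar>)" for c d
  have main: "\<bar>D x0 y0\<bar> \<le> e * N x0 y0" if xy: "a \<le> x0" "x0 \<le> y0" "y0 \<le> b" and e: "e > 0" for x0 y0 e
  proof -
    define R where "R c d \<longleftrightarrow> (x0 \<le> c \<longrightarrow> c \<le> d \<longrightarrow> d \<le> y0 \<longrightarrow> \<bar>D c d\<bar> \<le> e * N c d)" for c d
    have "R x0 y0" using \<open>x0 \<le> y0\<close>
    proof (induction rule: Bolzano)
      case (trans c d k)
      show ?case unfolding R_def
      proof (intro impI)
        assume ck: "x0 \<le> c" "c \<le> k" "k \<le> y0"
        have "(LBINT s:{c..k}. h' (f s) * f' s) = (LBINT s:{c..d}. h' (f s) * f' s) + (LBINT s:{d..k}. h' (f s) * f' s)"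
          by (rule set_integral_combine_Icc[OF Ic]) (use ck xy trans(3,4) in simp_all)
        then have "D c k = D c d + D d k" unfolding D_def by linarith
        moreover have "N c k = N c d + N d k"
          unfolding N_def by (rule set_integral_combine_Icc[OF Ia]) (use ck xy trans(3,4) in simp_all)
        ultimately show "\<bar>D c k\<bar> \<le> e * N c k"
          using trans ck unfolding R_def by (auto simp: distrib_left)
      qed
    next
      case (local x)
      have "isCont h' (f x)" using h' by (simp add: continuous_on_eq_continuous_at)
      then obtain \<eta> where \<eta>: "\<eta> > 0" "\<And>y. \<bar>y - f x\<bar> < \<eta> \<Longrightarrow> \<bar>h' y - h' (f x)\<bar> < e/2"
        using e unfolding continuous_at_eps_delta dist_real_def by (metis half_gt_zero)
      have "continuous (at x within {a..b}) f"
        using cf local xy by (simp add: continuous_on_eq_continuous_within)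
      then obtain \<delta> where \<delta>: "\<delta> > 0" "\<And>s. s \<in> {a..b} \<Longrightarrow> \<bar>s - x\<bar> < \<delta> \<Longrightarrow> \<bar>f s - f x\<bar> < \<eta>"
        using \<eta>(1) unfolding continuous_within_eps_delta dist_real_def by metis
      show ?case unfolding R_def
      proof (rule exI[of _ \<delta>], intro conjI allI impI \<delta>(1))
        fix c d assume cd: "c \<le> x \<and> x \<le> d \<and> d - c < \<delta>" "x0 \<le> c" "c \<le> d" "d \<le> y0"
        have nb: "\<bar>f s - f x\<bar> < \<eta>" if "s \<in> {c..d}" for s
          using that cd xy by (intro \<delta>) auto
        have ball: "f c \<in> ball (f x) \<eta>" "f d \<in> ball (f x) \<eta>"
          using nb[of c] nb[of d] \<open>c \<le> d\<close> by (simp_all add: dist_real_def abs_minus_commute)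
        \<comment> \<open>Half of e pays for replacing h by its tangent at f x (mean value bound),
          the other half for replacing h' (f s) by h' (f x) under the integral.\<close>
        have mv: "norm ((h (f d) - h' (f x) * f d) - (h (f c) - h' (f x) * f c)) \<le> e/2 * norm (f d - f c)"
        proof (rule field_differentiable_bound[where S = "ball (f x) \<eta>" and f' = "\<lambda>y. h' y - h' (f x)"])
          fix y assume y: "y \<in> ball (f x) \<eta>"
          show "((\<lambda>y. h y - h' (f x) * y) has_field_derivative h' y - h' (f x)) (at y within ball (f x) \<eta>)"
            by (rule has_field_derivative_at_within[OF DERIV_diff[OF h DERIV_cmult_Id]])
          have "\<bar>y - f x\<bar> < \<eta>" using y by (simp add: dist_real_def abs_minus_commute)
          from less_imp_le[OF \<eta>(2)[OF this]] show "norm (h' y - h' (f x)) \<le> e/2"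
            by (simp only: real_norm_def)
        qed (simp_all add: ball del: mem_ball)
        have fdc: "f d - f c = (LBINT s:{c..d}. f' s)"
          using f cd xy by (auto simp: ac_deriv_def)
        have "\<bar>LBINT s:{c..d}. f' s\<bar> \<le> N c d"
          unfolding N_def using set_integral_norm_bound[OF If, of c d] cd xy by simp
        then have fN: "norm (f d - f c) \<le> N c d" by (simp only: fdc real_norm_def)
        have "h (f d) - h (f c) - h' (f x) * (f d - f c) = (h (f d) - h' (f x) * f d) - (h (f c) - h' (f x) * f c)"
          by (simp only: right_diff_distrib)
        then have 1: "\<bar>h (f d) - h (f c) - h' (f x) * (f d - f c)\<bar> \<le> e/2 * N c d"
          using order_trans[OF mv mult_left_mono[OF fN, of "e/2"]] e by (simp only: real_norm_def)
        have "h' (f x) * (f d - f c) = (LBINT s:{c..d}. h' (f x) * f' s)"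
          by (simp add: fdc)
        moreover have ac: "a \<le> c" "d \<le> b" using cd xy by auto
        have Ix: "set_integrable lborel {c..d} (\<lambda>s. h' (f x) * f' s)"
          by (intro set_integrable_mult_right If ac)
        have Idf: "set_integrable lborel {c..d} (\<lambda>s. h' (f x) * f' s - h' (f s) * f' s)"
          by (rule set_integral_diff(1)[OF Ix Ic[OF ac]])
        ultimately have "h' (f x) * (f d - f c) - (LBINT s:{c..d}. h' (f s) * f' s)
            = (LBINT s:{c..d}. h' (f x) * f' s - h' (f s) * f' s)"
          using set_integral_diff(2)[OF Ix Ic[OF ac]] by simp
        moreover have "\<bar>LBINT s:{c..d}. h' (f x) * f' s - h' (f s) * f' s\<bar> \<le> (LBINT s:{c..d}. \<bar>h' (f x) * f' s - h' (f s) * f' s\<bar>)"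
          using set_integral_norm_bound[OF Idf] by (simp only: real_norm_def)
        moreover have "\<dots> \<le> (LBINT s:{c..d}. e/2 * \<bar>f' s\<bar>)"
        proof (rule set_integral_mono)
          fix s assume "s \<in> {c..d}"
          then have "\<bar>h' (f x) - h' (f s)\<bar> \<le> e/2" using \<eta>(2)[OF nb[of s]] by (simp add: abs_minus_commute)
          then show "\<bar>h' (f x) * f' s - h' (f s) * f' s\<bar> \<le> e / 2 * \<bar>f' s\<bar>"
            using mult_right_mono[of "\<bar>h' (f x) - h' (f s)\<bar>" "e/2" "\<bar>f' s\<bar>"]
            by (simp only: left_diff_distrib[symmetric] abs_mult abs_ge_zero)
        next
          show "set_integrable lborel {c..d} (\<lambda>s. \<bar>h' (f x) * f' s - h' (f s) * f' s\<bar>)"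
            by (rule set_integrable_abs[OF Idf])
          show "set_integrable lborel {c..d} (\<lambda>s. e / 2 * \<bar>f' s\<bar>)"
            by (intro set_integrable_mult_right Ia ac)
        qed
        ultimately have "\<bar>h' (f x) * (f d - f c) - (LBINT s:{c..d}. h' (f s) * f' s)\<bar> \<le> e/2 * N c d"
          unfolding N_def by simp
        with 1 show "\<bar>D c d\<bar> \<le> e * N c d" unfolding D_def abs_le_iff by (simp add: field_simps)
      qed
    qed
    then show ?thesis using xy unfolding R_def by auto
  qed
  show ?thesis unfolding ac_deriv_def
  proof (intro conjI allI impI I)
    fix x y assume xy: "a \<le> x" "x \<le> y" "y \<le> b"
    have "\<bar>D x y\<bar> \<le> 0 + e" if "e > 0" for e
    proof -
      have N0: "N x y \<ge> 0" unfolding N_def by (auto simp: set_lebesgue_integral_def)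
      have "\<bar>D x y\<bar> \<le> e / (N x y + 1) * N x y" using main[OF xy, of "e / (N x y + 1)"] that N0 by simp
      also have "\<dots> \<le> e" using N0 that by (simp add: field_simps)
      finally show ?thesis by simp
    qed
    then have "\<bar>D x y\<bar> \<le> 0" by (rule field_le_epsilon)
    then show "h (f y) - h (f x) = (LBINT s:{x..y}. h' (f s) * f' s)" unfolding D_def by simp
  qed
qed

lemma ac_deriv_power2:
  "ac_deriv f f' a b \<Longrightarrow> ac_deriv (\<lambda>x. (f x)\<^sup>2) (\<lambda>x. 2 * f x * f' x) a b"
  by (rule ac_deriv_chain[where h = "\<lambda>y. y\<^sup>2" and h' = "\<lambda>y. 2 * y"])
    (auto intro!: derivative_eq_intros continuous_intros)

text \<open>Polarisation: 4 f g is the difference of the squares of f + g and f - g.\<close>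

lemma ac_deriv_mult:
  assumes f: "ac_deriv f f' a b" and g: "ac_deriv g g' a b"
  shows "ac_deriv (\<lambda>x. f x * g x) (\<lambda>x. f' x * g x + f x * g' x) a b"
proof -
  note s = ac_deriv_power2[OF ac_deriv_add[OF f g]]
  note d = ac_deriv_power2[OF ac_deriv_add[OF f ac_deriv_cmult[OF g, of "-1"]]]
  note ac_deriv_cmult[OF ac_deriv_add[OF s ac_deriv_cmult[OF d, of "-1"]], of "1/4"]
  then show ?thesis by (rule ac_deriv_cong) (auto simp: power2_eq_square algebra_simps)
qed

text \<open>The divergence theorem on the part of a rectangle beyond a curve, which is a graph
  \<open>lu\<close> over v and a graph \<open>lv\<close> over u. Fubini's theorem integrates each of
  A and B first in the variable in which it is a derivative; the sign of A + B gives the inequality.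
  The exterior uses the triangle cut off by u = - v, the interior a full rectangle.\<close>

lemma green_inequality:
  fixes A B Ju Jv :: "real \<Rightarrow> real \<Rightarrow> real" and lu lv :: "real \<Rightarrow> real"
  assumes lum: "lu \<in> borel_measurable borel"
    and lu: "\<And>v. v \<in> {c..d} \<Longrightarrow> a \<le> lu v" and lv: "\<And>u. u \<in> {a..b} \<Longrightarrow> c \<le> lv u"
    and iff: "\<And>u v. u \<in> {a..b} \<Longrightarrow> v \<in> {c..d} \<Longrightarrow> lu v \<le> u \<longleftrightarrow> lv u \<le> v"
    and A: "set_integrable lborel ({a..b} \<times> {c..d}) (\<lambda>z. A (fst z) (snd z))"
    and B: "set_integrable lborel ({a..b} \<times> {c..d}) (\<lambda>z. B (fst z) (snd z))"
    and Ju: "\<And>v. v \<in> {c..d} \<Longrightarrow> Ju b v - Ju (lu v) v = (LBINT u:{lu v..b}. A u v)"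
    and Jv: "\<And>u. u \<in> {a..b} \<Longrightarrow> Jv u d - Jv u (lv u) = (LBINT v:{lv u..d}. B u v)"
    and le: "\<And>u v. u \<in> {a..b} \<Longrightarrow> v \<in> {c..d} \<Longrightarrow> lu v \<le> u \<Longrightarrow> A u v + B u v \<le> 0"
    and iu: "set_integrable lborel {c..d} (Ju b)" "set_integrable lborel {c..d} (\<lambda>v. Ju (lu v) v)"
    and iv: "set_integrable lborel {a..b} (\<lambda>u. Jv u d)" "set_integrable lborel {a..b} (\<lambda>u. Jv u (lv u))"
  shows "(LBINT v:{c..d}. Ju b v) + (LBINT u:{a..b}. Jv u d)
    \<le> (LBINT v:{c..d}. Ju (lu v) v) + (LBINT u:{a..b}. Jv u (lv u))"
proof -
  define T where "T = {z \<in> {a..b} \<times> {c..d}. lu (snd z) \<le> fst z}"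
  have "T \<in> sets (borel :: (real \<times> real) measure)"
  proof -
    have 1: "(\<lambda>z::real\<times>real. lu (snd z) - fst z) \<in> borel_measurable borel"
      using lum by (auto intro!: borel_measurable_diff measurable_compose[OF _ lum] simp: borel_prod[symmetric])
    have "{z \<in> space borel. lu (snd z) - fst z \<le> 0} \<in> sets (borel :: (real \<times> real) measure)"
      using 1 by measurable
    moreover have "{a..b} \<times> {c..d} \<in> sets (borel :: (real \<times> real) measure)"
      by (intro borel_closed closed_Times) auto
    ultimately have "({a..b} \<times> {c..d}) \<inter> {z \<in> space borel. lu (snd z) - fst z \<le> 0} \<in> sets borel"
      by (intro sets.Int)
    also have "({a..b} \<times> {c..d}) \<inter> {z \<in> space borel. lu (snd z) - fst z \<le> 0} = T"
      unfolding T_def by auto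
    finally show ?thesis .
  qed
  then have AT: "set_integrable lborel T (\<lambda>z. A (fst z) (snd z))"
    and BT: "set_integrable lborel T (\<lambda>z. B (fst z) (snd z))"
    by (auto intro: set_integrable_subset[OF A] set_integrable_subset[OF B] simp: T_def)
  have fA: "integrable (lborel \<Otimes>\<^sub>M lborel) (case_prod (\<lambda>u v. indicator T (u,v) * A u v))"
    and fB: "integrable (lborel \<Otimes>\<^sub>M lborel) (case_prod (\<lambda>u v. indicator T (u,v) * B u v))"
    using AT BT unfolding set_integrable_def lborel_prod by (simp_all add: case_prod_beta')
  have ind: "indicat_real T (u,v) = indicator {c..d} v * indicator {lu v..b} u" for u v
    using lu[of v] by (auto simp: T_def indicator_def)
  have ind': "indicat_real T (u,v) = indicator {a..b} u * indicator {lv u..d} v" for u v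
    using lv[of u] iff[of u v] by (auto simp: T_def indicator_def)
  have a1: "(LINT z|lborel. indicator T z * A (fst z) (snd z)) = (LINT v|lborel. LINT u|lborel. indicator T (u,v) * A u v)"
    using lborel_pair.integral_snd[OF fA] by (simp add: lborel_prod case_prod_beta')
  also have "\<dots> = (LBINT v:{c..d}. Ju b v - Ju (lu v) v)"
    unfolding set_lebesgue_integral_def
  proof (intro Bochner_Integration.integral_cong refl)
    fix v
    show "(LINT u|lborel. indicator T (u, v) * A u v) = indicat_real {c..d} v *\<^sub>R (Ju b v - Ju (lu v) v)"
    proof (cases "v \<in> {c..d}")
      case True
      then show ?thesis using Ju[OF True]
        by (simp add: ind set_lebesgue_integral_def)
    qed (simp add: ind)
  qed
  finally have 1: "(LINT z|lborel. indicator T z * A (fst z) (snd z)) = (LBINT v:{c..d}. Ju b v) - (LBINT v:{c..d}. Ju (lu v) v)"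
    using iu by (simp add: set_integral_diff)
  have a2: "(LINT z|lborel. indicator T z * B (fst z) (snd z)) = (LINT u|lborel. LINT v|lborel. indicator T (u,v) * B u v)"
    using lborel_pair.integral_fst'[OF fB] by (simp add: lborel_prod case_prod_beta')
  also have "\<dots> = (LBINT u:{a..b}. Jv u d - Jv u (lv u))"
    unfolding set_lebesgue_integral_def
  proof (intro Bochner_Integration.integral_cong refl)
    fix u
    show "(LINT v|lborel. indicator T (u, v) * B u v) = indicat_real {a..b} u *\<^sub>R (Jv u d - Jv u (lv u))"
    proof (cases "u \<in> {a..b}")
      case True
      then show ?thesis using Jv[OF True]
        by (simp add: ind' set_lebesgue_integral_def)
    qed (simp add: ind')
  qed
  finally have 2: "(LINT z|lborel. indicator T z * B (fst z) (snd z)) = (LBINT u:{a..b}. Jv u d) - (LBINT u:{a..b}. Jv u (lv u))"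
    using iv by (simp add: set_integral_diff)
  have "(LINT z|lborel. indicator T z * A (fst z) (snd z)) + (LINT z|lborel. indicator T z * B (fst z) (snd z))
     = (LINT z|lborel. indicator T z * A (fst z) (snd z) + indicator T z * B (fst z) (snd z))"
    using AT BT unfolding set_integrable_def by (subst Bochner_Integration.integral_add) auto
  also have "\<dots> \<le> (LINT z|lborel. 0 * z)"
  proof -
    have "(LINT z|lborel. indicator T z * A (fst z) (snd z) + indicator T z * B (fst z) (snd z)) \<le> 0"
    proof -
      have "0 \<le> (LINT z|lborel. - (indicator T z * A (fst z) (snd z) + indicator T z * B (fst z) (snd z)))"
        by (intro Bochner_Integration.integral_nonneg)
            (use le in \<open>force simp: T_def indicator_def minus_le_iff dest!: le\<close>)
      then show ?thesis unfolding Bochner_Integration.integral_minus by linarith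
    qed
    then show ?thesis by simp
  qed
  finally show ?thesis using 1 2 by simp
qed

section \<open>Smooth test functions\<close>

lemma dir_deriv_eqI: "(\<And>z. (f has_derivative D z) (at z)) \<Longrightarrow> dir_deriv v f = (\<lambda>z. D z v)"
  unfolding dir_deriv_def by (rule ext) (metis frechet_derivative_at)

lemma has_derivative_dir_deriv:
  "f differentiable (at z) \<Longrightarrow> (f has_derivative (\<lambda>v. dir_deriv v f z)) (at z)"
  unfolding dir_deriv_def by (metis eta_contract_eq frechet_derivative_works)

lemma C_k_SucI:
  assumes "\<And>z. (f has_derivative D z) (at z)" "\<And>v. C_k k (\<lambda>z. D z v)"
  shows "C_k (Suc k) f"
  using assms dir_deriv_eqI[of f D] by (auto simp: differentiable_def)

lemma C_k_Suc_imp: "C_k (Suc k) f \<Longrightarrow> C_k k f"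
proof (induction k arbitrary: f)
  case 0
  then show ?case
    by (auto simp: continuous_on_eq_continuous_at intro: differentiable_imp_continuous_within)
next
  case (Suc k)
  then show ?case by (metis C_k.simps(2))
qed

lemma C_k_const: "C_k k (\<lambda>z. c)"
proof (induction k arbitrary: c)
  case (Suc k)
  show ?case by (rule C_k_SucI[where D = "\<lambda>z v. 0"]) (use Suc in auto)
qed simp

lemma C_k_add: "C_k k f \<Longrightarrow> C_k k g \<Longrightarrow> C_k k (\<lambda>z. f z + g z)"
proof (induction k arbitrary: f g)
  case 0
  then show ?case by (simp add: continuous_on_add)
next
  case (Suc k)
  show ?case
    by (rule C_k_SucI[where D = "\<lambda>z v. dir_deriv v f z + dir_deriv v g z"])
      (use Suc in \<open>auto intro!: has_derivative_add has_derivative_dir_deriv\<close>)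
qed

lemma C_k_mult: "C_k k f \<Longrightarrow> C_k k g \<Longrightarrow> C_k k (\<lambda>z. f z * g z)"
proof (induction k arbitrary: f g)
  case 0
  then show ?case by (simp add: continuous_on_mult)
next
  case (Suc k)
  have *: "C_k k (\<lambda>z. f z * dir_deriv v g z + dir_deriv v f z * g z)" for v
    using Suc.prems C_k_Suc_imp[OF Suc.prems(1)] C_k_Suc_imp[OF Suc.prems(2)]
    by (intro C_k_add Suc.IH) auto
  show ?case
    by (rule C_k_SucI[where D = "\<lambda>z v. f z * dir_deriv v g z + dir_deriv v f z * g z"])
      (use Suc.prems * in \<open>auto intro!: has_derivative_mult has_derivative_dir_deriv\<close>)
qed

lemma C_k_real_SucI:
  fixes f :: "real \<Rightarrow> real"
  assumes "\<And>x. (f has_real_derivative f' x) (at x)" "C_k k f'"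
  shows "C_k (Suc k) f"
proof (rule C_k_SucI[where D = "\<lambda>z v. f' z * v"])
  show "C_k k (\<lambda>z. f' z * v)" for v
    using C_k_mult[OF assms(2) C_k_const] .
qed (use assms(1) in \<open>simp add: has_field_derivative_def\<close>)

lemma C_k_real_SucD:
  fixes f :: "real \<Rightarrow> real"
  assumes "C_k (Suc k) f"
  shows "(f has_real_derivative dir_deriv 1 f x) (at x)" "C_k k (dir_deriv 1 f)"
proof -
  have "(f has_derivative (\<lambda>v. dir_deriv v f x)) (at x)"
    using assms by (intro has_derivative_dir_deriv) auto
  moreover have "(\<lambda>v. dir_deriv v f x) = (\<lambda>v. dir_deriv 1 f x * v)"
  proof
    fix v :: real
    show "dir_deriv v f x = dir_deriv 1 f x * v"
      using linear_cmul[OF has_derivative_linear[OF calculation], of v 1] by (simp only: real_scaleR_def mult_1_right mult_1_left mult.commute)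
  qed
  ultimately show "(f has_real_derivative dir_deriv 1 f x) (at x)"
    unfolding has_field_derivative_def by argo
qed (use assms in auto)

lemma C_k_compose_affine:
  fixes g :: "real \<Rightarrow> real" and l :: "'a::euclidean_space \<Rightarrow> real"
  assumes l: "bounded_linear l"
  shows "C_k k g \<Longrightarrow> C_k k (\<lambda>z. g (l z + c))"
proof (induction k arbitrary: g)
  case 0
  have "continuous_on UNIV (\<lambda>z. l z + c)"
    using l by (intro continuous_intros) (simp add: linear_continuous_on)
  then show ?case using 0 by (auto intro: continuous_on_compose2)
next
  case (Suc k)
  note d = C_k_real_SucD[OF Suc.prems]
  show ?case
  proof (rule C_k_SucI[where D = "\<lambda>z v. dir_deriv 1 g (l z + c) * l v"])
    fix z
    have "((\<lambda>z. l z + c) has_derivative l) (at z)"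
      using bounded_linear_imp_has_derivative[OF l] by (auto intro!: derivative_eq_intros)
    from has_derivative_compose[OF this d(1)[unfolded has_field_derivative_def]]
    show "((\<lambda>z. g (l z + c)) has_derivative (\<lambda>v. dir_deriv 1 g (l z + c) * l v)) (at z)" .
    show "C_k k (\<lambda>z. dir_deriv 1 g (l z + c) * l v)" for v
      using C_k_mult[OF Suc.IH[OF d(2)] C_k_const] .
  qed
qed

text \<open>The index n makes the family closed under differentiation up to linear combinations, so
  smoothness is one induction for all n.\<close>

definition flat_exp :: "nat \<Rightarrow> real \<Rightarrow> real" where
  "flat_exp n x = (if x > 0 then exp (- 1 / x) / x ^ n else 0)"

lemma flat_exp_tendsto_0: "(flat_exp n \<longlongrightarrow> 0) (at_right 0)"
proof -
  have "((\<lambda>y::real. y ^ n / exp y) \<longlongrightarrow> 0) at_top"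
    by (rule tendsto_power_div_exp_0)
  then have "((\<lambda>x::real. inverse x ^ n / exp (inverse x)) \<longlongrightarrow> 0) (at_right 0)"
    by (rule filterlim_compose[OF _ filterlim_inverse_at_top_right])
  then show ?thesis
  proof (rule Lim_transform_eventually)
    show "\<forall>\<^sub>F x in at_right 0. inverse x ^ n / exp (inverse x) = flat_exp n x"
      using eventually_at_right_less[of "0::real"]
      by eventually_elim (simp add: flat_exp_def exp_minus field_simps)
  qed
qed

lemma flat_exp_has_derivative:
  "(flat_exp n has_real_derivative flat_exp (n + 2) x - real n * flat_exp (n + 1) x) (at x)"
proof -
  consider "x < 0" | "x > 0" | "x = 0" by linarith
  then show ?thesis
  proof cases
    case 1
    have "((\<lambda>x. 0) has_real_derivative 0) (at x)" by simp
    then have "(flat_exp n has_real_derivative 0) (at x)"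
      by (rule has_field_derivative_transform_within_open[of _ _ _ "{..<0}"])
        (use 1 in \<open>auto simp: flat_exp_def\<close>)
    then show ?thesis using 1 by (simp add: flat_exp_def)
  next
    case 2
    have i: "(inverse has_real_derivative - (inverse x ^ Suc (Suc 0))) (at x)"
      using 2 DERIV_inverse[of x UNIV] by simp
    have "((\<lambda>x. exp (- inverse x) * inverse x ^ n) has_real_derivative
        flat_exp (n + 2) x - real n * flat_exp (n + 1) x) (at x)"
      by (rule DERIV_cong[OF DERIV_mult[OF DERIV_fun_exp[OF DERIV_minus[OF i]] DERIV_power[OF i, of n]]])
        (use 2 in \<open>cases n; simp add: flat_exp_def field_simps\<close>)
    then show ?thesis
      by (rule has_field_derivative_transform_within_open[of _ _ _ "{0<..}"])
        (use 2 in \<open>auto simp: flat_exp_def field_simps\<close>)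
  next
    case 3
    \<comment> \<open>On the right the difference quotient at 0 is \<open>flat_exp (Suc n)\<close>,
      which tends to 0; on the left it is constantly 0.\<close>
    have "((\<lambda>h. flat_exp n h / h) \<longlongrightarrow> 0) (at 0)"
    proof (rule filterlim_split_at)
      show "((\<lambda>h. flat_exp n h / h) \<longlongrightarrow> 0) (at_right 0)"
      proof (rule Lim_transform_eventually[OF flat_exp_tendsto_0[of "Suc n"]])
        show "\<forall>\<^sub>F x in at_right 0. flat_exp (Suc n) x = flat_exp n x / x"
          using eventually_at_right_less[of "0::real"]
          by eventually_elim (simp add: flat_exp_def field_simps)
      qed
      show "((\<lambda>h. flat_exp n h / h) \<longlongrightarrow> 0) (at_left 0)"
      proof (rule Lim_transform_eventually[OF tendsto_const])
        show "\<forall>\<^sub>F x in at_left 0. 0 = flat_exp n x / x"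
          unfolding eventually_at_left_field by (auto simp: flat_exp_def intro!: exI[of _ "-1"])
      qed
    qed
    then show ?thesis using 3 by (simp add: DERIV_def flat_exp_def)
  qed
qed

lemma flat_exp_C_k: "C_k k (flat_exp n)"
proof (induction k arbitrary: n)
  case 0
  show ?case
    using DERIV_isCont[OF flat_exp_has_derivative] by (simp add: continuous_at_imp_continuous_on)
next
  case (Suc k)
  have "C_k k (\<lambda>x. flat_exp (n + 2) x + (- real n) * flat_exp (n + 1) x)"
    by (intro C_k_add C_k_mult C_k_const Suc)
  then show ?case
    by (intro C_k_real_SucI[OF flat_exp_has_derivative]) simp
qed

lemma smooth_bump_exists:
  obtains \<rho> :: "real \<Rightarrow> real" where "\<And>k. C_k k \<rho>" "\<And>x. 0 \<le> \<rho> x" "\<And>x. x \<notin> {0<..<1} \<Longrightarrow> \<rho> x = 0"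
    "integral {0..1} \<rho> = 1"
proof -
  define r where "r x = flat_exp 0 x * flat_exp 0 (1 - x)" for x
  have Cr: "C_k k r" for k
  proof -
    have "C_k k (\<lambda>x::real. flat_exp 0 (- x + 1))"
      by (rule C_k_compose_affine[OF _ flat_exp_C_k]) (rule bounded_linear_minus[OF bounded_linear_ident])
    then show ?thesis unfolding r_def[abs_def] using C_k_mult[OF flat_exp_C_k] by simp
  qed
  then have cr: "continuous_on UNIV r" using C_k.simps(1) by blast
  have r0: "0 \<le> r x" for x by (simp add: r_def flat_exp_def)
  have r1: "r x = 0" if "x \<notin> {0<..<1}" for x using that by (auto simp: r_def flat_exp_def)
  define I where "I = integral {0..1} r"
  have "I \<noteq> 0"
  proof
    assume "I = 0"
    then have "r (1/2) = 0"
      using integral_eq_0_iff[of 0 1 r] continuous_on_subset[OF cr] r0 unfolding I_def by auto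
    then show False by (simp add: r_def flat_exp_def)
  qed
  moreover have "I \<ge> 0" unfolding I_def
    by (intro integral_nonneg integrable_continuous_real continuous_on_subset[OF cr]) (auto simp: r0)
  ultimately have I: "I > 0" by simp
  show ?thesis
  proof
    show "C_k k (\<lambda>x. r x * (1 / I))" for k by (intro C_k_mult C_k_const Cr)
    show "integral {0..1} (\<lambda>x. r x * (1 / I)) = 1"
      using I by (subst integral_mult_left) (simp add: I_def[symmetric])
  qed (use I r0 r1 in auto)
qed

lemma smooth_step_exists:
  obtains H \<rho> :: "real \<Rightarrow> real" where "\<And>k. C_k k H" "\<And>k. C_k k \<rho>"
    "\<And>x. (H has_real_derivative \<rho> x) (at x)"
    "\<And>x. 0 \<le> \<rho> x" "\<And>x. x \<notin> {0<..<1} \<Longrightarrow> \<rho> x = 0" "(LBINT x. \<rho> x) = 1"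
    "\<And>x. x \<le> 0 \<Longrightarrow> H x = 0" "\<And>x. x \<ge> 1 \<Longrightarrow> H x = 1" "\<And>x. 0 \<le> H x" "\<And>x. H x \<le> 1"
proof -
  obtain \<rho> :: "real \<Rightarrow> real" where \<rho>: "\<And>k. C_k k \<rho>" "\<And>x. 0 \<le> \<rho> x" "\<And>x. x \<notin> {0<..<1} \<Longrightarrow> \<rho> x = 0"
    "integral {0..1} \<rho> = 1" using smooth_bump_exists by blast
  have c: "continuous_on UNIV \<rho>" using \<rho>(1) C_k.simps(1) by blast
  then have i: "\<rho> integrable_on {a..b}" for a b
    by (intro integrable_continuous_real) (rule continuous_on_subset, auto)
  \<comment> \<open>For x <= 0 the interval is a single point, so H vanishes there without a case
    distinction.\<close>
  define H where "H x = integral {min x 0..x} \<rho>" for x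
  have H0: "H x = 0" if "x \<le> 0" for x using that by (simp add: H_def)
  have Heq: "H x = integral {a..x} \<rho>" if "a \<le> x" "a \<le> 0" for a x
  proof -
    have "integral {a..min x 0} \<rho> = integral {a..min x 0} (\<lambda>x. 0)"
      by (rule integral_cong) (auto intro: \<rho>(3))
    moreover have "integral {a..min x 0} \<rho> + integral {min x 0..x} \<rho> = integral {a..x} \<rho>"
      using that by (intro Henstock_Kurzweil_Integration.integral_combine i) auto
    ultimately show ?thesis by (simp add: H_def)
  qed
  have H1: "H x = 1" if "x \<ge> 1" for x
  proof -
    have "integral {1..x} \<rho> = integral {1..x} (\<lambda>x. 0)"
      by (rule integral_cong) (auto intro: \<rho>(3))
    moreover have "integral {0..1} \<rho> + integral {1..x} \<rho> = integral {0..x} \<rho>"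
      using that by (intro Henstock_Kurzweil_Integration.integral_combine i) auto
    ultimately show ?thesis using Heq[of 0 x] that \<rho>(4) by simp
  qed
  have Hd: "(H has_real_derivative \<rho> x) (at x)" for x
  proof -
    define a where "a = min x 0 - 1"
    have "((\<lambda>y. integral {a..y} \<rho>) has_real_derivative \<rho> x) (at x within {a..x+1})"
      by (rule integral_has_real_derivative) (auto simp: a_def intro: continuous_on_subset[OF c])
    moreover have "at x within {a..x+1} = at x"
      by (rule at_within_interior) (auto simp: a_def)
    ultimately have "((\<lambda>y. integral {a..y} \<rho>) has_real_derivative \<rho> x) (at x)" by simp
    then show ?thesis
      by (rule has_field_derivative_transform_within_open[of _ _ _ "{a<..}"])
        (auto simp: a_def intro!: Heq[symmetric])
  qed
  have mono: "H x \<le> H y" if "x \<le> y" for x y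
    using Hd \<rho>(2) that by (intro DERIV_nonneg_imp_nondecreasing[of x y H]) auto
  show ?thesis
  proof (rule that[of H \<rho>])
    show "C_k k H" for k
    proof (cases k)
      case 0
      then show ?thesis using Hd by (auto intro!: continuous_at_imp_continuous_on DERIV_isCont)
    qed (use C_k_real_SucI[OF Hd \<rho>(1)] in simp)
    show "0 \<le> H x" for x using mono[of "min x 0" x] H0[of "min x 0"] by simp
    show "H x \<le> 1" for x using mono[of x "max x 1"] H1[of "max x 1"] by simp
    have "set_integrable lborel {0..1} \<rho>"
      unfolding set_integrable_def using borel_integrable_atLeastAtMost'[of 0 1 \<rho>] continuous_on_subset[OF c]
      by (simp add: set_integrable_def)
    then have "(LBINT x:{0..1}. \<rho> x) = 1"
      using set_borel_integral_eq_integral(2) \<rho>(4) by metis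
    moreover have "(LBINT x:{0..1}. \<rho> x) = (LBINT x. \<rho> x)"
      unfolding set_lebesgue_integral_def
    proof (rule Bochner_Integration.integral_cong[OF refl])
      fix x show "indicat_real {0..1} x *\<^sub>R \<rho> x = \<rho> x"
        by (cases "x \<in> {0<..<1}") (auto simp: \<rho>(3))
    qed
    ultimately show "(LBINT x. \<rho> x) = 1" by simp
  qed (use \<rho> Hd H0 H1 in auto)
qed

section \<open>Decay along a characteristic ray\<close>

lemma ac_deriv_weight_mult:
  assumes w: "\<And>x. x \<in> {a..b} \<Longrightarrow> (w has_real_derivative w' x) (at x)" "continuous_on {a..b} w'"
    and f: "ac_deriv f f' a b"
  shows "ac_deriv (\<lambda>x. w x * f x) (\<lambda>x. w' x * f x + w x * f' x) a b"
  by (rule ac_deriv_mult[OF ac_deriv_C1[OF w] f])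

lemma set_integral_reflect:
  fixes f :: "real \<Rightarrow> real"
  shows "(LBINT x:{a..b}. f (- x)) = (LBINT x:{-b..-a}. f x)"
    and "set_integrable lborel {a..b} (\<lambda>x. f (- x)) \<longleftrightarrow> set_integrable lborel {-b..-a} f"
proof -
  have ind: "indicator {a..b} x = (indicator {-b..-a} (- x) :: real)" for x :: real
    by (auto simp: indicator_def)
  show "(LBINT x:{a..b}. f (- x)) = (LBINT x:{-b..-a}. f x)"
    unfolding set_lebesgue_integral_def ind
    using lborel_integral_real_affine[of "-1" "\<lambda>x. indicator {-b..-a} x *\<^sub>R f x" 0] by simp
  show "set_integrable lborel {a..b} (\<lambda>x. f (- x)) \<longleftrightarrow> set_integrable lborel {-b..-a} f"
    unfolding set_integrable_def ind
    using lborel_integrable_real_affine_iff[of "-1" "\<lambda>x. indicator {-b..-a} x *\<^sub>R f x" 0] by simp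
qed

lemma ac_deriv_reflect:
  assumes "ac_deriv f f' (- b) (- a)"
  shows "ac_deriv (\<lambda>x. f (- x)) (\<lambda>x. - f' (- x)) a b"
  unfolding ac_deriv_def
proof (intro conjI allI impI)
  show "set_integrable lborel {a..b} (\<lambda>x. - f' (- x))"
    using ac_deriv_integrable[OF assms] set_integral_reflect(2)[of a b f'] by (simp add: set_integrable_def)
  fix x y assume "a \<le> x" "x \<le> y" "y \<le> b"
  then have "f (- x) - f (- y) = (LBINT s:{-y..-x}. f' s)"
    using assms by (simp add: ac_deriv_def)
  then show "f (- y) - f (- x) = (LBINT s:{x..y}. - f' (- s))"
    using set_integral_reflect(1)[of x y f'] by (simp add: set_lebesgue_integral_def)
qed

lemma integrable_fst_rect:
  fixes g :: "real \<Rightarrow> real" and c d :: real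
  assumes g: "set_integrable lborel {a..b} g"
  shows "set_integrable lborel ({a..b} \<times> {c..d}) (\<lambda>z. g (fst z))"
    and "set_integrable lborel ({c..d} \<times> {a..b}) (\<lambda>z. g (snd z))"
proof -
  define G where "G x = indicat_real {a..b} x * g x" for x
  have gi: "integrable lborel G"
    using g by (simp add: set_integrable_def G_def[abs_def])
  then have gm: "G \<in> borel_measurable lborel" by (rule borel_measurable_integrable)
  have i: "integrable (lborel \<Otimes>\<^sub>M lborel) (\<lambda>z. G (fst z) * indicat_real {c..d} (snd z))"
  proof (rule lborel_pair.Fubini_integrable)
    have "(\<lambda>z. indicat_real {c..d} (snd z)) \<in> borel_measurable (lborel \<Otimes>\<^sub>M lborel)"
      by (rule measurable_compose[OF measurable_snd]) (simp add: borel_measurable_indicator)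
    then show "(\<lambda>z. G (fst z) * indicat_real {c..d} (snd z)) \<in> borel_measurable (lborel \<Otimes>\<^sub>M lborel)"
      by (intro borel_measurable_times measurable_compose[OF measurable_fst gm])
    show "integrable lborel (\<lambda>x. LINT y|lborel. norm (G (fst (x, y)) * indicat_real {c..d} (snd (x, y))))"
      using integrable_norm[OF gi] by (simp add: abs_mult)
    have "integrable lborel (indicat_real {c..d})"
      using set_integrable_continuous[of "{c..d}" "\<lambda>_. 1"] by (simp add: set_integrable_def)
    then show "AE x in lborel. integrable lborel (\<lambda>y. G (fst (x, y)) * indicat_real {c..d} (snd (x, y)))"
      by simp
  qed
  have eq: "indicator ({a..b} \<times> {c..d}) z *\<^sub>R g (fst z) = G (fst z) * indicat_real {c..d} (snd z)" for z
    by (auto simp: indicator_def G_def mem_Times_iff)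
  show "set_integrable lborel ({a..b} \<times> {c..d}) (\<lambda>z. g (fst z))"
    using i unfolding set_integrable_def eq lborel_prod by simp
  have eq': "indicator ({c..d} \<times> {a..b}) z *\<^sub>R g (snd z) = (\<lambda>(x,y). (\<lambda>z. G (fst z) * indicat_real {c..d} (snd z)) (y, x)) z" for z
    by (cases z) (auto simp: indicator_def G_def)
  show "set_integrable lborel ({c..d} \<times> {a..b}) (\<lambda>z. g (snd z))"
    using lborel_pair.integrable_product_swap[OF i] unfolding set_integrable_def eq' lborel_prod by simp
qed

lemma set_integrable_dominated:
  fixes f g :: "'a::euclidean_space \<Rightarrow> real"
  assumes "set_integrable lborel K g" "f \<in> borel_measurable borel" "compact K"
    "\<And>z. z \<in> K \<Longrightarrow> \<bar>f z\<bar> \<le> g z"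
  shows "set_integrable lborel K f"
proof (rule set_integrable_bound[OF assms(1)])
  have "K \<in> sets borel" using assms(3) by (simp add: borel_compact)
  then show "set_borel_measurable lborel K f"
    unfolding set_borel_measurable_def using assms(2) by simp
  show "AE x in lborel. x \<in> K \<longrightarrow> norm (f x) \<le> norm (g x)"
    using assms(4) by (force intro!: AE_I2)
qed

section \<open>The power nonlinearity and its potential\<close>

lemma abs_powr_has_derivative:
  assumes "q > 2"
  shows "((\<lambda>y. \<bar>y\<bar> powr q) has_real_derivative q * (\<bar>y\<bar> powr (q - 2) * y)) (at y)"
proof -
  consider "y > 0" | "y < 0" | "y = 0" by linarith
  then show ?thesis
  proof cases
    case 1
    have "((\<lambda>y. y powr q) has_real_derivative q * y powr (q - 1)) (at y)"
      using 1 by (rule has_real_derivative_powr)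
    then have "((\<lambda>y. \<bar>y\<bar> powr q) has_real_derivative q * y powr (q - 1)) (at y)"
      by (rule has_field_derivative_transform_within_open[of _ _ _ "{0<..}"]) (use 1 in auto)
    moreover have "y powr (q - 2) * y = y powr (q - 1)"
      using 1 powr_add[of y "q - 2" 1] by simp
    ultimately show ?thesis using 1 by simp
  next
    case 2
    have "((\<lambda>y. (- y) powr q) has_real_derivative q * (- y) powr (q - 1) * (- 1)) (at y)"
      using 2 by (intro DERIV_chain'[of uminus "-1" y UNIV "\<lambda>y. y powr q"] has_real_derivative_powr)
        (auto intro!: derivative_eq_intros)
    then have "((\<lambda>y. \<bar>y\<bar> powr q) has_real_derivative q * (- y) powr (q - 1) * (- 1)) (at y)"
      by (rule has_field_derivative_transform_within_open[of _ _ _ "{..<0}"]) (use 2 in auto)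
    moreover have e: "(- y) powr (q - 1) = (- y) powr (q - 2) * (- y)"
      using 2 powr_add[of "- y" "q - 2" 1] by simp
    have "q * (- y) powr (q - 1) * (- 1) = q * (\<bar>y\<bar> powr (q - 2) * y)"
      unfolding e using 2 by simp
    ultimately show ?thesis by (simp only:)
  next
    case 3
    have "((\<lambda>h. \<bar>h\<bar> powr (q - 2) * h) \<longlongrightarrow> \<bar>0\<bar> powr (q - 2) * 0) (at 0)"
      using assms by (intro tendsto_intros tendsto_powr') auto
    moreover have "\<bar>h\<bar> powr (q - 2) * h = \<bar>h\<bar> powr q / h" for h :: real
    proof (cases "h = 0")
      case False
      then have "\<bar>h\<bar> powr q = \<bar>h\<bar> powr (q - 2) * \<bar>h\<bar>\<^sup>2"
        using powr_add[of "\<bar>h\<bar>" "q - 2" 2] by simp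
      with False show ?thesis by (simp add: power2_eq_square)
    qed simp
    ultimately show ?thesis using 3 by (simp add: DERIV_def)
  qed
qed

definition nl :: "real \<Rightarrow> real \<Rightarrow> real" where "nl p y = \<bar>y\<bar> powr (p - 1) * y"
definition pot :: "real \<Rightarrow> real \<Rightarrow> real" where "pot p y = 2 / (p + 1) * \<bar>y\<bar> powr (p + 1)"

lemma nl_continuous: "p > 1 \<Longrightarrow> continuous_on S (nl p)"
  unfolding nl_def by (intro continuous_intros continuous_on_powr') auto

lemma pot_nonneg: "p > 1 \<Longrightarrow> 0 \<le> pot p y" by (simp add: pot_def)

lemma pot_has_derivative:
  assumes "p > 1" shows "(pot p has_real_derivative 2 * nl p y) (at y)"
  unfolding pot_def nl_def
  using DERIV_cmult[OF abs_powr_has_derivative[of "p + 1" y], of "2 / (p + 1)"] assms by simp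

lemma pot_continuous: "p > 1 \<Longrightarrow> continuous_on S (pot p)"
  by (meson DERIV_isCont continuous_at_imp_continuous_on pot_has_derivative)

lemma mult_nl:
  assumes "p > 1" shows "y * nl p y = (p + 1) / 2 * pot p y"
proof (cases "y = 0")
  case False
  then have "\<bar>y\<bar> powr (p + 1) = \<bar>y\<bar> powr (p - 1) * (y * y)"
    using powr_add[of "\<bar>y\<bar>" "p - 1" 2] by (simp add: power2_eq_square add.commute)
  then show ?thesis using assms by (simp add: nl_def pot_def)
qed (simp add: nl_def pot_def)

lemma ac_deriv_pot:
  "p > 1 \<Longrightarrow> ac_deriv f f' a b \<Longrightarrow> ac_deriv (\<lambda>x. pot p (f x)) (\<lambda>x. 2 * nl p (f x) * f' x) a b"
  by (rule ac_deriv_chain[where h = "pot p" and h' = "\<lambda>y. 2 * nl p y"])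
    (auto intro!: pot_has_derivative continuous_intros nl_continuous)

text \<open>With q = (p + 3) / 2 one has 2 (q - 1) = p + 1, so |y| powr (q - 1) * |y'| is at most a
  geometric mean of a y'^2 and b |y| powr (p + 1) divided by m. The derivative of |y| powr q is
  integrated back from a point V where this power is at most e. In the constant, (p + 3) / 2 comes
  from differentiating the power and (p + 1) / 2 from the normalisation of
  \<open>pot\<close>.\<close>

lemma decay_along_ray:
  fixes y y' a b :: "real \<Rightarrow> real"
  assumes p: "p > 1" and y: "\<And>V. ac_deriv y y' v0 V" and v0: "v0 \<ge> 0"
    and a: "\<And>v. v \<ge> v0 \<Longrightarrow> 0 \<le> a v" and m: "m > 0" "\<And>v. v \<ge> v0 \<Longrightarrow> m\<^sup>2 \<le> a v * b v"
    and \<kappa>: "\<kappa> > 0" "\<And>v. v \<ge> v0 \<Longrightarrow> \<kappa> / (1 + v) \<le> b v"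
    and i: "\<And>V. V \<ge> v0 \<Longrightarrow> set_integrable lborel {v0..V} (\<lambda>v. a v * (y' v)\<^sup>2 + b v * pot p (y v))"
    and K: "\<And>V. V \<ge> v0 \<Longrightarrow> (LBINT v:{v0..V}. a v * (y' v)\<^sup>2 + b v * pot p (y v)) \<le> K"
  shows "\<bar>y v0\<bar> powr ((p + 3) / 2) \<le> (p + 3) * (p + 1) / 4 * K / m"
proof (rule field_le_epsilon)
  fix e :: real assume e: "e > 0"
  define q where "q = (p + 3) / 2"
  have q: "q > 2" using p by (simp add: q_def)
  have b: "0 \<le> b v" if "v \<ge> v0" for v
  proof -
    have "0 \<le> \<kappa> / (1 + v)" using that v0 \<kappa>(1) by simp
    then show ?thesis using \<kappa>(2)[OF that] by linarith
  qed
  define W where "W v = a v * (y' v)\<^sup>2 + b v * pot p (y v)" for v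
  have W0: "0 \<le> W v" if "v \<ge> v0" for v
    unfolding W_def using a b pot_nonneg[OF p] that by simp
  obtain V where V: "V \<ge> v0" "\<bar>y V\<bar> powr q \<le> e"
  proof -
    have "\<exists>V\<ge>v0. \<bar>y V\<bar> powr q \<le> e"
    proof (rule ccontr)
      assume "\<not> ?thesis"
      then have big: "\<bar>y v\<bar> powr q > e" if "v \<ge> v0" for v using that by force
      define \<delta> where "\<delta> = e powr ((p + 1) / q)"
      have \<delta>: "\<delta> > 0" using e by (simp add: \<delta>_def)
      have yb: "\<delta> \<le> \<bar>y v\<bar> powr (p + 1)" if "v \<ge> v0" for v
      proof -
        have "\<delta> \<le> (\<bar>y v\<bar> powr q) powr ((p + 1) / q)"
          unfolding \<delta>_def using big[OF that] e p q by (intro powr_mono2) auto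
        also have "\<dots> = \<bar>y v\<bar> powr (p + 1)" using q by (simp add: powr_powr)
        finally show ?thesis .
      qed
      define c where "c = \<kappa> * (2 / (p + 1) * \<delta>)"
      have c: "c > 0" using \<kappa> \<delta> p by (simp add: c_def)
      have Wb: "c / (1 + v) \<le> W v" if "v \<ge> v0" for v
      proof -
        have "c / (1 + v) = \<kappa> / (1 + v) * (2 / (p + 1) * \<delta>)" by (simp add: c_def)
        also have "\<dots> \<le> b v * pot p (y v)"
          unfolding pot_def using \<kappa>(2)[OF that] yb[OF that] \<delta> p b[OF that] by (intro mult_mono) auto
        also have "\<dots> \<le> W v" unfolding W_def using a[OF that] by simp
        finally show ?thesis .
      qed
      \<comment> \<open>If |y| stayed away from 0, the integrand would dominate c / (1 + v). This V
        makes the logarithmic integral of c / (1 + v) equal to |K| + c, which exceeds the bound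
        K.\<close>
      define V where "V = (1 + v0) * exp (\<bar>K\<bar> / c + 1) - 1"
      have "1 \<le> exp (\<bar>K\<bar> / c + 1)" using c by simp
      then have "1 + v0 \<le> (1 + v0) * exp (\<bar>K\<bar> / c + 1)"
        using mult_left_mono[of 1 "exp (\<bar>K\<bar> / c + 1)" "1 + v0"] v0 by (simp only: mult_1_right)
      then have V: "V \<ge> v0" unfolding V_def by linarith
      have acl: "ac_deriv (\<lambda>v. c * ln (1 + v)) (\<lambda>v. c / (1 + v)) v0 V"
        using v0 by (intro ac_deriv_C1) (auto intro!: derivative_eq_intros continuous_intros)
      have "ln (1 + V) = ln (1 + v0) + (\<bar>K\<bar> / c + 1)"
        unfolding V_def using v0 by (simp add: ln_mult)
      then have "\<bar>K\<bar> + c = c * ln (1 + V) - c * ln (1 + v0)"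
        using c by (simp add: field_simps)
      also have "\<dots> = (LBINT v:{v0..V}. c / (1 + v))"
        using ac_deriv_eq[OF acl V] .
      also have "\<dots> \<le> (LBINT v:{v0..V}. W v)"
        using ac_deriv_integrable[OF acl] i[OF V] Wb unfolding W_def by (intro set_integral_mono) auto
      also have "\<dots> \<le> K" using K[OF V] by (simp add: W_def)
      finally show False using c by simp
    qed
    then show ?thesis using that by blast
  qed
  have ac: "ac_deriv (\<lambda>v. \<bar>y v\<bar> powr q) (\<lambda>v. q * (\<bar>y v\<bar> powr (q - 2) * y v) * y' v) v0 V"
    using q by (intro ac_deriv_chain[OF y, where h = "\<lambda>y. \<bar>y\<bar> powr q"] abs_powr_has_derivative)
      (auto intro!: continuous_intros continuous_on_powr')
  have pt: "- (q * (\<bar>y v\<bar> powr (q - 2) * y v) * y' v) \<le> q * (p + 1) / 2 / m * W v" if v: "v \<ge> v0" for v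
  proof -
    define s where "s = a v * (y' v)\<^sup>2"
    define t where "t = b v * \<bar>y v\<bar> powr (p + 1)"
    have st: "0 \<le> s" "0 \<le> t" using a[OF v] b[OF v] by (auto simp: s_def t_def)
    define r where "r = \<bar>y v\<bar> powr (q - 1) * \<bar>y' v\<bar>"
    have sq: "(\<bar>y v\<bar> powr (q - 1))\<^sup>2 = \<bar>y v\<bar> powr (p + 1)"
      by (simp add: power2_eq_square powr_add[symmetric] q_def add.commute)
    have "(m * r)\<^sup>2 = m\<^sup>2 * (\<bar>y v\<bar> powr (p + 1) * (y' v)\<^sup>2)"
      by (simp add: r_def power_mult_distrib sq)
    also have "\<dots> \<le> (a v * b v) * (\<bar>y v\<bar> powr (p + 1) * (y' v)\<^sup>2)"
      using m(2)[OF v] by (intro mult_right_mono) auto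
    also have "\<dots> = s * t" by (simp add: s_def t_def)
    also have "\<dots> \<le> (s + t)\<^sup>2" using st by (simp add: power2_eq_square algebra_simps)
    finally have "m * r \<le> s + t" by (rule power2_le_imp_le) (use st in simp)
    also have "\<dots> \<le> (p + 1) / 2 * W v"
    proof -
      have "t = (p + 1) / 2 * (b v * pot p (y v))" using p by (simp add: t_def pot_def)
      moreover have "s \<le> (p + 1) / 2 * s"
        using mult_right_mono[of 1 "(p+1)/2" s] st(1) p by (simp only: mult_1_left) simp
      moreover have "(p + 1) / 2 * W v = (p + 1) / 2 * s + (p + 1) / 2 * (b v * pot p (y v))"
        unfolding W_def s_def by (rule distrib_left)
      ultimately show ?thesis by linarith
    qed
    finally have r: "r \<le> (p + 1) / 2 * W v / m" using m(1) by (simp add: field_simps)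
    have "\<bar>y v\<bar> powr (q - 2) * \<bar>y v\<bar> = \<bar>y v\<bar> powr (q - 1)"
      using powr_add[of "\<bar>y v\<bar>" "q - 2" 1] by (cases "y v = 0") auto
    then have "\<bar>q * (\<bar>y v\<bar> powr (q - 2) * y v) * y' v\<bar> = q * r"
      using q by (simp add: abs_mult r_def mult.assoc[symmetric])
    also have "\<dots> \<le> q * ((p + 1) / 2 * W v / m)" using r q by (intro mult_left_mono) auto
    finally show ?thesis by (simp add: abs_le_iff field_simps)
  qed
  have "\<bar>y v0\<bar> powr q = \<bar>y V\<bar> powr q + (LBINT v:{v0..V}. - (q * (\<bar>y v\<bar> powr (q - 2) * y v) * y' v))"
    using ac_deriv_eq[OF ac V(1)] by (simp add: set_lebesgue_integral_def)
  also have "(LBINT v:{v0..V}. - (q * (\<bar>y v\<bar> powr (q - 2) * y v) * y' v)) \<le> (LBINT v:{v0..V}. q * (p + 1) / 2 / m * W v)"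
  proof (rule set_integral_mono)
    show "set_integrable lborel {v0..V} (\<lambda>v. - (q * (\<bar>y v\<bar> powr (q - 2) * y v) * y' v))"
      using ac_deriv_integrable[OF ac] unfolding set_integrable_def by simp
    show "set_integrable lborel {v0..V} (\<lambda>v. q * (p + 1) / 2 / m * W v)"
      unfolding W_def by (rule set_integrable_mult_right) (use i[OF V(1)] in simp)
  qed (use pt in auto)
  also have "(LBINT v:{v0..V}. q * (p + 1) / 2 / m * W v) \<le> q * (p + 1) / 2 / m * K"
    using mult_left_mono[OF K[OF V(1)], of "q * (p + 1) / 2 / m"] q p m(1)
    by (simp only: W_def set_integral_mult_right) simp
  finally show "\<bar>y v0\<bar> powr ((p + 3) / 2) \<le> (p + 3) * (p + 1) / 4 * K / m + e"
    using V(2) by (simp add: q_def field_simps)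
qed

section \<open>Energy estimates outside the light cone\<close>

lemma measurable_swap_plane:
  fixes f :: "real \<times> real \<Rightarrow> real"
  assumes "f \<in> borel_measurable borel"
  shows "(\<lambda>z. f (c * snd z, c * fst z)) \<in> borel_measurable borel"
proof (rule measurable_compose[OF _ assms])
  show "(\<lambda>z::real\<times>real. (c * snd z, c * fst z)) \<in> borel_measurable borel"
    by (intro borel_measurable_continuous_onI continuous_intros)
qed

text \<open>Here \<open>P = \<Phi>\<^sub>v\<close> and \<open>Q = \<Phi>\<^sub>u\<close>; the line \<open>u = - v\<close> is \<open>t = 0\<close>, where \<open>2 P\<^sup>2 + 2 Q\<^sup>2 = \<phi>\<^sub>t\<^sup>2 + \<phi>\<^sub>x\<^sup>2\<close>,
  so that \<open>M\<close> bounds the weighted energy of the data.\<close>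

locale wave =
  fixes p M :: real and \<Phi> P Q :: "real \<Rightarrow> real \<Rightarrow> real"
  assumes p: "p > 1"
    and cont: "continuous_on UNIV (\<lambda>z. \<Phi> (fst z) (snd z))"
    and P_measurable: "(\<lambda>z. P (fst z) (snd z)) \<in> borel_measurable borel"
    and Q_measurable: "(\<lambda>z. Q (fst z) (snd z)) \<in> borel_measurable borel"
    and P_sq: "set_integrable lborel {a..b} (\<lambda>v. (P u v)\<^sup>2)"
    and Q_sq: "set_integrable lborel {a..b} (\<lambda>u. (Q u v)\<^sup>2)"
    and \<Phi>_v: "ac_deriv (\<Phi> u) (P u) a b"
    and \<Phi>_u: "ac_deriv (\<lambda>u. \<Phi> u v) (\<lambda>u. Q u v) a b"
    and P_u: "ac_deriv (\<lambda>u. P u v) (\<lambda>u. - nl p (\<Phi> u v) / 4) a b"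
    and Q_v: "ac_deriv (Q u) (\<lambda>v. - nl p (\<Phi> u v) / 4) a b"
    and data_integrable: "integrable lborel (\<lambda>x. (1 + \<bar>x\<bar>) *
        (2 * (P (- x) x)\<^sup>2 + 2 * (Q (- x) x)\<^sup>2 + pot p (\<Phi> (- x) x)))"
    and data_bound: "(LBINT x. (1 + \<bar>x\<bar>) *
        (2 * (P (- x) x)\<^sup>2 + 2 * (Q (- x) x)\<^sup>2 + pot p (\<Phi> (- x) x))) \<le> M"

lemma (in wave) \<Phi>_compose:
  assumes "continuous_on S f" "continuous_on S g"
  shows "continuous_on S (\<lambda>x. \<Phi> (f x) (g x))"
  using continuous_on_compose2[OF cont continuous_on_Pair[OF assms]] by simp

text \<open>Exchanging u and v is the reflection x -> - x.\<close>

lemma wave_swap: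
  assumes "wave p M \<Phi> P Q"
  shows "wave p M (\<lambda>u v. \<Phi> v u) (\<lambda>u v. Q v u) (\<lambda>u v. P v u)"
proof -
  interpret wave p M \<Phi> P Q by fact
  define w where "w x = (1 + \<bar>x\<bar>) * (2 * (P (- x) x)\<^sup>2 + 2 * (Q (- x) x)\<^sup>2 + pot p (\<Phi> (- x) x))" for x
  have i: "integrable lborel w" and b: "(LBINT x. w x) \<le> M"
    using data_integrable data_bound unfolding w_def by auto
  have refl: "(\<lambda>x. (1 + \<bar>x\<bar>) * (2 * (Q x (- x))\<^sup>2 + 2 * (P x (- x))\<^sup>2 + pot p (\<Phi> x (- x)))) = (\<lambda>x. w (0 + (-1) * x))"
    by (simp add: w_def add.commute)
  show ?thesis
  proof
    show "continuous_on UNIV (\<lambda>z. \<Phi> (snd z) (fst z))"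
      by (intro \<Phi>_compose continuous_intros)
    show "(\<lambda>z. Q (snd z) (fst z)) \<in> borel_measurable borel"
      using measurable_swap_plane[OF Q_measurable, of 1] by simp
    show "(\<lambda>z. P (snd z) (fst z)) \<in> borel_measurable borel"
      using measurable_swap_plane[OF P_measurable, of 1] by simp
    show "integrable lborel (\<lambda>x. (1 + \<bar>x\<bar>) * (2 * (Q x (- x))\<^sup>2 + 2 * (P x (- x))\<^sup>2 + pot p (\<Phi> x (- x))))"
      unfolding refl by (rule lborel_integrable_real_affine[OF i]) simp
    show "(LBINT x. (1 + \<bar>x\<bar>) * (2 * (Q x (- x))\<^sup>2 + 2 * (P x (- x))\<^sup>2 + pot p (\<Phi> x (- x)))) \<le> M"
      unfolding refl using lborel_integral_real_affine[of "-1" w 0] b by simp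
  qed (use p P_sq Q_sq \<Phi>_v \<Phi>_u P_u Q_v in auto)
qed

text \<open>The map (u, v) -> (- v, - u) is time reversal with x fixed, which changes the sign of
  both derivatives and exchanges their roles.\<close>

lemma wave_reverse:
  assumes "wave p M \<Phi> P Q"
  shows "wave p M (\<lambda>u v. \<Phi> (- v) (- u)) (\<lambda>u v. - Q (- v) (- u)) (\<lambda>u v. - P (- v) (- u))"
proof -
  interpret wave p M \<Phi> P Q by fact
  show ?thesis
  proof
    show "continuous_on UNIV (\<lambda>z. \<Phi> (- snd z) (- fst z))"
      by (intro \<Phi>_compose continuous_intros)
    show "(\<lambda>z. - Q (- snd z) (- fst z)) \<in> borel_measurable borel"
      using measurable_swap_plane[OF Q_measurable, of "-1"] by simp
    show "(\<lambda>z. - P (- snd z) (- fst z)) \<in> borel_measurable borel"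
      using measurable_swap_plane[OF P_measurable, of "-1"] by simp
    show "set_integrable lborel {a..b} (\<lambda>v. (- Q (- v) (- u))\<^sup>2)" for a b u
      using set_integral_reflect(2)[of a b "\<lambda>v. (Q v (- u))\<^sup>2"] Q_sq by simp
    show "set_integrable lborel {a..b} (\<lambda>u. (- P (- v) (- u))\<^sup>2)" for a b v
      using set_integral_reflect(2)[of a b "\<lambda>u. (P (- v) u)\<^sup>2"] P_sq by simp
    show "ac_deriv (\<lambda>v. \<Phi> (- v) (- u)) (\<lambda>v. - Q (- v) (- u)) a b" for u a b
      by (rule ac_deriv_reflect[OF \<Phi>_u])
    show "ac_deriv (\<lambda>u. \<Phi> (- v) (- u)) (\<lambda>u. - P (- v) (- u)) a b" for v a b
      by (rule ac_deriv_reflect[OF \<Phi>_v])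
    show "ac_deriv (\<lambda>u. - Q (- v) (- u)) (\<lambda>u. - nl p (\<Phi> (- v) (- u)) / 4) a b" for v a b
      using ac_deriv_cmult[OF ac_deriv_reflect[OF Q_v], of "-1" "- v" a b] by simp
    show "ac_deriv (\<lambda>v. - P (- v) (- u)) (\<lambda>v. - nl p (\<Phi> (- v) (- u)) / 4) a b" for u a b
      using ac_deriv_cmult[OF ac_deriv_reflect[OF P_u], of "-1" "- u" a b] by simp
  qed (use p data_integrable data_bound in \<open>simp_all add: add.commute\<close>)
qed

section \<open>Square integrability on rectangles\<close>

context wave
begin

lemma M_nonneg: "0 \<le> M"
proof -
  have "0 \<le> (LBINT x. (1 + \<bar>x\<bar>) * (2 * (P (- x) x)\<^sup>2 + 2 * (Q (- x) x)\<^sup>2 + pot p (\<Phi> (- x) x)))"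
    using pot_nonneg[OF p] by (intro Bochner_Integration.integral_nonneg) auto
  then show ?thesis using data_bound by linarith
qed

lemma nl_\<Phi>_bounded:
  obtains B where "B \<ge> 0" "\<And>u v. u \<in> {a..b} \<Longrightarrow> v \<in> {c..d} \<Longrightarrow> \<bar>nl p (\<Phi> u v)\<bar> \<le> B"
proof -
  have "continuous_on ({a..b} \<times> {c..d}) (\<lambda>z. nl p (\<Phi> (fst z) (snd z)))"
    using continuous_on_compose2[OF nl_continuous[OF p, of UNIV] cont] by (auto intro: continuous_on_subset)
  then have "bounded ((\<lambda>z. nl p (\<Phi> (fst z) (snd z))) ` ({a..b} \<times> {c..d}))"
    by (intro compact_imp_bounded compact_continuous_image compact_Times) auto
  then obtain B where B: "\<And>u v. u \<in> {a..b} \<Longrightarrow> v \<in> {c..d} \<Longrightarrow> \<bar>nl p (\<Phi> u v)\<bar> \<le> B"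
    by (fastforce simp: bounded_iff)
  show ?thesis
  proof (rule that[of "\<bar>B\<bar>"])
    fix u v assume "u \<in> {a..b}" "v \<in> {c..d}"
    then show "\<bar>nl p (\<Phi> u v)\<bar> \<le> \<bar>B\<bar>" using B[of u v] by linarith
  qed simp
qed

text \<open>On the line u = a the square of P is integrable, and for other u the value of P differs
  by at most K because its u-derivative is bounded on the rectangle. So a function of v alone
  dominates.\<close>

lemma P_sq_rect: "set_integrable lborel ({a..b} \<times> {c..d}) (\<lambda>z. (P (fst z) (snd z))\<^sup>2)"
proof -
  obtain B where B: "B \<ge> 0" "\<And>u v. u \<in> {a..b} \<Longrightarrow> v \<in> {c..d} \<Longrightarrow> \<bar>nl p (\<Phi> u v)\<bar> \<le> B"
    using nl_\<Phi>_bounded[of a b c d] by blast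
  define K where "K = B / 4 * (b - a)"
  show ?thesis
  proof (rule set_integrable_dominated)
  show "set_integrable lborel ({a..b} \<times> {c..d}) (\<lambda>z. 2 * (P a (snd z))\<^sup>2 + 2 * K\<^sup>2)"
    by (intro set_integral_add set_integrable_mult_right integrable_fst_rect(2) P_sq set_integrable_continuous compact_Times)
      (auto intro: continuous_intros)
  show "(\<lambda>z. (P (fst z) (snd z))\<^sup>2) \<in> borel_measurable borel"
    using P_measurable by simp
  show "compact ({a..b} \<times> {c..d})" by (intro compact_Times) auto
  fix z assume "z \<in> {a..b} \<times> {c..d}"
  then obtain u v where z: "z = (u, v)" "u \<in> {a..b}" "v \<in> {c..d}" by auto
  note pu = P_u[of v a u]
  have "\<bar>P u v - P a v\<bar> = \<bar>LBINT s:{a..u}. - nl p (\<Phi> s v) / 4\<bar>"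
    using ac_deriv_eq[OF pu] z by simp
  also have "\<dots> \<le> (LBINT s:{a..u}. \<bar>- nl p (\<Phi> s v) / 4\<bar>)"
    using set_integral_norm_bound[OF ac_deriv_integrable[OF pu]] by simp
  also have "\<dots> \<le> (LBINT s:{a..u}. B / 4)"
  proof (rule set_integral_mono)
    show "set_integrable lborel {a..u} (\<lambda>s. \<bar>- nl p (\<Phi> s v) / 4\<bar>)"
      by (rule set_integrable_abs[OF ac_deriv_integrable[OF pu]])
    show "set_integrable lborel {a..u} (\<lambda>s. B / 4)"
      by (intro set_integrable_continuous) auto
  qed (use B(2) z in auto)
  also have "\<dots> = B / 4 * (u - a)" using z by (simp add: set_lebesgue_integral_def)
  also have "\<dots> \<le> K" unfolding K_def using B(1) z by (intro mult_left_mono) auto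
  finally have "\<bar>P u v\<bar> \<le> \<bar>P a v\<bar> + K" by linarith
  then have "(P u v)\<^sup>2 \<le> (\<bar>P a v\<bar> + K)\<^sup>2"
    by (metis abs_ge_zero power2_abs power_mono)
  also have "\<dots> \<le> 2 * (P a v)\<^sup>2 + 2 * K\<^sup>2"
    using sum_squares_bound[of "\<bar>P a v\<bar>" K] by (simp add: power2_sum)
  finally show "\<bar>(P (fst z) (snd z))\<^sup>2\<bar> \<le> 2 * (P a (snd z))\<^sup>2 + 2 * K\<^sup>2" using z by simp
  qed
qed

end

context wave
begin

interpretation swap: wave p M "\<lambda>u v. \<Phi> v u" "\<lambda>u v. Q v u" "\<lambda>u v. P v u"
  by (rule wave_swap) unfold_locales

lemma Q_sq_rect: "set_integrable lborel ({a..b} \<times> {c..d}) (\<lambda>z. (Q (fst z) (snd z))\<^sup>2)"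
proof -
  have i: "integrable (lborel \<Otimes>\<^sub>M lborel) (\<lambda>z. indicator ({c..d} \<times> {a..b}) z *\<^sub>R (Q (snd z) (fst z))\<^sup>2)"
    using swap.P_sq_rect[of c d a b] unfolding set_integrable_def lborel_prod by simp
  have eq: "(\<lambda>(x,y). (\<lambda>z. indicator ({c..d} \<times> {a..b}) z *\<^sub>R (Q (snd z) (fst z))\<^sup>2) (y, x))
     = (\<lambda>z. indicator ({a..b} \<times> {c..d}) z *\<^sub>R (Q (fst z) (snd z))\<^sup>2)"
    by (auto simp: indicator_def fun_eq_iff)
  show ?thesis
    using lborel_pair.integrable_product_swap[OF i] unfolding eq set_integrable_def lborel_prod .
qed

text \<open>The divergences below are sums of these six types: a continuous coefficient times a
  monomial of degree at most two in P and Q.\<close>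

lemma rect_integrable:
  assumes "continuous_on ({a..b} \<times> {c..d}) (\<lambda>z. k (fst z) (snd z))"
  shows "set_integrable lborel ({a..b} \<times> {c..d}) (\<lambda>z. k (fst z) (snd z) * (P (fst z) (snd z))\<^sup>2)"
    "set_integrable lborel ({a..b} \<times> {c..d}) (\<lambda>z. k (fst z) (snd z) * (Q (fst z) (snd z))\<^sup>2)"
    "set_integrable lborel ({a..b} \<times> {c..d}) (\<lambda>z. k (fst z) (snd z) * P (fst z) (snd z))"
    "set_integrable lborel ({a..b} \<times> {c..d}) (\<lambda>z. k (fst z) (snd z) * Q (fst z) (snd z))"
    "set_integrable lborel ({a..b} \<times> {c..d}) (\<lambda>z. k (fst z) (snd z) * (P (fst z) (snd z) * Q (fst z) (snd z)))"
    "set_integrable lborel ({a..b} \<times> {c..d}) (\<lambda>z. k (fst z) (snd z))"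
proof -
  let ?R = "{a..b} \<times> {c..d}"
  have cR: "compact ?R" by (intro compact_Times) auto
  have 1: "set_integrable lborel ?R (\<lambda>z. 1::real)" by (intro set_integrable_continuous cR) auto
  have le1: "\<bar>x\<bar> \<le> 1 + x\<^sup>2" for x :: real
    using zero_le_power2[of "\<bar>x\<bar> - 1"] by (simp add: power2_diff)
  have iP: "set_integrable lborel ?R (\<lambda>z. P (fst z) (snd z))"
    by (rule set_integrable_dominated[OF set_integral_add(1)[OF 1 P_sq_rect] P_measurable cR le1])
  have iQ: "set_integrable lborel ?R (\<lambda>z. Q (fst z) (snd z))"
    by (rule set_integrable_dominated[OF set_integral_add(1)[OF 1 Q_sq_rect] Q_measurable cR le1])
  have iPQ: "set_integrable lborel ?R (\<lambda>z. P (fst z) (snd z) * Q (fst z) (snd z))"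
  proof (rule set_integrable_dominated[OF set_integral_add(1)[OF P_sq_rect Q_sq_rect] _ cR])
    show "(\<lambda>z. P (fst z) (snd z) * Q (fst z) (snd z)) \<in> borel_measurable borel"
      using P_measurable Q_measurable by simp
    show "\<bar>P (fst z) (snd z) * Q (fst z) (snd z)\<bar> \<le> (P (fst z) (snd z))\<^sup>2 + (Q (fst z) (snd z))\<^sup>2" for z
      using sum_squares_bound[of "\<bar>P (fst z) (snd z)\<bar>" "\<bar>Q (fst z) (snd z)\<bar>", unfolded power2_abs]
        mult_nonneg_nonneg[OF abs_ge_zero[of "P (fst z) (snd z)"] abs_ge_zero[of "Q (fst z) (snd z)"]]
      unfolding abs_mult by linarith
  qed
  show "set_integrable lborel ?R (\<lambda>z. k (fst z) (snd z) * (P (fst z) (snd z))\<^sup>2)"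
    "set_integrable lborel ?R (\<lambda>z. k (fst z) (snd z) * (Q (fst z) (snd z))\<^sup>2)"
    "set_integrable lborel ?R (\<lambda>z. k (fst z) (snd z) * P (fst z) (snd z))"
    "set_integrable lborel ?R (\<lambda>z. k (fst z) (snd z) * Q (fst z) (snd z))"
    "set_integrable lborel ?R (\<lambda>z. k (fst z) (snd z) * (P (fst z) (snd z) * Q (fst z) (snd z)))"
    "set_integrable lborel ?R (\<lambda>z. k (fst z) (snd z))"
    using assms by (intro set_integrable_mult_continuous set_integrable_continuous P_sq_rect Q_sq_rect iP iQ iPQ cR; assumption)+
qed

lemma cont_rect: "continuous_on S (\<lambda>z. \<Phi> (fst z) (snd z))"
  using cont by (rule continuous_on_subset) simp

lemma continuous_v: "continuous_on S (\<Phi> u)"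
  by (intro \<Phi>_compose continuous_intros)

lemma continuous_u: "continuous_on S (\<lambda>u. \<Phi> u v)"
  by (intro \<Phi>_compose continuous_intros)

text \<open>Green's theorem on the triangle between t = 0, the ray u = u0 and the line v = V. The
  multiplier \<open>(1 + v) \<partial>\<^sub>v + (1 - u) \<partial>\<^sub>u\<close> is the boost
  plus time translation; both are symmetries of the flat metric, which is why nothing is left in the
  divergence. On t = 0 the two densities add up to twice the energy density of the data, whence 2 M;
  the flux through v = V is nonnegative and is dropped.\<close>

lemma exterior_flux:
  assumes u0: "u0 \<le> 0" and V: "- u0 \<le> V"
  shows "(LBINT v:{-u0..V}. 4 * (1 + v) * (P u0 v)\<^sup>2 + (1 - u0) * pot p (\<Phi> u0 v)) \<le> 2 * M"
proof -
  define Ju where "Ju u v = 4 * (1 + v) * (P u v)\<^sup>2 + (1 - u) * pot p (\<Phi> u v)" for u v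
  define Jv where "Jv u v = 4 * (1 - u) * (Q u v)\<^sup>2 + (1 + v) * pot p (\<Phi> u v)" for u v
  define A where "A u v = 4 * (1 + v) * (2 * P u v * (- nl p (\<Phi> u v) / 4))
      + ((-1) * pot p (\<Phi> u v) + (1 - u) * (2 * nl p (\<Phi> u v) * Q u v))" for u v
  define B where "B u v = 4 * (1 - u) * (2 * Q u v * (- nl p (\<Phi> u v) / 4))
      + (1 * pot p (\<Phi> u v) + (1 + v) * (2 * nl p (\<Phi> u v) * P u v))" for u v
  have acu: "ac_deriv (\<lambda>u. Ju u v) (\<lambda>u. A u v) a b" for v a b
    unfolding Ju_def A_def
    by (intro ac_deriv_add ac_deriv_cmult[OF ac_deriv_power2[OF P_u]]
        ac_deriv_weight_mult[OF _ _ ac_deriv_pot[OF p \<Phi>_u]]) (auto intro!: derivative_eq_intros)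
  have acv: "ac_deriv (Jv u) (B u) a b" for u a b
    unfolding Jv_def[abs_def] B_def[abs_def]
    by (intro ac_deriv_add ac_deriv_cmult[OF ac_deriv_power2[OF Q_v]]
        ac_deriv_weight_mult[OF _ _ ac_deriv_pot[OF p \<Phi>_v]]) (auto intro!: derivative_eq_intros)
  have cn: "continuous_on S (\<lambda>z. nl p (\<Phi> (fst z) (snd z)))" "continuous_on S (\<lambda>z. pot p (\<Phi> (fst z) (snd z)))" for S
    by (rule continuous_on_compose2[OF nl_continuous[OF p, of UNIV] cont_rect] continuous_on_compose2[OF pot_continuous[OF p, of UNIV] cont_rect]; simp)+
  have iA: "set_integrable lborel ({a..b} \<times> {c..d}) (\<lambda>z. A (fst z) (snd z))" for a b c d
  proof -
    have eq: "A (fst z) (snd z) = (- 2 * (1 + snd z) * nl p (\<Phi> (fst z) (snd z))) * P (fst z) (snd z)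
      + (- pot p (\<Phi> (fst z) (snd z)) + (2 * (1 - fst z) * nl p (\<Phi> (fst z) (snd z))) * Q (fst z) (snd z))" for z
      by (simp add: A_def field_simps)
    show ?thesis unfolding eq
      by (intro set_integral_add rect_integrable(3)[where k = "\<lambda>u v. - 2 * (1 + v) * nl p (\<Phi> u v)"]
          rect_integrable(4)[where k = "\<lambda>u v. 2 * (1 - u) * nl p (\<Phi> u v)"]
          rect_integrable(6)[where k = "\<lambda>u v. - pot p (\<Phi> u v)"] continuous_intros cn)
  qed
  have iB: "set_integrable lborel ({a..b} \<times> {c..d}) (\<lambda>z. B (fst z) (snd z))" for a b c d
  proof -
    have eq: "B (fst z) (snd z) = (- 2 * (1 - fst z) * nl p (\<Phi> (fst z) (snd z))) * Q (fst z) (snd z)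
      + (pot p (\<Phi> (fst z) (snd z)) + (2 * (1 + snd z) * nl p (\<Phi> (fst z) (snd z))) * P (fst z) (snd z))" for z
      by (simp add: B_def field_simps)
    show ?thesis unfolding eq
      by (intro set_integral_add rect_integrable(4)[where k = "\<lambda>u v. - 2 * (1 - u) * nl p (\<Phi> u v)"]
          rect_integrable(3)[where k = "\<lambda>u v. 2 * (1 + v) * nl p (\<Phi> u v)"]
          rect_integrable(6)[where k = "\<lambda>u v. pot p (\<Phi> u v)"] continuous_intros cn)
  qed
  have iJu: "set_integrable lborel {a..b} (Ju u)" for a b u
    unfolding Ju_def[abs_def]
    by (intro set_integral_add(1) set_integrable_mult_continuous[OF P_sq] set_integrable_continuous
        continuous_intros continuous_on_compose2[OF pot_continuous[OF p, of UNIV] continuous_v]) auto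
  have iJv: "set_integrable lborel {a..b} (\<lambda>u. Jv u v)" for a b v
    unfolding Jv_def[abs_def]
    by (intro set_integral_add(1) set_integrable_mult_continuous[OF Q_sq] set_integrable_continuous
        continuous_intros continuous_on_compose2[OF pot_continuous[OF p, of UNIV] continuous_u]) auto
  define w where "w x = (1 + \<bar>x\<bar>) * (2 * (P (- x) x)\<^sup>2 + 2 * (Q (- x) x)\<^sup>2 + pot p (\<Phi> (- x) x))" for x
  have iw: "integrable lborel w" and bw: "(LBINT x. w x) \<le> M"
    using data_integrable data_bound unfolding w_def by auto
  have m1: "(\<lambda>x. P (- x) x) \<in> borel_measurable borel" "(\<lambda>x. Q (- x) x) \<in> borel_measurable borel"
    using measurable_compose[OF _ P_measurable, of "\<lambda>x. (- x, x)" borel]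
      measurable_compose[OF _ Q_measurable, of "\<lambda>x. (- x, x)" borel]
    by (auto intro!: borel_measurable_continuous_onI continuous_intros)
  have m2: "(\<lambda>x. pot p (\<Phi> (- x) x)) \<in> borel_measurable borel"
    by (intro borel_measurable_continuous_onI continuous_on_compose2[OF pot_continuous[OF p, of UNIV]]
        \<Phi>_compose continuous_intros) auto
  have eJ: "Ju (- v) v + Jv (- v) v = 2 * w v" if "v \<ge> 0" for v
    using that by (simp add: Ju_def Jv_def w_def algebra_simps)
  have Jnn: "0 \<le> Ju (- v) v" "0 \<le> Jv (- v) v" if "v \<ge> 0" for v
    using that pot_nonneg[OF p] by (auto simp: Ju_def Jv_def)
  have iw2: "set_integrable lborel {-u0..V} (\<lambda>v. 2 * w v)"
    unfolding set_integrable_def by (intro integrable_mult_indicator integrable_mult_right iw) auto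
  \<comment> \<open>\<open>P_sq\<close> and \<open>Q_sq\<close> concern characteristic lines only;
    on the line t = 0 integrability comes from domination by the data density w.\<close>
  have iJd: "set_integrable lborel {-u0..V} (\<lambda>v. Ju (- v) v)" "set_integrable lborel {-u0..V} (\<lambda>v. Jv (- v) v)"
  proof -
    have "(\<lambda>v. Ju (- v) v) \<in> borel_measurable borel" "(\<lambda>v. Jv (- v) v) \<in> borel_measurable borel"
      unfolding Ju_def Jv_def using m1 m2 by simp_all
    moreover have "\<bar>Ju (- v) v\<bar> \<le> 2 * w v \<and> \<bar>Jv (- v) v\<bar> \<le> 2 * w v" if "v \<in> {-u0..V}" for v
      using Jnn[of v] eJ[of v] that u0 by auto
    ultimately show "set_integrable lborel {-u0..V} (\<lambda>v. Ju (- v) v)" "set_integrable lborel {-u0..V} (\<lambda>v. Jv (- v) v)"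
      by (auto intro!: set_integrable_dominated[OF iw2])
  qed
  have iJd': "set_integrable lborel {-V..u0} (\<lambda>u. Jv u (- u))"
    using iJd(2) set_integral_reflect(2)[of "-V" u0 "\<lambda>v. Jv (- v) v"] by simp
  have rJ: "(LBINT u:{-V..u0}. Jv u (- u)) = (LBINT v:{-u0..V}. Jv (- v) v)"
    using set_integral_reflect(1)[of "-V" u0 "\<lambda>v. Jv (- v) v"] by simp
  have "(LBINT v:{-u0..V}. Ju u0 v) + (LBINT u:{-V..u0}. Jv u V)
    \<le> (LBINT v:{-u0..V}. Ju (- v) v) + (LBINT u:{-V..u0}. Jv u (- u))"
  proof (rule green_inequality[where A = A and B = B])
    show "Ju u0 v - Ju (- v) v = (LBINT u:{- v..u0}. A u v)" if "v \<in> {-u0..V}" for v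
      using that by (intro ac_deriv_eq[OF acu]) auto
    show "Jv u V - Jv u (- u) = (LBINT v:{- u..V}. B u v)" if "u \<in> {-V..u0}" for u
      using that by (intro ac_deriv_eq[OF acv]) auto
    show "A u v + B u v \<le> 0" for u v by (simp add: A_def B_def field_simps)
  qed (use iA iB iJu iJv iJd iJd' in auto)
  also have "\<dots> = (LBINT v:{-u0..V}. 2 * w v)"
    unfolding rJ set_integral_add(2)[OF iJd, symmetric]
    using u0 eJ by (intro set_lebesgue_integral_cong) auto
  also have "\<dots> \<le> 2 * M"
  proof -
    have "(LBINT v:{-u0..V}. 2 * w v) \<le> (LBINT v. 2 * w v)"
      unfolding set_lebesgue_integral_def
    proof (rule integral_mono)
      show "integrable lborel (\<lambda>v. indicator {-u0..V} v *\<^sub>R (2 * w v))" using iw2 by (simp add: set_integrable_def)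
      show "indicator {-u0..V} v *\<^sub>R (2 * w v) \<le> 2 * w v" for v
        using pot_nonneg[OF p] by (auto simp: indicator_def w_def)
    qed (use iw in auto)
    then show ?thesis using bw by simp
  qed
  finally have "(LBINT v:{-u0..V}. Ju u0 v) + (LBINT u:{-V..u0}. Jv u V) \<le> 2 * M" .
  moreover have "0 \<le> (LBINT u:{-V..u0}. Jv u V)"
  proof -
    have "0 \<le> Jv u V" if "u \<le> u0" for u
      using that u0 V pot_nonneg[OF p] by (auto simp: Jv_def)
    then show ?thesis unfolding set_lebesgue_integral_def
      by (intro Bochner_Integration.integral_nonneg) (auto simp: indicator_def)
  qed
  ultimately show ?thesis by (simp add: Ju_def)
qed

text \<open>The product of the weights 4 (1 + v) and 1 - u0 grows along the ray, so its value at v0,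
  without the factor 4, serves as m^2. The flux over the part of the ray beyond v0 is at most the
  full one because the density is nonnegative.\<close>

lemma exterior_decay:
  assumes u0: "u0 \<le> 0" and v0: "- u0 \<le> v0"
  shows "\<bar>\<Phi> u0 v0\<bar> powr ((p + 3) / 2) \<le> (p + 3) * (p + 1) / 4 * (2 * M) / sqrt ((1 + v0) * (1 - u0))"
proof (rule decay_along_ray[OF p \<Phi>_v, where a = "\<lambda>v. 4 * (1 + v)" and b = "\<lambda>v. 1 - u0" and \<kappa> = 1])
  have v0': "v0 \<ge> 0" using u0 v0 by simp
  then show "0 \<le> v0" .
  show "0 < sqrt ((1 + v0) * (1 - u0))" using v0' u0 by simp
  show "(sqrt ((1 + v0) * (1 - u0)))\<^sup>2 \<le> 4 * (1 + v) * (1 - u0)" if "v \<ge> v0" for v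
    using that v0' u0 by (simp add: mult_right_mono)
  show "1 / (1 + v) \<le> 1 - u0" if "v0 \<le> v" for v
  proof -
    have "1 / (1 + v) \<le> 1" using that v0' by simp
    then show ?thesis using u0 by linarith
  qed
  have i: "set_integrable lborel {a..V} (\<lambda>v. 4 * (1 + v) * (P u0 v)\<^sup>2 + (1 - u0) * pot p (\<Phi> u0 v))" for a V
    by (intro set_integral_add(1) set_integrable_mult_continuous[OF P_sq] set_integrable_continuous
        continuous_intros continuous_on_compose2[OF pot_continuous[OF p, of UNIV] continuous_v]) auto
  then show "set_integrable lborel {v0..V} (\<lambda>v. 4 * (1 + v) * (P u0 v)\<^sup>2 + (1 - u0) * pot p (\<Phi> u0 v))" for V .
  show "(LBINT v:{v0..V}. 4 * (1 + v) * (P u0 v)\<^sup>2 + (1 - u0) * pot p (\<Phi> u0 v)) \<le> 2 * M" if "v0 \<le> V" for V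
  proof -
    let ?f = "\<lambda>v. 4 * (1 + v) * (P u0 v)\<^sup>2 + (1 - u0) * pot p (\<Phi> u0 v)"
    have "0 \<le> (LBINT v:{-u0..v0}. ?f v)"
      unfolding set_lebesgue_integral_def using u0 pot_nonneg[OF p]
      by (intro Bochner_Integration.integral_nonneg) (auto simp: indicator_def)
    moreover have "(LBINT v:{-u0..V}. ?f v) = (LBINT v:{-u0..v0}. ?f v) + (LBINT v:{v0..V}. ?f v)"
      using v0 that by (intro set_integral_combine_Icc i) auto
    moreover have "(LBINT v:{-u0..V}. ?f v) \<le> 2 * M"
      using v0 that u0 by (intro exterior_flux) auto
    ultimately show ?thesis by linarith
  qed
qed (use u0 v0 in auto)

end

section \<open>Weighted energy estimates inside the light cone\<close>

text \<open>The mixed term \<open>2 c \<chi> P Q\<close> with \<open>\<chi> = v\<^sup>\<alpha>\<^sup>-\<^sup>1 u\<^sup>\<beta>\<^sup>-\<^sup>1\<close> comes from the divergence of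
  \<open>(\<theta> c \<chi> \<Phi> P, (2 - \<theta>) c \<chi> \<Phi> Q)\<close>, up to terms in \<open>\<Phi>\<^sup>2\<close>. The splitting \<open>\<theta> = 2 (1 - \<sigma>)\<close> is free, and
  the choice of \<open>\<sigma>\<close> below turns both boundary densities into perfect squares plus positive terms.\<close>

definition \<sigma>w :: "real \<Rightarrow> real \<Rightarrow> real" where "\<sigma>w p \<alpha> = 2 / (2 + (p + 1) * (1 / \<alpha> - 1))"
definition cw :: "real \<Rightarrow> real \<Rightarrow> real \<Rightarrow> real" where "cw p \<alpha> \<beta> = 8 * \<alpha> * \<beta> / (p + 1)"

definition admissible :: "real \<Rightarrow> real \<Rightarrow> real \<Rightarrow> bool" where
  "admissible p \<alpha> \<beta> \<longleftrightarrow> p > 1 \<and> 0 < \<alpha> \<and> \<alpha> < 1 \<and> 0 < \<beta> \<and> \<beta> < 1 \<and>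
     (1 / \<alpha> - 1) * (1 / \<beta> - 1) = 4 / (p + 1)\<^sup>2"

lemma admissible_sym: "admissible p \<alpha> \<beta> \<Longrightarrow> admissible p \<beta> \<alpha>"
  by (auto simp: admissible_def mult.commute)

text \<open>For X = (p + 1) (1 / \<alpha> - 1) and the analogous Y the relation reads X Y = 4, and
  this gives 2 / (2 + X) + 2 / (2 + Y) = 1. Hence the values of \<open>\<sigma>w\<close> for the two
  densities are complementary, as the splitting \<theta>, 2 - \<theta> requires. The formula for (1
  - \<sigma>) c is the perfect square condition for the boundary density, the one for c^2 the
  degeneracy of the quadratic form in the divergence.\<close>

lemma admissible_eqs:
  assumes "admissible p \<alpha> \<beta>"
  shows "(1 - \<alpha>) * (1 - \<beta>) * (p + 1)\<^sup>2 = 4 * (\<alpha> * \<beta>)"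
    and "0 < \<sigma>w p \<alpha>" "\<sigma>w p \<alpha> < 1" "\<sigma>w p \<beta> = 1 - \<sigma>w p \<alpha>"
    and "(1 - \<sigma>w p \<alpha>) * cw p \<alpha> \<beta> = 4 * \<beta> * \<sigma>w p \<alpha> * (1 - \<alpha>)"
    and "0 < cw p \<alpha> \<beta>" "cw p \<alpha> \<beta> < 4" "(cw p \<alpha> \<beta>)\<^sup>2 = (4 * \<beta> * (1 - \<beta>)) * (4 * \<alpha> * (1 - \<alpha>))"
proof -
  have a: "p > 1" "0 < \<alpha>" "\<alpha> < 1" "0 < \<beta>" "\<beta> < 1" and r: "(1 / \<alpha> - 1) * (1 / \<beta> - 1) = 4 / (p + 1)\<^sup>2"
    using assms by (auto simp: admissible_def)
  show rel: "(1 - \<alpha>) * (1 - \<beta>) * (p + 1)\<^sup>2 = 4 * (\<alpha> * \<beta>)"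
  proof -
    have "(1 - \<alpha>) * (1 - \<beta>) = \<alpha> * \<beta> * ((1 / \<alpha> - 1) * (1 / \<beta> - 1))" using a by (simp add: field_simps)
    also have "\<dots> = \<alpha> * \<beta> * (4 / (p + 1)\<^sup>2)" by (simp only: r)
    finally show ?thesis using a by simp
  qed
  define X where "X = (p + 1) * (1 / \<alpha> - 1)"
  define Y where "Y = (p + 1) * (1 / \<beta> - 1)"
  have X: "X > 0" and Y: "Y > 0" using a by (auto simp: X_def Y_def)
  have "X * Y = (p + 1)\<^sup>2 * ((1 / \<alpha> - 1) * (1 / \<beta> - 1))" by (simp add: X_def Y_def power2_eq_square)
  also have "\<dots> = 4" using a by (simp add: r)
  finally have XY: "X * Y = 4" .
  have s: "\<sigma>w p \<alpha> = 2 / (2 + X)" "\<sigma>w p \<beta> = 2 / (2 + Y)" by (auto simp: \<sigma>w_def X_def Y_def)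
  show "0 < \<sigma>w p \<alpha>" "\<sigma>w p \<alpha> < 1" using X by (auto simp: s)
  have Y': "Y = 4 / X" using XY X by (simp add: field_simps)
  show "\<sigma>w p \<beta> = 1 - \<sigma>w p \<alpha>" unfolding s Y' using X by (simp add: field_simps)
  have aX: "\<alpha> * X = (p + 1) * (1 - \<alpha>)" using a by (simp add: X_def field_simps)
  have "(1 - \<sigma>w p \<alpha>) * cw p \<alpha> \<beta> = \<sigma>w p \<alpha> * (4 * \<beta> * (\<alpha> * X) / (p + 1))"
    unfolding s cw_def using X a by (simp add: divide_simps)
  also have "\<dots> = 4 * \<beta> * \<sigma>w p \<alpha> * (1 - \<alpha>)" unfolding aX using a by simp
  finally show "(1 - \<sigma>w p \<alpha>) * cw p \<alpha> \<beta> = 4 * \<beta> * \<sigma>w p \<alpha> * (1 - \<alpha>)" .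
  show "0 < cw p \<alpha> \<beta>" using a by (simp add: cw_def)
  have "\<alpha> * \<beta> < 1" using a mult_strict_mono[of \<alpha> 1 \<beta> 1] by simp
  then show "cw p \<alpha> \<beta> < 4" using a by (simp add: cw_def field_simps)
  have "(cw p \<alpha> \<beta>)\<^sup>2 = 16 * (\<alpha> * \<beta>) * (4 * (\<alpha> * \<beta>)) / (p + 1)\<^sup>2"
    by (simp add: cw_def power_divide power2_eq_square)
  also have "\<dots> = 16 * (\<alpha> * \<beta>) * ((1 - \<alpha>) * (1 - \<beta>))"
    unfolding rel[symmetric] using a by simp
  finally show "(cw p \<alpha> \<beta>)\<^sup>2 = (4 * \<beta> * (1 - \<beta>)) * (4 * \<alpha> * (1 - \<alpha>))" by simp
qed

lemma nonneg_of_square: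
  fixes A x y :: real
  assumes "A > 0" "A * B = D\<^sup>2"
  shows "0 \<le> A * x\<^sup>2 + 2 * D * x * y + B * y\<^sup>2"
proof -
  have "A * (A * x\<^sup>2 + 2 * D * x * y + B * y\<^sup>2) = (A * x)\<^sup>2 + 2 * (A * x) * (D * y) + (A * B) * y\<^sup>2"
    by (simp add: algebra_simps power2_eq_square)
  also have "\<dots> = (A * x + D * y)\<^sup>2"
    unfolding assms(2) by (simp add: power2_sum power_mult_distrib)
  finally have "0 \<le> A * (A * x\<^sup>2 + 2 * D * x * y + B * y\<^sup>2)" by simp
  then show ?thesis using assms(1) by (simp add: zero_le_mult_iff)
qed

text \<open>The flux density through an outgoing ray. The last term comes from no multiplier: its
  u-derivative cancels the \<Phi> Q term that arises when the weight of \<Phi> Q in the incoming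
  density is differentiated. The incoming density is the same formula with u and v, \<alpha> and
  \<beta>, P and Q exchanged, so one set of lemmas serves for both.\<close>

definition Jdens :: "real \<Rightarrow> real \<Rightarrow> real \<Rightarrow> (real \<Rightarrow> real \<Rightarrow> real) \<Rightarrow> (real \<Rightarrow> real \<Rightarrow> real) \<Rightarrow> real \<Rightarrow> real \<Rightarrow> real" where
  "Jdens p \<alpha> \<beta> \<Phi> P u v =
     4 * \<beta> * (1 + v) powr \<alpha> * ((1 + u) powr (\<beta> - 1) * (P u v)\<^sup>2)
   + (\<alpha> * (1 + v) powr (\<alpha> - 1) * ((1 + u) powr \<beta> * pot p (\<Phi> u v))
   + (2 * (1 - \<sigma>w p \<alpha>) * cw p \<alpha> \<beta> * (1 + v) powr (\<alpha> - 1) * ((1 + u) powr (\<beta> - 1) * (\<Phi> u v * P u v))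
   + \<sigma>w p \<alpha> * (1 - \<alpha>) * cw p \<alpha> \<beta> * (1 + v) powr (\<alpha> - 2) * ((1 + u) powr (\<beta> - 1) * (\<Phi> u v)\<^sup>2)))"

text \<open>The u-derivative of \<open>Jdens\<close> with the equation inserted for the derivative
  of P, left in the unsimplified shape that the rules for \<open>ac_deriv\<close> produce.\<close>

definition Jdiv :: "real \<Rightarrow> real \<Rightarrow> real \<Rightarrow> (real \<Rightarrow> real \<Rightarrow> real) \<Rightarrow> (real \<Rightarrow> real \<Rightarrow> real) \<Rightarrow> (real \<Rightarrow> real \<Rightarrow> real) \<Rightarrow> real \<Rightarrow> real \<Rightarrow> real" where
  "Jdiv p \<alpha> \<beta> \<Phi> P Q u v =
     4 * \<beta> * (1 + v) powr \<alpha> * ((\<beta> - 1) * (1 + u) powr (\<beta> - 2) * (P u v)\<^sup>2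
        + (1 + u) powr (\<beta> - 1) * (2 * P u v * (- nl p (\<Phi> u v) / 4)))
   + (\<alpha> * (1 + v) powr (\<alpha> - 1) * (\<beta> * (1 + u) powr (\<beta> - 1) * pot p (\<Phi> u v)
        + (1 + u) powr \<beta> * (2 * nl p (\<Phi> u v) * Q u v))
   + (2 * (1 - \<sigma>w p \<alpha>) * cw p \<alpha> \<beta> * (1 + v) powr (\<alpha> - 1) * ((\<beta> - 1) * (1 + u) powr (\<beta> - 2) * (\<Phi> u v * P u v)
        + (1 + u) powr (\<beta> - 1) * (Q u v * P u v + \<Phi> u v * (- nl p (\<Phi> u v) / 4)))
   + \<sigma>w p \<alpha> * (1 - \<alpha>) * cw p \<alpha> \<beta> * (1 + v) powr (\<alpha> - 2) * ((\<beta> - 1) * (1 + u) powr (\<beta> - 2) * (\<Phi> u v)\<^sup>2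
        + (1 + u) powr (\<beta> - 1) * (2 * \<Phi> u v * Q u v))))"

lemma powr_shift:
  fixes x k :: real
  assumes "x > 0"
  shows "x powr (k - 1) = x powr (k - 2) * x" "x powr k = x powr (k - 2) * x\<^sup>2"
  using powr_add[of x "k - 2" 1] powr_add[of x "k - 2" 2] assms by auto

text \<open>A fraction \<sigma> of the coefficient of P^2 is kept. The remaining fraction 1 -
  \<sigma> forms a perfect square with the mixed term and the \<Phi>^2 term, by (1 - \<sigma>) c = 4
  \<beta> \<sigma> (1 - \<alpha>); this requirement is the origin of
  \<open>\<sigma>w\<close>.\<close>

lemma Jdens_lower:
  assumes ad: "admissible p \<alpha> \<beta>" and u: "u \<ge> 0" and v: "v \<ge> 0"
  shows "\<sigma>w p \<alpha> * (4 * \<beta> * (1 + v) powr \<alpha> * (1 + u) powr (\<beta> - 1)) * (P u v)\<^sup>2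
     + \<alpha> * (1 + v) powr (\<alpha> - 1) * (1 + u) powr \<beta> * pot p (\<Phi> u v) \<le> Jdens p \<alpha> \<beta> \<Phi> P u v"
proof -
  note e = admissible_eqs[OF ad]
  have a: "0 < \<alpha>" "\<alpha> < 1" "0 < \<beta>" "\<beta> < 1" using ad by (auto simp: admissible_def)
  define g where "g = (1 + u) powr (\<beta> - 1)"
  define V where "V = 1 + v"
  define r where "r = V powr (\<alpha> - 2)"
  have V: "V > 0" using v by (simp add: V_def)
  note sh = powr_shift[OF V, of \<alpha>, folded r_def]
  define s where "s = \<sigma>w p \<alpha>"
  define c where "c = cw p \<alpha> \<beta>"
  have sq: "(4 * \<beta> * (1 - s)) * (s * (1 - \<alpha>) * c) = ((1 - s) * c)\<^sup>2"
    unfolding power2_eq_square using e(5) by (simp add: s_def c_def)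
  have "0 \<le> 4 * \<beta> * (1 - s) * (V * P u v)\<^sup>2 + 2 * ((1 - s) * c) * (V * P u v) * \<Phi> u v + s * (1 - \<alpha>) * c * (\<Phi> u v)\<^sup>2"
    by (rule nonneg_of_square[OF _ sq]) (use a e in \<open>simp add: s_def\<close>)
  then have "0 \<le> r * g * (4 * \<beta> * (1 - s) * (V * P u v)\<^sup>2 + 2 * ((1 - s) * c) * (V * P u v) * \<Phi> u v + s * (1 - \<alpha>) * c * (\<Phi> u v)\<^sup>2)"
    by (intro mult_nonneg_nonneg) (auto simp: r_def g_def)
  also have "\<dots> = Jdens p \<alpha> \<beta> \<Phi> P u v - (\<sigma>w p \<alpha> * (4 * \<beta> * (1 + v) powr \<alpha> * (1 + u) powr (\<beta> - 1)) * (P u v)\<^sup>2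
     + \<alpha> * (1 + v) powr (\<alpha> - 1) * (1 + u) powr \<beta> * pot p (\<Phi> u v))"
    unfolding Jdens_def V_def[symmetric] sh s_def[symmetric] c_def[symmetric] g_def[symmetric] r_def[symmetric]
    by (simp add: algebra_simps power2_eq_square)
  finally show ?thesis by simp
qed

text \<open>On the cone u = 0 the interior flux is compared with the exterior one, which contains no
  \<Phi>^2. After splitting the mixed term by 2 x y <= x^2 + y^2, everything quadratic in \<Phi>
  goes into the summand with K; since \<alpha> <= 1, the other weights are at most those of the
  exterior flux.\<close>

lemma Jdens_upper:
  assumes ad: "admissible p \<alpha> \<beta>" and v: "v \<ge> 0" and K: "(\<Phi> 0 v)\<^sup>2 \<le> K"
  shows "Jdens p \<alpha> \<beta> \<Phi> P 0 v \<le> 2 * (4 * (1 + v) * (P 0 v)\<^sup>2 + (1 - 0) * pot p (\<Phi> 0 v)) + 8 * K * (1 + v) powr (\<alpha> - 2)"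
proof -
  note e = admissible_eqs[OF ad]
  have a: "p > 1" "0 < \<alpha>" "\<alpha> < 1" "0 < \<beta>" "\<beta> < 1" using ad by (auto simp: admissible_def)
  define V where "V = 1 + v"
  define r where "r = V powr (\<alpha> - 2)"
  have r: "r \<ge> 0" by (simp add: r_def)
  have V: "V \<ge> 1" using v by (simp add: V_def)
  note sh = powr_shift[of V \<alpha>, folded r_def]
  define s where "s = \<sigma>w p \<alpha>"
  define c where "c = cw p \<alpha> \<beta>"
  have sc: "0 < s" "s < 1" "0 < c" "c < 4" using e by (auto simp: s_def c_def)
  define F where "F = \<Phi> 0 v"
  define D where "D = P 0 v"
  define w where "w = pot p F"
  have w0: "w \<ge> 0" using pot_nonneg[OF a(1)] by (simp add: w_def)
  have "2 * (V * D) * F \<le> (V * D)\<^sup>2 + F\<^sup>2" by (rule sum_squares_bound)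
  then have "(1 - s) * c * (2 * (V * D) * F) \<le> (1 - s) * c * ((V * D)\<^sup>2 + F\<^sup>2)"
    using sc by (intro mult_left_mono) auto
  also have "\<dots> \<le> 4 * ((V * D)\<^sup>2 + F\<^sup>2)"
    using sc mult_mono[of "1 - s" 1 c 4] by (intro mult_right_mono) auto
  finally have 1: "(1 - s) * c * (2 * (V * D) * F) \<le> 4 * ((V * D)\<^sup>2 + F\<^sup>2)" .
  have "s * (1 - \<alpha>) * c \<le> 1 * 1 * 4" using sc a by (intro mult_mono) auto
  then have 2: "s * (1 - \<alpha>) * c * F\<^sup>2 \<le> 4 * F\<^sup>2" by (intro mult_right_mono) auto
  have 3: "4 * \<beta> * (V * D)\<^sup>2 \<le> 4 * (V * D)\<^sup>2" using a by (intro mult_right_mono) auto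
  have "r * (4 * \<beta> * (V * D)\<^sup>2 + (1 - s) * c * (2 * (V * D) * F) + s * (1 - \<alpha>) * c * F\<^sup>2)
     \<le> r * (8 * (V * D)\<^sup>2 + 8 * F\<^sup>2)"
    using 1 2 3 r by (intro mult_left_mono) auto
  also have "\<dots> = 8 * (r * V\<^sup>2) * D\<^sup>2 + 8 * r * F\<^sup>2" by (simp add: algebra_simps power2_eq_square)
  also have "\<dots> \<le> 8 * V * D\<^sup>2 + 8 * r * K"
  proof -
    have "r * V\<^sup>2 \<le> V" using powr_mono[of \<alpha> 1 V] V a by (simp add: sh(2)[symmetric])
    then show ?thesis using r K by (intro add_mono mult_right_mono mult_left_mono) (auto simp: F_def)
  qed
  finally have 4: "r * (4 * \<beta> * (V * D)\<^sup>2 + (1 - s) * c * (2 * (V * D) * F) + s * (1 - \<alpha>) * c * F\<^sup>2)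
     \<le> 8 * V * D\<^sup>2 + 8 * r * K" .
  have "r * V \<le> 1" using powr_mono[of "\<alpha> - 1" 0 V] V a by (simp add: sh(1)[symmetric])
  then have 5: "\<alpha> * (r * V) * w \<le> 2 * w"
    using a w0 r V mult_mono[of \<alpha> 1 "r * V" 1] by (intro mult_right_mono) auto
  have "Jdens p \<alpha> \<beta> \<Phi> P 0 v = r * (4 * \<beta> * (V * D)\<^sup>2 + (1 - s) * c * (2 * (V * D) * F) + s * (1 - \<alpha>) * c * F\<^sup>2)
     + \<alpha> * (r * V) * w"
    unfolding Jdens_def V_def[symmetric] s_def[symmetric] c_def[symmetric] F_def[symmetric] D_def[symmetric] w_def[symmetric]
    using V by (simp add: sh r_def[symmetric] algebra_simps power2_eq_square)
  also have "\<dots> \<le> 8 * V * D\<^sup>2 + 8 * r * K + 2 * w" using 4 5 by linarith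
  finally show ?thesis
    unfolding V_def[symmetric] F_def[symmetric] D_def[symmetric] w_def[symmetric] r_def[symmetric]
    by (simp add: algebra_simps)
qed

text \<open>All powers reduce to r = (1 + v) powr (\<alpha> - 2) and s = (1 + u) powr (\<beta> - 2)
  times powers of V = 1 + v and U = 1 + u, which makes the claim polynomial. D, G, F stand for P, Q,
  \<Phi>, and n, w for nonlinearity and potential. The products F D and F G cancel; a quadratic form
  in V D and U G, a \<Phi>^2 term of good sign and the bracket that determines c remain.\<close>

lemma divergence_identity:
  fixes \<alpha> \<beta> r s c U V D G F n w \<sigma> :: real
  shows "4 * \<beta> * (r * V\<^sup>2) * ((\<beta> - 1) * s * D\<^sup>2 + s * U * (2 * D * (- n / 4)))
     + (\<alpha> * (r * V) * (\<beta> * (s * U) * w + s * U\<^sup>2 * (2 * n * G))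
     + (2 * (1 - \<sigma>) * c * (r * V) * ((\<beta> - 1) * s * (F * D) + s * U * (G * D + F * (- n / 4)))
     + \<sigma> * (1 - \<alpha>) * c * r * ((\<beta> - 1) * s * F\<^sup>2 + s * U * (2 * F * G))))
   + (4 * \<alpha> * (s * U\<^sup>2) * ((\<alpha> - 1) * r * G\<^sup>2 + r * V * (2 * G * (- n / 4)))
     + (\<beta> * (s * U) * (\<alpha> * (r * V) * w + r * V\<^sup>2 * (2 * n * D))
     + (2 * (1 - (1 - \<sigma>)) * c * (s * U) * ((\<alpha> - 1) * r * (F * G) + r * V * (D * G + F * (- n / 4)))
     + (1 - \<sigma>) * (1 - \<beta>) * c * s * ((\<alpha> - 1) * r * F\<^sup>2 + r * V * (2 * F * D)))))
   = r * s * (- (4 * \<beta> * (1 - \<beta>) * (V * D)\<^sup>2 + 2 * (- c) * (V * D) * (U * G) + 4 * \<alpha> * (1 - \<alpha>) * (U * G)\<^sup>2)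
       - c * (1 - \<alpha>) * (1 - \<beta>) * F\<^sup>2)
     + r * s * U * V * (2 * \<alpha> * \<beta> * w - c / 2 * (F * n))"
  by (simp add: power2_eq_square) algebra

lemma divergence_nonpos:
  assumes ad: "admissible p \<alpha> \<beta>" and u: "u \<ge> 0" and v: "v \<ge> 0"
  shows "Jdiv p \<alpha> \<beta> \<Phi> P Q u v + Jdiv p \<beta> \<alpha> (\<lambda>u v. \<Phi> v u) (\<lambda>u v. Q v u) (\<lambda>u v. P v u) v u \<le> 0"
proof -
  note e = admissible_eqs[OF ad]
  have a: "p > 1" "0 < \<alpha>" "\<alpha> < 1" "0 < \<beta>" "\<beta> < 1" using ad by (auto simp: admissible_def)
  define U where "U = 1 + u"
  define V where "V = 1 + v"
  define r where "r = V powr (\<alpha> - 2)"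
  define s where "s = U powr (\<beta> - 2)"
  have UV: "U > 0" "V > 0" using u v by (auto simp: U_def V_def)
  note shv = powr_shift[OF UV(2), of \<alpha>, folded r_def]
  note shu = powr_shift[OF UV(1), of \<beta>, folded s_def]
  define c where "c = cw p \<alpha> \<beta>"
  have c': "cw p \<beta> \<alpha> = c" by (simp add: c_def cw_def)
  define n where "n = nl p (\<Phi> u v)"
  define w where "w = pot p (\<Phi> u v)"
  have cp: "c * (p + 1) = 8 * \<alpha> * \<beta>" using a by (simp add: c_def cw_def)
  \<comment> \<open>The identity \<open>mult_nl\<close> expresses the homogeneity of the potential
    and turns the bracket into one equation for c, solved by \<open>cw\<close>.\<close>
  have "c / 2 * (\<Phi> u v * n) = c / 2 * ((p + 1) / 2 * w)"
    unfolding n_def w_def mult_nl[OF a(1)] ..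
  also have "\<dots> = (c * (p + 1)) / 4 * w" by simp
  also have "\<dots> = 2 * \<alpha> * \<beta> * w" unfolding cp by simp
  finally have "c / 2 * (\<Phi> u v * n) = 2 * \<alpha> * \<beta> * w" .
  then have z: "2 * \<alpha> * \<beta> * w - c / 2 * (\<Phi> u v * n) = 0" by simp
  \<comment> \<open>The form has discriminant zero by the formula for c^2, so it is a square up to a
    positive factor.\<close>
  have q: "0 \<le> 4 * \<beta> * (1 - \<beta>) * (V * P u v)\<^sup>2 + 2 * (- c) * (V * P u v) * (U * Q u v) + 4 * \<alpha> * (1 - \<alpha>) * (U * Q u v)\<^sup>2"
    by (rule nonneg_of_square) (use a e(8) in \<open>auto simp: c_def\<close>)
  have "Jdiv p \<alpha> \<beta> \<Phi> P Q u v + Jdiv p \<beta> \<alpha> (\<lambda>u v. \<Phi> v u) (\<lambda>u v. Q v u) (\<lambda>u v. P v u) v u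
    = r * s * (- (4 * \<beta> * (1 - \<beta>) * (V * P u v)\<^sup>2 + 2 * (- c) * (V * P u v) * (U * Q u v) + 4 * \<alpha> * (1 - \<alpha>) * (U * Q u v)\<^sup>2)
       - c * (1 - \<alpha>) * (1 - \<beta>) * (\<Phi> u v)\<^sup>2)
     + r * s * U * V * (2 * \<alpha> * \<beta> * w - c / 2 * (\<Phi> u v * n))"
    unfolding Jdiv_def V_def[symmetric] U_def[symmetric] shv shu n_def[symmetric] w_def[symmetric] c' c_def[symmetric] e(4)
      r_def[symmetric] s_def[symmetric]
    by (rule divergence_identity)
  also have "\<dots> = r * s * (- (4 * \<beta> * (1 - \<beta>) * (V * P u v)\<^sup>2 + 2 * (- c) * (V * P u v) * (U * Q u v) + 4 * \<alpha> * (1 - \<alpha>) * (U * Q u v)\<^sup>2)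
       - c * (1 - \<alpha>) * (1 - \<beta>) * (\<Phi> u v)\<^sup>2)" unfolding z by simp
  also have "\<dots> \<le> 0"
  proof (rule mult_nonneg_nonpos)
    have "0 \<le> c * (1 - \<alpha>) * (1 - \<beta>) * (\<Phi> u v)\<^sup>2" using a e(6) by (simp add: c_def)
    then show "- (4 * \<beta> * (1 - \<beta>) * (V * P u v)\<^sup>2 + 2 * (- c) * (V * P u v) * (U * Q u v) + 4 * \<alpha> * (1 - \<alpha>) * (U * Q u v)\<^sup>2)
       - c * (1 - \<alpha>) * (1 - \<beta>) * (\<Phi> u v)\<^sup>2 \<le> 0" using q by linarith
  qed (simp add: r_def s_def)
  finally show ?thesis .
qed

lemma integral_weight_bound:
  fixes \<alpha> V :: real
  assumes "0 < \<alpha>" "\<alpha> < 1" "V \<ge> 0"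
  shows "(LBINT v:{0..V}. (1 + v) powr (\<alpha> - 2)) \<le> 1 / (1 - \<alpha>)"
proof -
  have ac: "ac_deriv (\<lambda>v. (1 + v) powr (\<alpha> - 1) / (\<alpha> - 1)) (\<lambda>v. (1 + v) powr (\<alpha> - 2)) 0 V"
    using assms by (intro ac_deriv_C1) (auto intro!: derivative_eq_intros continuous_intros)
  have "(LBINT v:{0..V}. (1 + v) powr (\<alpha> - 2)) = (1 + V) powr (\<alpha> - 1) / (\<alpha> - 1) - 1 / (\<alpha> - 1)"
    using ac_deriv_eq[OF ac assms(3)] by simp
  also have "\<dots> \<le> - 1 / (\<alpha> - 1)" using assms by (simp add: divide_nonneg_neg)
  also have "\<dots> = 1 / (1 - \<alpha>)" using assms by (simp add: field_simps)
  finally show ?thesis .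
qed

section \<open>Flux from the light cone into the interior\<close>

context wave
begin

lemma Jdens_ac_deriv:
  assumes "0 \<le> a"
  shows "ac_deriv (\<lambda>u. Jdens p \<alpha> \<beta> \<Phi> P u v) (\<lambda>u. Jdiv p \<alpha> \<beta> \<Phi> P Q u v) a b"
proof -
  have w: "ac_deriv (\<lambda>u. (1 + u) powr k * f u) (\<lambda>u. k * (1 + u) powr (k - 1) * f u + (1 + u) powr k * f' u) a b"
    if "ac_deriv f f' a b" for f f' k
    using assms that by (intro ac_deriv_weight_mult) (auto intro!: derivative_eq_intros continuous_intros)
  have w2: "ac_deriv (\<lambda>u. (1 + u) powr (k - 1) * f u) (\<lambda>u. (k - 1) * (1 + u) powr (k - 2) * f u + (1 + u) powr (k - 1) * f' u) a b"
    if "ac_deriv f f' a b" for f f' k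
    using w[OF that, of "k - 1"] by simp
  show ?thesis unfolding Jdens_def Jdiv_def
    by (intro ac_deriv_add ac_deriv_cmult w2[OF ac_deriv_power2[OF P_u]] w[OF ac_deriv_pot[OF p \<Phi>_u]]
        w2[OF ac_deriv_mult[OF \<Phi>_u P_u]] w2[OF ac_deriv_power2[OF \<Phi>_u]])
qed

lemma Jdiv_rect_integrable:
  assumes "0 \<le> a" "0 \<le> c"
  shows "set_integrable lborel ({a..b} \<times> {c..d}) (\<lambda>z. Jdiv p \<alpha> \<beta> \<Phi> P Q (fst z) (snd z))"
proof -
  have cn: "continuous_on S (\<lambda>z. nl p (\<Phi> (fst z) (snd z)))" "continuous_on S (\<lambda>z. pot p (\<Phi> (fst z) (snd z)))" for S
    by (rule continuous_on_compose2[OF nl_continuous[OF p, of UNIV] cont_rect] continuous_on_compose2[OF pot_continuous[OF p, of UNIV] cont_rect]; simp)+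
  have cpu: "continuous_on ({a..b} \<times> {c..d}) (\<lambda>z. (1 + fst z) powr k)" for k
    using assms by (intro continuous_intros) auto
  have cpv: "continuous_on ({a..b} \<times> {c..d}) (\<lambda>z. (1 + snd z) powr k)" for k
    using assms by (intro continuous_intros) auto
  define s where "s = \<sigma>w p \<alpha>"
  define e where "e = cw p \<alpha> \<beta>"
  define k1 where "k1 u v = 4 * \<beta> * (1 + v) powr \<alpha> * ((\<beta> - 1) * (1 + u) powr (\<beta> - 2))" for u v
  define k2 where "k2 u v = - 2 * \<beta> * (1 + v) powr \<alpha> * (1 + u) powr (\<beta> - 1) * nl p (\<Phi> u v)
     + 2 * (1 - s) * e * (1 + v) powr (\<alpha> - 1) * ((\<beta> - 1) * (1 + u) powr (\<beta> - 2)) * \<Phi> u v" for u v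
  define k3 where "k3 u v = 2 * \<alpha> * (1 + v) powr (\<alpha> - 1) * (1 + u) powr \<beta> * nl p (\<Phi> u v)
     + 2 * s * (1 - \<alpha>) * e * (1 + v) powr (\<alpha> - 2) * (1 + u) powr (\<beta> - 1) * \<Phi> u v" for u v
  define k4 where "k4 u v = 2 * (1 - s) * e * (1 + v) powr (\<alpha> - 1) * (1 + u) powr (\<beta> - 1)" for u v
  define k5 where "k5 u v = \<alpha> * (1 + v) powr (\<alpha> - 1) * (\<beta> * (1 + u) powr (\<beta> - 1) * pot p (\<Phi> u v))
     + (- (1/2) * (1 - s) * e * (1 + v) powr (\<alpha> - 1) * (1 + u) powr (\<beta> - 1) * (\<Phi> u v * nl p (\<Phi> u v))
     + s * (1 - \<alpha>) * e * (1 + v) powr (\<alpha> - 2) * ((\<beta> - 1) * (1 + u) powr (\<beta> - 2) * (\<Phi> u v)\<^sup>2))" for u v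
  have eq: "Jdiv p \<alpha> \<beta> \<Phi> P Q (fst z) (snd z) = k1 (fst z) (snd z) * (P (fst z) (snd z))\<^sup>2 + (k2 (fst z) (snd z) * P (fst z) (snd z)
     + (k3 (fst z) (snd z) * Q (fst z) (snd z) + (k4 (fst z) (snd z) * (P (fst z) (snd z) * Q (fst z) (snd z)) + k5 (fst z) (snd z))))" for z
    unfolding Jdiv_def s_def[symmetric] e_def[symmetric] k1_def k2_def k3_def k4_def k5_def by algebra
  note ci = continuous_on_add continuous_on_mult continuous_on_const continuous_on_power cn cpu cpv cont_rect
  have c: "continuous_on ({a..b} \<times> {c..d}) (\<lambda>z. k1 (fst z) (snd z))"
    "continuous_on ({a..b} \<times> {c..d}) (\<lambda>z. k2 (fst z) (snd z))"
    "continuous_on ({a..b} \<times> {c..d}) (\<lambda>z. k3 (fst z) (snd z))"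
    "continuous_on ({a..b} \<times> {c..d}) (\<lambda>z. k4 (fst z) (snd z))"
    "continuous_on ({a..b} \<times> {c..d}) (\<lambda>z. k5 (fst z) (snd z))"
    unfolding k1_def k2_def k3_def k4_def k5_def by (intro ci)+
  show ?thesis unfolding eq
    by (rule set_integral_add(1)[OF rect_integrable(1)[OF c(1)] set_integral_add(1)[OF rect_integrable(3)[OF c(2)]
          set_integral_add(1)[OF rect_integrable(4)[OF c(3)] set_integral_add(1)[OF rect_integrable(5)[OF c(4)] rect_integrable(6)[OF c(5)]]]]])
qed

lemma Jdens_line_integrable:
  assumes "0 \<le> a" "0 \<le> u"
  shows "set_integrable lborel {a..b} (\<lambda>v. Jdens p \<alpha> \<beta> \<Phi> P u v)"
proof -
  have cpv: "continuous_on {a..b} (\<lambda>v. (1 + v) powr k)" for k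
    using assms by (intro continuous_intros) auto
  have cpot: "continuous_on {a..b} (\<lambda>v. pot p (\<Phi> u v))"
    by (rule continuous_on_compose2[OF pot_continuous[OF p, of UNIV] continuous_v]) auto
  have iP: "set_integrable lborel {a..b} (P u)" by (rule ac_deriv_integrable[OF \<Phi>_v])
  have eq: "Jdens p \<alpha> \<beta> \<Phi> P u v = (4 * \<beta> * (1 + v) powr \<alpha> * (1 + u) powr (\<beta> - 1)) * (P u v)\<^sup>2
     + ((2 * (1 - \<sigma>w p \<alpha>) * cw p \<alpha> \<beta> * (1 + v) powr (\<alpha> - 1) * ((1 + u) powr (\<beta> - 1) * \<Phi> u v)) * P u v
     + (\<alpha> * (1 + v) powr (\<alpha> - 1) * ((1 + u) powr \<beta> * pot p (\<Phi> u v))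
     + \<sigma>w p \<alpha> * (1 - \<alpha>) * cw p \<alpha> \<beta> * (1 + v) powr (\<alpha> - 2) * ((1 + u) powr (\<beta> - 1) * (\<Phi> u v)\<^sup>2)))" for v
    unfolding Jdens_def by algebra
  have cP: "continuous_on {a..b} (\<Phi> u)" by (rule continuous_v)
  note ci = continuous_on_add continuous_on_mult continuous_on_const continuous_on_power cpv cpot cP
  show ?thesis unfolding eq
    by (rule set_integral_add(1)[OF set_integrable_mult_continuous[OF P_sq]
          set_integral_add(1)[OF set_integrable_mult_continuous[OF iP] set_integrable_continuous]])
      (intro ci compact_Icc)+
qed

text \<open>The exterior bound at u = 0, where the weight is at least 1, raised to the power that
  turns |\<Phi>| powr ((p + 3) / 2) into \<Phi>^2. It depends on p and M alone, so it may enter the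
  constants of the theorem and agrees for all reflected solutions.\<close>

definition sup_sq :: real where "sup_sq = ((p + 3) * (p + 1) / 2 * M) powr (4 / (p + 3))"

lemma cone_bound:
  assumes "v \<ge> 0" shows "(\<Phi> 0 v)\<^sup>2 \<le> sup_sq"
proof -
  have "\<bar>\<Phi> 0 v\<bar> powr ((p + 3) / 2) \<le> (p + 3) * (p + 1) / 4 * (2 * M) / sqrt ((1 + v) * (1 - 0))"
    using exterior_decay[of 0 v] assms by simp
  also have "\<dots> \<le> (p + 3) * (p + 1) / 2 * M / 1"
    using assms p M_nonneg by (intro frac_le) auto
  finally have "\<bar>\<Phi> 0 v\<bar> powr ((p + 3) / 2) \<le> (p + 3) * (p + 1) / 2 * M" by simp
  then have "(\<bar>\<Phi> 0 v\<bar> powr ((p + 3) / 2)) powr (4 / (p + 3)) \<le> sup_sq"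
    unfolding sup_sq_def using p by (intro powr_mono2) auto
  moreover have "(p + 3) / 2 * (4 / (p + 3)) = 2" using p by (simp add: field_simps)
  ultimately show ?thesis by (cases "\<Phi> 0 v = 0") (simp_all add: powr_powr sup_sq_def)
qed

lemma Jdens_initial:
  assumes ad: "admissible p \<alpha> \<beta>" and V: "V \<ge> 0"
  shows "(LBINT v:{0..V}. Jdens p \<alpha> \<beta> \<Phi> P 0 v) \<le> 4 * M + 8 * sup_sq / (1 - \<alpha>)"
proof -
  have a: "0 < \<alpha>" "\<alpha> < 1" using ad by (auto simp: admissible_def)
  have iw: "set_integrable lborel {0..V} (\<lambda>v. (1 + v) powr (\<alpha> - 2))"
    by (intro set_integrable_continuous) (auto intro!: continuous_intros)
  have ie: "set_integrable lborel {0..V} (\<lambda>v. 4 * (1 + v) * (P 0 v)\<^sup>2 + (1 - 0) * pot p (\<Phi> 0 v))"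
    by (intro set_integral_add(1) set_integrable_mult_continuous[OF P_sq] set_integrable_continuous
        continuous_intros continuous_on_compose2[OF pot_continuous[OF p, of UNIV] continuous_v]) auto
  have "(LBINT v:{0..V}. Jdens p \<alpha> \<beta> \<Phi> P 0 v) \<le> (LBINT v:{0..V}.
      2 * (4 * (1 + v) * (P 0 v)\<^sup>2 + (1 - 0) * pot p (\<Phi> 0 v)) + 8 * sup_sq * (1 + v) powr (\<alpha> - 2))"
  proof (rule set_integral_mono)
    show "set_integrable lborel {0..V} (\<lambda>v. 2 * (4 * (1 + v) * (P 0 v)\<^sup>2 + (1 - 0) * pot p (\<Phi> 0 v)) + 8 * sup_sq * (1 + v) powr (\<alpha> - 2))"
      by (intro set_integral_add(1) set_integrable_mult_right ie iw)
    show "Jdens p \<alpha> \<beta> \<Phi> P 0 v \<le> 2 * (4 * (1 + v) * (P 0 v)\<^sup>2 + (1 - 0) * pot p (\<Phi> 0 v)) + 8 * sup_sq * (1 + v) powr (\<alpha> - 2)"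
      if "v \<in> {0..V}" for v
      using that by (intro Jdens_upper[OF ad] cone_bound) auto
  qed (rule Jdens_line_integrable; simp)
  also have "\<dots> = 2 * (LBINT v:{0..V}. 4 * (1 + v) * (P 0 v)\<^sup>2 + (1 - 0) * pot p (\<Phi> 0 v))
      + 8 * sup_sq * (LBINT v:{0..V}. (1 + v) powr (\<alpha> - 2))"
    unfolding set_integral_add(2)[OF set_integrable_mult_right[OF ie] set_integrable_mult_right[OF iw]] set_integral_mult_right ..
  also have "\<dots> \<le> 2 * (2 * M) + 8 * sup_sq * (1 / (1 - \<alpha>))"
    using exterior_flux[of 0 V] V integral_weight_bound[OF a V]
    by (intro add_mono mult_left_mono) (auto simp: sup_sq_def)
  finally show ?thesis by simp
qed

end

context wave
begin

interpretation swap: wave p M "\<lambda>u v. \<Phi> v u" "\<lambda>u v. Q v u" "\<lambda>u v. P v u"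
  by (rule wave_swap) unfold_locales

text \<open>Two edges of the rectangle {0..u0} x {0..V} lie on the light cone of the origin. The
  flux through u = 0 is bounded by \<open>Jdens_initial\<close>, the one through v = 0 by the same
  lemma for the reflected solution. The flux through v = V is nonnegative by
  \<open>Jdens_lower\<close>.\<close>

lemma interior_flux:
  assumes ad: "admissible p \<alpha> \<beta>" and u0: "u0 \<ge> 0" and V: "V \<ge> 0"
  shows "(LBINT v:{0..V}. Jdens p \<alpha> \<beta> \<Phi> P u0 v) \<le> 8 * M + 8 * sup_sq * (1 / (1 - \<alpha>) + 1 / (1 - \<beta>))"
proof -
  note ads = admissible_sym[OF ad]
  define Ju where "Ju u v = Jdens p \<alpha> \<beta> \<Phi> P u v" for u v
  define Jv where "Jv u v = Jdens p \<beta> \<alpha> (\<lambda>u v. \<Phi> v u) (\<lambda>u v. Q v u) v u" for u v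
  define A where "A u v = Jdiv p \<alpha> \<beta> \<Phi> P Q u v" for u v
  define B where "B u v = Jdiv p \<beta> \<alpha> (\<lambda>u v. \<Phi> v u) (\<lambda>u v. Q v u) (\<lambda>u v. P v u) v u" for u v
  have iB: "set_integrable lborel ({0..u0} \<times> {0..V}) (\<lambda>z. B (fst z) (snd z))"
  proof -
    have i: "integrable (lborel \<Otimes>\<^sub>M lborel) (\<lambda>z. indicator ({0..V} \<times> {0..u0}) z *\<^sub>R B (snd z) (fst z))"
      using swap.Jdiv_rect_integrable[of 0 0 V u0 \<beta> \<alpha>] unfolding set_integrable_def lborel_prod B_def by simp
    have eq: "(\<lambda>(x,y). (\<lambda>z. indicator ({0..V} \<times> {0..u0}) z *\<^sub>R B (snd z) (fst z)) (y, x))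
       = (\<lambda>z. indicator ({0..u0} \<times> {0..V}) z *\<^sub>R B (fst z) (snd z))"
      by (auto simp: indicator_def fun_eq_iff)
    show ?thesis
      using lborel_pair.integrable_product_swap[OF i] unfolding eq set_integrable_def lborel_prod .
  qed
  have "(LBINT v:{0..V}. Ju u0 v) + (LBINT u:{0..u0}. Jv u V)
    \<le> (LBINT v:{0..V}. Ju 0 v) + (LBINT u:{0..u0}. Jv u 0)"
  proof (rule green_inequality[where A = A and B = B and lu = "\<lambda>_. 0" and lv = "\<lambda>_. 0"])
    show "Ju u0 v - Ju 0 v = (LBINT u:{0..u0}. A u v)" if "v \<in> {0..V}" for v
      using u0 unfolding Ju_def A_def by (intro ac_deriv_eq[OF Jdens_ac_deriv]) auto
    show "Jv u V - Jv u 0 = (LBINT v:{0..V}. B u v)" if "u \<in> {0..u0}" for u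
      using V unfolding Jv_def B_def by (intro ac_deriv_eq[OF swap.Jdens_ac_deriv]) auto
    show "A u v + B u v \<le> 0" if "u \<in> {0..u0}" "v \<in> {0..V}" for u v
      unfolding A_def B_def using that by (intro divergence_nonpos[OF ad]) auto
    show "set_integrable lborel ({0..u0} \<times> {0..V}) (\<lambda>z. A (fst z) (snd z))"
      unfolding A_def by (rule Jdiv_rect_integrable) auto
    show "set_integrable lborel {0..V} (Ju u0)" "set_integrable lborel {0..V} (Ju 0)"
      unfolding Ju_def[abs_def] using u0 by (auto intro: Jdens_line_integrable)
    show "set_integrable lborel {0..u0} (\<lambda>u. Jv u V)" "set_integrable lborel {0..u0} (\<lambda>u. Jv u 0)"
      unfolding Jv_def using V by (auto intro: swap.Jdens_line_integrable)
  qed (use iB in auto)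
  moreover have "0 \<le> (LBINT u:{0..u0}. Jv u V)"
  proof -
    have "0 \<le> Jv u V" if "u \<ge> 0" for u
    proof -
      have "0 \<le> \<sigma>w p \<beta> * (4 * \<alpha> * (1 + u) powr \<beta> * (1 + V) powr (\<alpha> - 1)) * (Q u V)\<^sup>2
         + \<beta> * (1 + u) powr (\<beta> - 1) * (1 + V) powr \<alpha> * pot p (\<Phi> u V)"
        using admissible_eqs(2)[OF ads] ad pot_nonneg[OF p] by (simp add: admissible_def)
      also have "\<dots> \<le> Jv u V" unfolding Jv_def by (rule Jdens_lower[OF ads V that])
      finally show ?thesis .
    qed
    then show ?thesis unfolding set_lebesgue_integral_def
      by (intro Bochner_Integration.integral_nonneg) (auto simp: indicator_def)
  qed
  moreover have "(LBINT v:{0..V}. Ju 0 v) \<le> 4 * M + 8 * sup_sq / (1 - \<alpha>)"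
    unfolding Ju_def by (rule Jdens_initial[OF ad V])
  moreover have "(LBINT u:{0..u0}. Jv u 0) \<le> 4 * M + 8 * sup_sq / (1 - \<beta>)"
    unfolding Jv_def by (rule swap.Jdens_initial[OF ads u0])
  ultimately show ?thesis unfolding Ju_def by (simp add: distrib_left)
qed

text \<open>The weights left by \<open>Jdens_lower\<close> have the product 4 \<sigma> \<alpha>
  \<beta> (1 + v) powr (2 \<alpha> - 1) * (1 + u0) powr (2 \<beta> - 1). The assumption \<alpha> >=
  1/2 makes it nondecreasing in v, while \<beta> enters only through a factor that is constant along
  the ray.\<close>

lemma interior_decay:
  assumes ad: "admissible p \<alpha> \<beta>" and al: "\<alpha> \<ge> 1/2" and u0: "u0 \<ge> 0" and v0: "v0 \<ge> 0"
  shows "\<bar>\<Phi> u0 v0\<bar> powr ((p + 3) / 2) \<le>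
    (p + 3) * (p + 1) / 4 * (8 * M + 8 * sup_sq * (1 / (1 - \<alpha>) + 1 / (1 - \<beta>)))
      / sqrt (4 * \<sigma>w p \<alpha> * \<alpha> * \<beta> * ((1 + v0) powr (2 * \<alpha> - 1) * (1 + u0) powr (2 * \<beta> - 1)))"
proof -
  define a where "a v = \<sigma>w p \<alpha> * (4 * \<beta> * (1 + v) powr \<alpha> * (1 + u0) powr (\<beta> - 1))" for v
  define b where "b v = \<alpha> * (1 + v) powr (\<alpha> - 1) * (1 + u0) powr \<beta>" for v
  have al0: "0 < \<alpha>" "\<alpha> < 1" "0 < \<beta>" "\<beta> < 1" using ad by (auto simp: admissible_def)
  note s = admissible_eqs(2,3)[OF ad]
  have i: "set_integrable lborel {x..V} (\<lambda>v. a v * (P u0 v)\<^sup>2 + b v * pot p (\<Phi> u0 v))" if "0 \<le> x" for x V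
    unfolding a_def b_def using that
    by (intro set_integral_add(1) set_integrable_mult_continuous[OF P_sq] set_integrable_continuous
        continuous_intros continuous_on_compose2[OF pot_continuous[OF p, of UNIV] continuous_v]) auto
  show ?thesis
  proof (rule decay_along_ray[OF p \<Phi>_v v0, where a = a and b = b and \<kappa> = \<alpha>])
    show "0 \<le> a v" for v using s al0 by (simp add: a_def)
    show "0 < sqrt (4 * \<sigma>w p \<alpha> * \<alpha> * \<beta> * ((1 + v0) powr (2 * \<alpha> - 1) * (1 + u0) powr (2 * \<beta> - 1)))"
      using s al0 u0 v0 by simp
    show "(sqrt (4 * \<sigma>w p \<alpha> * \<alpha> * \<beta> * ((1 + v0) powr (2 * \<alpha> - 1) * (1 + u0) powr (2 * \<beta> - 1))))\<^sup>2 \<le> a v * b v"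
      if "v0 \<le> v" for v
    proof -
      have "(1 + v0) powr (2 * \<alpha> - 1) \<le> (1 + v) powr (2 * \<alpha> - 1)"
        using that v0 al by (intro powr_mono2) auto
      then have "4 * \<sigma>w p \<alpha> * \<alpha> * \<beta> * ((1 + v0) powr (2 * \<alpha> - 1) * (1 + u0) powr (2 * \<beta> - 1))
        \<le> 4 * \<sigma>w p \<alpha> * \<alpha> * \<beta> * ((1 + v) powr (2 * \<alpha> - 1) * (1 + u0) powr (2 * \<beta> - 1))"
        using s al0 by (intro mult_left_mono mult_right_mono) auto
      also have "\<dots> = a v * b v"
      proof -
        have "(1 + v) powr (2 * \<alpha> - 1) = (1 + v) powr \<alpha> * (1 + v) powr (\<alpha> - 1)"
          "(1 + u0) powr (2 * \<beta> - 1) = (1 + u0) powr (\<beta> - 1) * (1 + u0) powr \<beta>"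
          by (simp_all add: powr_add[symmetric])
        then show ?thesis by (simp add: a_def b_def)
      qed
      finally show ?thesis using s al0 by simp
    qed
    show "0 < \<alpha>" by (rule al0)
    show "\<alpha> / (1 + v) \<le> b v" if "v0 \<le> v" for v
    proof -
      have "1 / (1 + v) = (1 + v) powr (- 1)" using that v0 by (simp add: powr_minus_divide)
      also have "\<dots> \<le> (1 + v) powr (\<alpha> - 1)" using that v0 al0 by (intro powr_mono) auto
      also have "\<dots> \<le> (1 + v) powr (\<alpha> - 1) * (1 + u0) powr \<beta>"
        using ge_one_powr_ge_zero[of "1 + u0" \<beta>] u0 al0
          mult_left_mono[of 1 "(1 + u0) powr \<beta>" "(1 + v) powr (\<alpha> - 1)"] by simp
      finally show ?thesis unfolding b_def using al0 mult_left_mono[of "1 / (1 + v)" _ \<alpha>] by (simp add: mult.assoc)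
    qed
    show "set_integrable lborel {v0..V} (\<lambda>v. a v * (P u0 v)\<^sup>2 + b v * pot p (\<Phi> u0 v))" for V by (rule i[OF v0])
    show "(LBINT v:{v0..V}. a v * (P u0 v)\<^sup>2 + b v * pot p (\<Phi> u0 v))
        \<le> 8 * M + 8 * sup_sq * (1 / (1 - \<alpha>) + 1 / (1 - \<beta>))" if "v0 \<le> V" for V
    proof -
      let ?f = "\<lambda>v. a v * (P u0 v)\<^sup>2 + b v * pot p (\<Phi> u0 v)"
      have "0 \<le> ?f v" for v
        using s al0 pot_nonneg[OF p] by (simp add: a_def b_def)
      then have "0 \<le> (LBINT v:{0..v0}. ?f v)"
        unfolding set_lebesgue_integral_def by (intro Bochner_Integration.integral_nonneg) auto
      moreover have "(LBINT v:{0..V}. ?f v) = (LBINT v:{0..v0}. ?f v) + (LBINT v:{v0..V}. ?f v)"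
        using v0 that by (intro set_integral_combine_Icc i) auto
      moreover have "(LBINT v:{0..V}. ?f v) \<le> (LBINT v:{0..V}. Jdens p \<alpha> \<beta> \<Phi> P u0 v)"
      proof (rule set_integral_mono)
        show "?f v \<le> Jdens p \<alpha> \<beta> \<Phi> P u0 v" if "v \<in> {0..V}" for v
          unfolding a_def b_def using that by (intro Jdens_lower[OF ad u0]) auto
      qed (auto intro!: i Jdens_line_integrable u0)
      moreover have "(LBINT v:{0..V}. Jdens p \<alpha> \<beta> \<Phi> P u0 v) \<le> 8 * M + 8 * sup_sq * (1 / (1 - \<alpha>) + 1 / (1 - \<beta>))"
        using v0 that by (intro interior_flux[OF ad u0]) auto
      ultimately show ?thesis by linarith
    qed
  qed
qed

end

section \<open>Testing against approximate indicators\<close>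

lemma integrable_continuous_supp:
  fixes f :: "'a::euclidean_space \<Rightarrow> real"
  assumes "continuous_on UNIV f" "compact K" "\<And>x. x \<notin> K \<Longrightarrow> f x = 0"
  shows "integrable lborel f"
proof -
  have "set_integrable lborel K f"
    using assms by (intro set_integrable_continuous) (auto intro: continuous_on_subset)
  moreover have "(\<lambda>x. indicator K x *\<^sub>R f x) = f"
    using assms(3) by (auto simp: indicator_def fun_eq_iff)
  ultimately show ?thesis by (simp add: set_integrable_def)
qed

lemma integrable_mult_continuous_supp:
  fixes f g :: "'a::euclidean_space \<Rightarrow> real"
  assumes "set_integrable lborel K g" "continuous_on UNIV f" "compact K" "\<And>x. x \<notin> K \<Longrightarrow> f x = 0"
  shows "integrable lborel (\<lambda>x. g x * f x)"
proof -
  have "set_integrable lborel K (\<lambda>x. f x * g x)"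
    using assms by (intro set_integrable_mult_continuous) (auto intro: continuous_on_subset)
  moreover have "(\<lambda>x. indicator K x *\<^sub>R (f x * g x)) = (\<lambda>x. g x * f x)"
    using assms(4) by (auto simp: indicator_def fun_eq_iff)
  ultimately show ?thesis by (simp add: set_integrable_def)
qed

lemma test_functionI:
  fixes \<psi> :: "'a::euclidean_space \<Rightarrow> real"
  assumes "\<And>k. C_k k \<psi>" "compact K" "\<And>z. z \<notin> K \<Longrightarrow> \<psi> z = 0"
  shows "test_function \<psi>"
proof -
  have "closure {z. \<psi> z \<noteq> 0} \<subseteq> K"
    using assms by (intro closure_minimal compact_imp_closed) auto
  then have "compact (closure {z. \<psi> z \<noteq> 0})"
    using compact_Int_closed[OF assms(2) closed_closure] by (metis inf.absorb2)
  then show ?thesis using assms(1) by (simp add: test_function_def)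
qed

lemma tensor_has_derivative:
  fixes l1 l2 :: "'a::euclidean_space \<Rightarrow> real"
  assumes "\<And>x. (f has_real_derivative f' x) (at x)" "\<And>x. (g has_real_derivative g' x) (at x)"
    and l: "bounded_linear l1" "bounded_linear l2"
  shows "((\<lambda>z. f (l1 z) * g (l2 z)) has_derivative
     (\<lambda>v. l1 v * (f' (l1 z) * g (l2 z)) + l2 v * (f (l1 z) * g' (l2 z)))) (at z)"
proof -
  have "((\<lambda>z. f (l1 z)) has_derivative (\<lambda>v. f' (l1 z) * l1 v)) (at z)"
    using has_derivative_compose[OF bounded_linear_imp_has_derivative[OF l(1)] assms(1)[unfolded has_field_derivative_def]] .
  moreover have "((\<lambda>z. g (l2 z)) has_derivative (\<lambda>v. g' (l2 z) * l2 v)) (at z)"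
    using has_derivative_compose[OF bounded_linear_imp_has_derivative[OF l(2)] assms(2)[unfolded has_field_derivative_def]] .
  ultimately have "((\<lambda>z. f (l1 z) * g (l2 z)) has_derivative (\<lambda>v. f (l1 z) * (g' (l2 z) * l2 v) + f' (l1 z) * l1 v * g (l2 z))) (at z)"
    by (rule has_derivative_mult)
  then show ?thesis by (rule has_derivative_eq_rhs) (simp add: fun_eq_iff algebra_simps)
qed

section \<open>Smoothed indicators of intervals and their limits\<close>

locale smooth_step =
  fixes H \<rho> :: "real \<Rightarrow> real"
  assumes H_C_k: "C_k k H" and \<rho>_C_k: "C_k k \<rho>"
    and H_deriv: "(H has_real_derivative \<rho> x) (at x)"
    and \<rho>_nonneg: "0 \<le> \<rho> x" and \<rho>_supp: "x \<notin> {0<..<1} \<Longrightarrow> \<rho> x = 0" and \<rho>_integral: "(LBINT x. \<rho> x) = 1"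
    and H_0: "x \<le> 0 \<Longrightarrow> H x = 0" and H_1: "x \<ge> 1 \<Longrightarrow> H x = 1" and H_nonneg: "0 \<le> H x" and H_le_1: "H x \<le> 1"
begin

text \<open>For a <= b a smooth version of the indicator of {a..b}. Both transition layers have
  width 1 / n and lie to the right of their end points, so for n >= 1 the support is inside {a..b +
  1}; hence the b + 1 in many intervals below.\<close>

definition eta :: "real \<Rightarrow> real \<Rightarrow> real \<Rightarrow> real \<Rightarrow> real" where
  "eta n a b s = H (n * (s - a)) - H (n * (s - b))"

definition deta :: "real \<Rightarrow> real \<Rightarrow> real \<Rightarrow> real \<Rightarrow> real" where
  "deta n a b s = n * \<rho> (n * (s - a)) - n * \<rho> (n * (s - b))"

lemma C_k_scale_shift:
  assumes "C_k k f" shows "C_k k (\<lambda>s::real. f (n * (s - a)))"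
  using C_k_compose_affine[OF bounded_linear_mult_right[of n] assms, of "- (n * a)"]
  by (simp add: right_diff_distrib)

lemma eta_C_k: "C_k k (eta n a b)"
proof -
  have "C_k k (\<lambda>s. H (n * (s - a)) + (- 1) * H (n * (s - b)))"
    by (intro C_k_add C_k_mult C_k_const C_k_scale_shift H_C_k)
  then show ?thesis by (simp add: eta_def[abs_def])
qed

lemma deta_C_k: "C_k k (deta n a b)"
proof -
  have "C_k k (\<lambda>s. n * \<rho> (n * (s - a)) + (- n) * \<rho> (n * (s - b)))"
    by (intro C_k_add C_k_mult C_k_const C_k_scale_shift \<rho>_C_k)
  then show ?thesis by (simp add: deta_def[abs_def])
qed

lemma eta_deriv: "(eta n a b has_real_derivative deta n a b s) (at s)"
proof -
  have "((\<lambda>s. H (n * (s - c))) has_real_derivative n * \<rho> (n * (s - c))) (at s)" for c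
  proof -
    have "((\<lambda>s. n * (s - c)) has_real_derivative n) (at s)" by (auto intro!: derivative_eq_intros)
    from DERIV_chain2[OF H_deriv this] show ?thesis by (simp only: mult.commute)
  qed
  from DERIV_diff[OF this[of a] this[of b]] show ?thesis
    unfolding eta_def[abs_def] deta_def .
qed

lemma eta_continuous: "continuous_on S (eta n a b)"
  using eta_C_k[of 0] by (auto intro: continuous_on_subset)

lemma deta_continuous: "continuous_on S (deta n a b)"
  using deta_C_k[of 0] by (auto intro: continuous_on_subset)

lemma scaled_ge_1: "n \<ge> 1 \<Longrightarrow> x \<ge> 1 \<Longrightarrow> 1 \<le> n * (x::real)"
  using mult_mono[of 1 n 1 x] by simp

lemma eta_supp:
  assumes "n \<ge> 1" "a \<le> b" "s \<notin> {a..b + 1}" shows "eta n a b s = 0" "deta n a b s = 0"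
proof -
  consider "s < a" | "s > b + 1" using assms(3) by fastforce
  then have "eta n a b s = 0 \<and> deta n a b s = 0"
  proof cases
    case 1
    then have "n * (s - a) \<le> 0" "n * (s - b) \<le> 0" using assms by (auto simp: mult_le_0_iff)
    then show ?thesis by (simp add: eta_def deta_def H_0 \<rho>_supp)
  next
    case 2
    then have "n * (s - a) \<ge> 1" "n * (s - b) \<ge> 1" using assms by (auto intro!: scaled_ge_1)
    then show ?thesis by (simp add: eta_def deta_def H_1 \<rho>_supp)
  qed
  then show "eta n a b s = 0" "deta n a b s = 0" by auto
qed

lemma eta_abs_le: "\<bar>eta n a b s\<bar> \<le> 1"
  using H_nonneg[of "n * (s - a)"] H_le_1[of "n * (s - a)"] H_nonneg[of "n * (s - b)"] H_le_1[of "n * (s - b)"]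
  unfolding eta_def by linarith

lemma eventually_scaled_ge_1:
  assumes "(x::real) > 0" shows "\<forall>\<^sub>F k in sequentially. 1 \<le> real (Suc k) * x"
proof -
  obtain N where N: "1 / x < real N" using reals_Archimedean2 by blast
  show ?thesis
  proof (rule eventually_sequentiallyI[of N])
    fix k assume "N \<le> k"
    then have "1 / x \<le> real (Suc k)" using N by simp
    then show "1 \<le> real (Suc k) * x" using assms by (simp add: field_simps)
  qed
qed

lemma eta_limit:
  assumes ab: "a \<le> b" and h: "h \<in> borel_measurable lborel" "set_integrable lborel {a..b + 1} h"
  shows "(\<lambda>k. LBINT s. h s * eta (real (Suc k)) a b s) \<longlonglongrightarrow> (LBINT s:{a..b}. h s)"
proof -
  have em: "eta n a b \<in> borel_measurable borel" for n
    by (rule borel_measurable_continuous_onI[OF eta_continuous])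
  have "(\<lambda>k. LBINT s. h s * eta (real (Suc k)) a b s) \<longlonglongrightarrow> (LBINT s. indicator {a..b} s *\<^sub>R h s)"
  proof (rule integral_dominated_convergence[where w = "\<lambda>s. indicator {a..b + 1} s * \<bar>h s\<bar>"])
    show "(\<lambda>s. indicat_real {a..b} s *\<^sub>R h s) \<in> borel_measurable lborel" using h(1) by simp
    show "(\<lambda>s. h s * eta (real (Suc k)) a b s) \<in> borel_measurable lborel" for k
      using h(1) em by simp
    show "integrable lborel (\<lambda>s. indicator {a..b + 1} s * \<bar>h s\<bar>)"
      using set_integrable_abs[OF h(2)] by (simp add: set_integrable_def)
    show "AE s in lborel. norm (h s * eta (real (Suc k)) a b s) \<le> indicator {a..b + 1} s * \<bar>h s\<bar>" for k
    proof (rule AE_I2)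
      fix s show "norm (h s * eta (real (Suc k)) a b s) \<le> indicator {a..b + 1} s * \<bar>h s\<bar>"
        using eta_abs_le[of "real (Suc k)" a b s] eta_supp(1)[of "real (Suc k)" a b s] ab
          mult_left_le[of "\<bar>eta (real (Suc k)) a b s\<bar>" "\<bar>h s\<bar>"]
        by (cases "s \<in> {a..b + 1}") (auto simp: abs_mult)
    qed
    \<comment> \<open>At s = a all approximants vanish although the indicator is 1, so this point is
      removed; at s = b they are eventually 1 if a < b.\<close>
    show "AE s in lborel. (\<lambda>k. h s * eta (real (Suc k)) a b s) \<longlonglongrightarrow> indicator {a..b} s *\<^sub>R h s"
      using AE_lborel_singleton[of a]
    proof eventually_elim
      case (elim s)
      have "(\<lambda>k. eta (real (Suc k)) a b s) \<longlonglongrightarrow> indicator {a..b} s"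
      proof -
        consider "s < a" | "a < s" "s \<le> b" | "b < s" using elim by linarith
        then show ?thesis
        proof cases
          case 1
          then have "eta (real (Suc k)) a b s = 0" for k using ab by (intro eta_supp) auto
          then show ?thesis using 1 by simp
        next
          case 2
          have "\<forall>\<^sub>F k in sequentially. 1 = eta (real (Suc k)) a b s"
            using eventually_scaled_ge_1[of "s - a"] 2
            by (auto elim!: eventually_mono simp: eta_def H_1 H_0 mult_nonneg_nonpos)
          then show ?thesis using 2 by (simp add: Lim_transform_eventually[OF tendsto_const])
        next
          case 3
          have "\<forall>\<^sub>F k in sequentially. 0 = eta (real (Suc k)) a b s"
            using eventually_conj[OF eventually_scaled_ge_1[of "s - a"] eventually_scaled_ge_1[of "s - b"]] 3 ab
            by (auto elim!: eventually_mono simp: eta_def H_1)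
          then show ?thesis using 3 by (simp add: Lim_transform_eventually[OF tendsto_const])
        qed
      qed
      from tendsto_mult[OF tendsto_const[of "h s"] this] show ?case by (simp add: mult.commute)
    qed
  qed
  then show ?thesis by (simp add: set_lebesgue_integral_def)
qed

lemma \<rho>_continuous: "continuous_on S \<rho>"
  using \<rho>_C_k[of 0] by (auto intro: continuous_on_subset)

lemma \<rho>_integrable: "integrable lborel \<rho>"
  by (rule integrable_continuous_supp[OF \<rho>_continuous, of "{0..1}"]) (auto intro: \<rho>_supp)

lemma mollify_limit:
  assumes f: "continuous_on UNIV f"
  shows "(\<lambda>k. LBINT s. f s * (real (Suc k) * \<rho> (real (Suc k) * (s - a)))) \<longlonglongrightarrow> f a"
proof -
  have eq: "(LBINT s. f s * (real (Suc k) * \<rho> (real (Suc k) * (s - a)))) = (LBINT s. f (a + 1 / real (Suc k) * s) * \<rho> s)" for k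
  proof -
    define n where "n = real (Suc k)"
    have n: "n > 0" by (simp add: n_def)
    have "(LBINT s. f s * (n * \<rho> (n * (s - a)))) = \<bar>1 / n\<bar> *\<^sub>R (LBINT s. f (a + 1 / n * s) * (n * \<rho> (n * (a + 1 / n * s - a))))"
      using n by (intro lborel_integral_real_affine) simp
    also have "\<dots> = 1 / n * (LBINT s. n * (f (a + 1 / n * s) * \<rho> s))"
      using n by (simp add: algebra_simps)
    also have "\<dots> = (LBINT s. f (a + 1 / n * s) * \<rho> s)" using n by simp
    finally show ?thesis by (simp add: n_def)
  qed
  have "bounded (f ` {a..a + 1})"
    by (intro compact_imp_bounded compact_continuous_image continuous_on_subset[OF f]) auto
  then obtain B where B: "\<And>s. s \<in> {a..a + 1} \<Longrightarrow> \<bar>f s\<bar> \<le> B" by (fastforce simp: bounded_iff)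
  have cf: "continuous_on UNIV (\<lambda>s. f (a + c * s))" for c
    by (rule continuous_on_compose2[OF f]) (auto intro!: continuous_intros)
  have "(\<lambda>k. LBINT s. f (a + 1 / real (Suc k) * s) * \<rho> s) \<longlonglongrightarrow> (LBINT s. f a * \<rho> s)"
  proof (rule integral_dominated_convergence[where w = "\<lambda>s. B * \<rho> s"])
    show "(\<lambda>s. f a * \<rho> s) \<in> borel_measurable lborel"
      using \<rho>_continuous by (auto intro!: borel_measurable_continuous_onI continuous_intros)
    show "(\<lambda>s. f (a + 1 / real (Suc k) * s) * \<rho> s) \<in> borel_measurable lborel" for k
      using borel_measurable_continuous_onI[OF continuous_on_mult[OF cf[of "1 / real (Suc k)"] \<rho>_continuous]] by simp
    show "integrable lborel (\<lambda>s. B * \<rho> s)" by (intro integrable_mult_right \<rho>_integrable)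
    show "AE s in lborel. (\<lambda>k. f (a + 1 / real (Suc k) * s) * \<rho> s) \<longlonglongrightarrow> f a * \<rho> s"
    proof (rule AE_I2)
      fix s
      have "(\<lambda>k. a + 1 / real (Suc k) * s) \<longlonglongrightarrow> a + 0 * s"
        by (intro tendsto_intros LIMSEQ_Suc[OF lim_1_over_n])
      then have "(\<lambda>k. f (a + 1 / real (Suc k) * s)) \<longlonglongrightarrow> f a"
        using f by (intro continuous_on_tendsto_compose[OF f]) auto
      then show "(\<lambda>k. f (a + 1 / real (Suc k) * s) * \<rho> s) \<longlonglongrightarrow> f a * \<rho> s" by (intro tendsto_intros)
    qed
    show "AE s in lborel. norm (f (a + 1 / real (Suc k) * s) * \<rho> s) \<le> B * \<rho> s" for k
    proof (rule AE_I2)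
      fix s show "norm (f (a + 1 / real (Suc k) * s) * \<rho> s) \<le> B * \<rho> s"
      proof (cases "s \<in> {0<..<1}")
        case True
        then have "a + 1 / real (Suc k) * s \<in> {a..a + 1}" by (auto simp: field_simps)
        from B[OF this] show ?thesis using \<rho>_nonneg[of s] by (simp add: abs_mult mult_right_mono)
      qed (simp add: \<rho>_supp)
    qed
  qed
  then show ?thesis unfolding eq by (simp add: \<rho>_integral)
qed

lemma deta_limit:
  assumes f: "continuous_on UNIV f"
  shows "(\<lambda>k. LBINT s. f s * deta (real (Suc k)) a b s) \<longlonglongrightarrow> f a - f b"
proof -
  have i: "integrable lborel (\<lambda>s. f s * (real (Suc k) * \<rho> (real (Suc k) * (s - c))))" for c k
  proof (rule integrable_continuous_supp[of _ "{c..c + 1}"])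
    show "continuous_on UNIV (\<lambda>s. f s * (real (Suc k) * \<rho> (real (Suc k) * (s - c))))"
      by (intro continuous_intros f continuous_on_compose2[OF \<rho>_continuous[of UNIV]]) auto
    fix s assume s: "s \<notin> {c..c + 1}"
    have "real (Suc k) * (s - c) \<notin> {0<..<1}"
    proof (cases "s < c")
      case True
      then have "real (Suc k) * (s - c) \<le> 0" by (simp add: mult_nonneg_nonpos)
      then show ?thesis by simp
    next
      case False
      then have "1 \<le> real (Suc k) * (s - c)" using s by (intro scaled_ge_1) auto
      then show ?thesis by simp
    qed
    from \<rho>_supp[OF this] show "f s * (real (Suc k) * \<rho> (real (Suc k) * (s - c))) = 0" by (simp only: mult_zero_right)
  qed simp
  have "(LBINT s. f s * deta (real (Suc k)) a b s) =
     (LBINT s. f s * (real (Suc k) * \<rho> (real (Suc k) * (s - a)))) - (LBINT s. f s * (real (Suc k) * \<rho> (real (Suc k) * (s - b))))" for k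
    unfolding deta_def using Bochner_Integration.integral_diff[OF i[of k a] i[of k b]]
    by (simp only: right_diff_distrib[of "f s" for s])
  then show ?thesis using tendsto_diff[OF mollify_limit[OF f, of a] mollify_limit[OF f, of b]] by simp
qed

text \<open>As n grows, \<open>deta\<close> turns the left side into f a - f b and
  \<open>eta\<close> turns the right side into an integral over {a..b}. This passage from weak
  derivatives to increments is applied to the data, in time, and in both null coordinates.\<close>

lemma weak_derivative_on_line:
  assumes f: "continuous_on UNIV f" and ab: "a \<le> b"
    and g: "g \<in> borel_measurable lborel" "set_integrable lborel {a..b + 1} g"
    and weak: "\<And>n. n \<ge> 1 \<Longrightarrow> (LBINT s. f s * deta n a b s) = - (LBINT s. g s * eta n a b s)"
  shows "f b - f a = (LBINT s:{a..b}. g s)"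
proof -
  have "(\<lambda>k. LBINT s. f s * deta (real (Suc k)) a b s) \<longlonglongrightarrow> - (LBINT s:{a..b}. g s)"
    using tendsto_minus[OF eta_limit[OF ab g]] weak by simp
  from LIMSEQ_unique[OF this deta_limit[OF f]] show ?thesis by simp
qed

text \<open>The linear forms are the null coordinates for the wave equation, and t and x for the
  weak time derivative.\<close>

lemma tensor_test_function:
  fixes l1 l2 :: "'a::euclidean_space \<Rightarrow> real"
  assumes l: "bounded_linear l1" "bounded_linear l2" and n: "n \<ge> 1" "m \<ge> 1" and ab: "a \<le> b" "c \<le> d"
    and K: "compact K" "\<And>z. l1 z \<in> {a..b + 1} \<Longrightarrow> l2 z \<in> {c..d + 1} \<Longrightarrow> z \<in> K"
  shows "test_function (\<lambda>z. eta n a b (l1 z) * eta m c d (l2 z))"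
proof (rule test_functionI[OF _ K(1)])
  show "C_k k (\<lambda>z. eta n a b (l1 z) * eta m c d (l2 z))" for k
    using C_k_mult[OF C_k_compose_affine[OF l(1) eta_C_k, where c = 0] C_k_compose_affine[OF l(2) eta_C_k, where c = 0]] by simp
  fix z assume "z \<notin> K"
  then have "l1 z \<notin> {a..b + 1} \<or> l2 z \<notin> {c..d + 1}" using K(2) by blast
  then show "eta n a b (l1 z) * eta m c d (l2 z) = 0" using eta_supp(1) n ab by (metis mult_eq_0_iff)
qed

lemma eta_test_function: "n \<ge> 1 \<Longrightarrow> a \<le> b \<Longrightarrow> test_function (eta n a b)"
  by (rule test_functionI[of _ "{a..b + 1}"]) (auto simp: eta_C_k intro: eta_supp)

lemma dir_deriv_eta: "dir_deriv 1 (eta n a b) = deta n a b"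
  using dir_deriv_eqI[of "eta n a b" "\<lambda>s v. deta n a b s * v" 1] eta_deriv
  by (simp add: has_field_derivative_def)

end

section \<open>The characteristic rectangle identity\<close>

lemma set_lebesgue_integral_param_continuous:
  fixes K :: "'a::euclidean_space \<Rightarrow> real \<Rightarrow> real"
  assumes K: "continuous_on UNIV (\<lambda>z. K (fst z) (snd z))"
  shows "continuous_on UNIV (\<lambda>x. LBINT y:{c..d}. K x y)"
proof -
  have "continuous_on (UNIV \<times> cbox c d) (\<lambda>(x, y). K x y)"
    using K by (auto simp: case_prod_beta' intro: continuous_on_subset)
  then have "continuous_on UNIV (\<lambda>x. integral (cbox c d) (K x))"
    by (rule integral_continuous_on_param)
  moreover have "(LBINT y:{c..d}. K x y) = integral (cbox c d) (K x)" for x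
  proof -
    have "continuous_on {c..d} (K x)"
      using continuous_on_compose2[OF K continuous_on_Pair[OF continuous_on_const[of _ x] continuous_on_id]] by simp
    then have "set_integrable lborel {c..d} (K x)" by (intro set_integrable_continuous) auto
    from set_borel_integral_eq_integral(2)[OF this] show ?thesis by simp
  qed
  ultimately show ?thesis by simp
qed

lemma set_integral_eq_LBINT:
  fixes f :: "real \<Rightarrow> real"
  assumes "\<And>x. x \<notin> {a..b} \<Longrightarrow> f x = 0"
  shows "(LBINT x:{a..b}. f x) = (LBINT x. f x)"
  unfolding set_lebesgue_integral_def
  by (rule Bochner_Integration.integral_cong) (use assms in \<open>auto simp: indicator_def\<close>)

lemma set_integral_Fubini_continuous:
  fixes K :: "real \<Rightarrow> real \<Rightarrow> real"
  assumes K: "continuous_on UNIV (\<lambda>z. K (fst z) (snd z))"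
  shows "(LBINT u:{a..b}. LBINT v:{c..d}. K u v) = (LBINT v:{c..d}. LBINT u:{a..b}. K u v)"
proof -
  have "set_integrable lborel ({a..b} \<times> {c..d}) (\<lambda>z. K (fst z) (snd z))"
    by (intro set_integrable_continuous compact_Times continuous_on_subset[OF K]) auto
  then have i: "integrable (lborel \<Otimes>\<^sub>M lborel) (case_prod (\<lambda>u v. indicator {a..b} u * indicator {c..d} v * K u v))"
    unfolding set_integrable_def lborel_prod by (simp add: case_prod_beta' indicator_times)
  have "(LINT v|lborel. LINT u|lborel. indicator {a..b} u * indicator {c..d} v * K u v)
     = (LINT u|lborel. LINT v|lborel. indicator {a..b} u * indicator {c..d} v * K u v)"
    by (rule lborel_pair.Fubini_integral[OF i])
  moreover have "(LINT v|lborel. indicator {a..b} u * indicator {c..d} v * K u v) = indicator {a..b} u * (LINT v|lborel. indicator {c..d} v * K u v)" for u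
    by (simp add: mult.assoc)
  moreover have "(LINT u|lborel. indicator {a..b} u * indicator {c..d} v * K u v) = indicator {c..d} v * (LINT u|lborel. indicator {a..b} u * K u v)" for v
    by (simp add: mult.assoc mult.left_commute[of "indicator {a..b} _"])
  ultimately show ?thesis by (simp add: set_lebesgue_integral_def)
qed

text \<open>Two shears reduce the change of variables to Fubini's theorem and affine substitutions in one
  variable.\<close>

lemma null_coordinates_integral:
  fixes K :: "real \<Rightarrow> real \<Rightarrow> real"
  assumes K: "continuous_on UNIV (\<lambda>z. K (fst z) (snd z))"
    and supp: "\<And>u v. u \<notin> {a..b} \<or> v \<notin> {c..d} \<Longrightarrow> K u v = 0"
  shows "(LBINT z. K (fst z - snd z) (fst z + snd z)) = 1 / 2 * (LBINT u. LBINT v. K u v)"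
proof -
  have Kc: "continuous_on UNIV (\<lambda>z. K (f z) (g z))" if "continuous_on UNIV f" "continuous_on UNIV g"
    for f g :: "real \<times> real \<Rightarrow> real"
    using continuous_on_compose2[OF K continuous_on_Pair[OF that]] by simp
  have i1: "integrable lborel (\<lambda>z. K (fst z - snd z) (fst z + snd z))"
  proof (rule integrable_continuous_supp[where K = "{(a + c) / 2..(b + d) / 2} \<times> {(c - b) / 2..(d - a) / 2}"])
    show "K (fst z - snd z) (fst z + snd z) = 0" if "z \<notin> {(a + c) / 2..(b + d) / 2} \<times> {(c - b) / 2..(d - a) / 2}" for z
    proof (rule supp, rule ccontr)
      assume "\<not> (fst z - snd z \<notin> {a..b} \<or> fst z + snd z \<notin> {c..d})"
      then have "z \<in> {(a + c) / 2..(b + d) / 2} \<times> {(c - b) / 2..(d - a) / 2}"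
        by (auto simp: mem_Times_iff)
      with that show False by blast
    qed
  qed (auto intro!: Kc continuous_intros compact_Times)
  have i2: "integrable lborel (\<lambda>z. K (snd z) (2 * fst z - snd z))"
  proof (rule integrable_continuous_supp[where K = "{(a + c) / 2..(b + d) / 2} \<times> {a..b}"])
    show "K (snd z) (2 * fst z - snd z) = 0" if "z \<notin> {(a + c) / 2..(b + d) / 2} \<times> {a..b}" for z
    proof (rule supp, rule ccontr)
      assume "\<not> (snd z \<notin> {a..b} \<or> 2 * fst z - snd z \<notin> {c..d})"
      then have "z \<in> {(a + c) / 2..(b + d) / 2} \<times> {a..b}"
        by (auto simp: mem_Times_iff)
      with that show False by blast
    qed
  qed (auto intro!: Kc continuous_intros compact_Times)
  have "(LBINT z. K (fst z - snd z) (fst z + snd z)) = (LBINT t. LBINT x. K (t - x) (t + x))"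
    using lborel_pair.integral_fst'[of "\<lambda>z. K (fst z - snd z) (fst z + snd z)"] i1 by (simp add: lborel_prod)
  also have "\<dots> = (LBINT t. LBINT u. K u (2 * t - u))"
    using lborel_integral_real_affine[of "-1" "\<lambda>x. K (t - x) (t + x)" t for t] by simp
  also have "\<dots> = (LBINT u. LBINT t. K u (2 * t - u))"
    using lborel_pair.Fubini_integral[of "\<lambda>t u. K u (2 * t - u)"] i2 by (simp add: lborel_prod case_prod_beta')
  also have "\<dots> = (LBINT u. 1 / 2 * (LBINT v. K u v))"
  proof (rule Bochner_Integration.integral_cong[OF refl])
    fix u :: real
    show "(LBINT t. K u (2 * t - u)) = 1 / 2 * (LBINT v. K u v)"
      using lborel_integral_real_affine[of "1/2" "\<lambda>t. K u (2 * t - u)" "u / 2"] by simp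
  qed
  finally show ?thesis by simp
qed

context smooth_step
begin

lemma eta_measurable: "eta n a b \<in> borel_measurable borel"
  by (rule borel_measurable_continuous_onI[OF eta_continuous])

lemma initial_value_primitive:
  fixes f f0 df0 :: "real \<Rightarrow> real"
  assumes w: "has_weak_deriv 1 f0 df0" and ae: "AE x in lborel. f x = f0 x"
    and f: "continuous_on UNIV f" and cd: "c \<le> d"
  shows "f d - f c = (LBINT x:{c..d}. df0 x)"
proof (rule weak_derivative_on_line[OF f cd])
  have l: "locally_integrable f0" "locally_integrable df0" using w by (auto simp: has_weak_deriv_def)
  then show "df0 \<in> borel_measurable lborel" "set_integrable lborel {c..d + 1} df0"
    by (auto simp: locally_integrable_def)
  fix n :: real assume n: "n \<ge> 1"
  have fm: "f \<in> borel_measurable lborel" using f by (simp add: borel_measurable_continuous_onI)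
  have "(LBINT s. f s * deta n c d s) = (LBINT s. f0 s * deta n c d s)"
    using ae l(1) fm borel_measurable_continuous_onI[OF deta_continuous[of UNIV n c d]]
    by (intro integral_cong_AE) (auto simp: locally_integrable_def elim: eventually_mono)
  also have "\<dots> = - (LBINT s. df0 s * eta n c d s)"
  proof -
    have "(LBINT s. f0 s * dir_deriv 1 (eta n c d) s) = - (LBINT s. df0 s * eta n c d s)"
      using w eta_test_function[OF n cd] unfolding has_weak_deriv_def by blast
    then show ?thesis by (simp only: dir_deriv_eta)
  qed
  finally show "(LBINT s. f s * deta n c d s) = - (LBINT s. df0 s * eta n c d s)" .
qed

lemma eta_tensor_deriv:
  fixes l1 l2 :: "real \<times> real \<Rightarrow> real"
  assumes "bounded_linear l1" "bounded_linear l2"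
  shows "((\<lambda>z. eta n a b (l1 z) * eta m c d (l2 z)) has_derivative (\<lambda>v. l1 v * (deta n a b (l1 z) * eta m c d (l2 z))
     + l2 v * (eta n a b (l1 z) * deta m c d (l2 z)))) (at z)"
  by (rule tensor_has_derivative[OF eta_deriv eta_deriv assms])

lemma deta_deriv: "(deta n a b has_real_derivative dir_deriv 1 (deta n a b) s) (at s)"
  by (rule C_k_real_SucD(1)[OF deta_C_k[of "Suc 0"]])

text \<open>In null coordinates the operator is
  \<open>- 4 \<partial>\<^sub>u \<partial>\<^sub>v\<close>: the pure second derivatives of the two
  factors cancel between time and space.\<close>

lemma box_operator_eta:
  fixes n a b m c d :: real and z :: "real \<times> real"
  defines "l1 \<equiv> \<lambda>z::real \<times> real. fst z - snd z" and "l2 \<equiv> \<lambda>z::real \<times> real. fst z + snd z"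
  defines "\<psi> \<equiv> \<lambda>z. eta n a b (l1 z) * eta m c d (l2 z)"
  shows "- D_t (D_t \<psi>) z + D_x (D_x \<psi>) z = - 4 * (deta n a b (l1 z) * deta m c d (l2 z))"
proof -
  have l: "bounded_linear l1" "bounded_linear l2"
    unfolding l1_def l2_def by (auto intro!: bounded_linear_intros)
  define d1 where "d1 = dir_deriv 1 (deta n a b)"
  define d2 where "d2 = dir_deriv 1 (deta m c d)"
  define \<psi>1 where "\<psi>1 = (\<lambda>z. deta n a b (l1 z) * eta m c d (l2 z))"
  define \<psi>2 where "\<psi>2 = (\<lambda>z. eta n a b (l1 z) * deta m c d (l2 z))"
  have D: "dir_deriv v \<psi> = (\<lambda>z. l1 v * \<psi>1 z + l2 v * \<psi>2 z)" for v
    unfolding \<psi>_def \<psi>1_def \<psi>2_def by (rule dir_deriv_eqI[OF eta_tensor_deriv[OF l]])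
  have h1: "(\<psi>1 has_derivative (\<lambda>v. l1 v * (d1 (l1 z) * eta m c d (l2 z)) + l2 v * (deta n a b (l1 z) * deta m c d (l2 z)))) (at z)" for z
    unfolding \<psi>1_def d1_def by (rule tensor_has_derivative[OF deta_deriv eta_deriv l])
  have h2: "(\<psi>2 has_derivative (\<lambda>v. l1 v * (deta n a b (l1 z) * deta m c d (l2 z)) + l2 v * (eta n a b (l1 z) * d2 (l2 z)))) (at z)" for z
    unfolding \<psi>2_def d2_def by (rule tensor_has_derivative[OF eta_deriv deta_deriv l])
  have D2: "dir_deriv w (\<lambda>z. k1 * \<psi>1 z + k2 * \<psi>2 z) = (\<lambda>z.
       k1 * (l1 w * (d1 (l1 z) * eta m c d (l2 z)) + l2 w * (deta n a b (l1 z) * deta m c d (l2 z)))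
     + k2 * (l1 w * (deta n a b (l1 z) * deta m c d (l2 z)) + l2 w * (eta n a b (l1 z) * d2 (l2 z))))" for w k1 k2
    by (rule dir_deriv_eqI[OF has_derivative_add[OF has_derivative_mult_right[OF h1] has_derivative_mult_right[OF h2]]])
  show ?thesis unfolding D D2 by (simp add: l1_def l2_def)
qed

text \<open>The two factors of the test function are sharpened one after the other. With m fixed,
  the limit in n gives a weak v-derivative of \<Phi> u1 - \<Phi> u0; the limit in m then integrates
  it. The Jacobian 1 / 2 occurs on both sides, so the 1 / 4 is that of the operator alone.\<close>

lemma rectangle_identity:
  fixes \<phi> :: "real \<times> real \<Rightarrow> real"
  assumes p: "p > 1" and \<phi>: "continuous_on UNIV \<phi>" and eq: "distributional_nlw p \<phi>"
    and u: "u0 \<le> u1" and v: "v0 \<le> v1"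
  defines "\<Phi> \<equiv> \<lambda>u v. \<phi> ((u + v) / 2, (v - u) / 2)"
  shows "\<Phi> u1 v1 - \<Phi> u1 v0 - \<Phi> u0 v1 + \<Phi> u0 v0 = - 1 / 4 * (LBINT v:{v0..v1}. LBINT u:{u0..u1}. nl p (\<Phi> u v))"
proof -
  have \<Phi>c: "continuous_on UNIV (\<lambda>z. \<Phi> (fst z) (snd z))"
    unfolding \<Phi>_def by (rule continuous_on_compose2[OF \<phi>]) (auto intro!: continuous_intros)
  have Fc: "continuous_on UNIV (\<lambda>z. nl p (\<Phi> (fst z) (snd z)))"
    by (rule continuous_on_compose2[OF nl_continuous[OF p, of UNIV] \<Phi>c]) simp
  have \<Phi>uv: "\<Phi> (fst z - snd z) (fst z + snd z) = \<phi> z" for z by (simp add: \<Phi>_def)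
  have ef: "continuous_on UNIV (\<lambda>z::real\<times>real. eta n a b (fst z))" "continuous_on UNIV (\<lambda>z::real\<times>real. eta n a b (snd z))"
    "continuous_on UNIV (\<lambda>z::real\<times>real. deta n a b (fst z))" "continuous_on UNIV (\<lambda>z::real\<times>real. deta n a b (snd z))"
    for n a b
    by (rule continuous_on_compose2[OF eta_continuous[of UNIV]] continuous_on_compose2[OF deta_continuous[of UNIV]];
        auto intro!: continuous_intros)+
  have weak: "(LBINT u. (LBINT v. \<Phi> u v * deta m v0 v1 v) * deta n u0 u1 u)
      = - (LBINT u. (1 / 4 * (LBINT v. nl p (\<Phi> u v) * eta m v0 v1 v)) * eta n u0 u1 u)"
    if n: "n \<ge> 1" and m: "m \<ge> 1" for n m
  proof -
    let ?\<psi> = "\<lambda>z. eta n u0 u1 (fst z - snd z) * eta m v0 v1 (fst z + snd z)"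
    have "test_function ?\<psi>"
    proof (rule tensor_test_function[OF _ _ n m u v, where K = "{(u0 + v0) / 2..(u1 + 1 + (v1 + 1)) / 2} \<times> {(v0 - (u1 + 1)) / 2..(v1 + 1 - u0) / 2}"])
      show "bounded_linear (\<lambda>z::real\<times>real. fst z - snd z)" "bounded_linear (\<lambda>z::real\<times>real. fst z + snd z)"
        by (auto intro!: bounded_linear_intros)
    qed (auto intro!: compact_Times simp: mem_Times_iff)
    then have "(LBINT z. \<phi> z * (- 4 * (deta n u0 u1 (fst z - snd z) * deta m v0 v1 (fst z + snd z))))
       = (LBINT z. nl p (\<phi> z) * ?\<psi> z)"
      using eq unfolding distributional_nlw_def box_operator_eta[symmetric] nl_def by blast
    moreover have "(LBINT z. \<phi> z * (- 4 * (deta n u0 u1 (fst z - snd z) * deta m v0 v1 (fst z + snd z))))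
      = 1 / 2 * (LBINT u. LBINT v. \<Phi> u v * (- 4 * (deta n u0 u1 u * deta m v0 v1 v)))"
      unfolding \<Phi>uv[symmetric]
    proof (rule null_coordinates_integral)
      show "continuous_on UNIV (\<lambda>z. \<Phi> (fst z) (snd z) * (- 4 * (deta n u0 u1 (fst z) * deta m v0 v1 (snd z))))"
        by (intro continuous_on_mult \<Phi>c continuous_on_const ef)
      show "\<Phi> u v * (- 4 * (deta n u0 u1 u * deta m v0 v1 v)) = 0" if "u \<notin> {u0..u1 + 1} \<or> v \<notin> {v0..v1 + 1}" for u v
        using that eta_supp(2)[OF n \<open>u0 \<le> u1\<close>, of u] eta_supp(2)[OF m \<open>v0 \<le> v1\<close>, of v] by auto
    qed
    moreover have "(LBINT z. nl p (\<phi> z) * ?\<psi> z)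
      = 1 / 2 * (LBINT u. LBINT v. nl p (\<Phi> u v) * (eta n u0 u1 u * eta m v0 v1 v))"
      unfolding \<Phi>uv[symmetric]
    proof (rule null_coordinates_integral)
      show "continuous_on UNIV (\<lambda>z. nl p (\<Phi> (fst z) (snd z)) * (eta n u0 u1 (fst z) * eta m v0 v1 (snd z)))"
        by (intro continuous_on_mult Fc ef)
      show "nl p (\<Phi> u v) * (eta n u0 u1 u * eta m v0 v1 v) = 0" if "u \<notin> {u0..u1 + 1} \<or> v \<notin> {v0..v1 + 1}" for u v
        using that eta_supp(1)[OF n \<open>u0 \<le> u1\<close>, of u] eta_supp(1)[OF m \<open>v0 \<le> v1\<close>, of v] by auto
    qed
    ultimately have "(LBINT u. LBINT v. - 4 * deta n u0 u1 u * (\<Phi> u v * deta m v0 v1 v))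
      = (LBINT u. LBINT v. eta n u0 u1 u * (nl p (\<Phi> u v) * eta m v0 v1 v))"
      by (simp add: mult.commute mult.left_commute)
    moreover have "(LBINT v. - 4 * deta n u0 u1 u * (\<Phi> u v * deta m v0 v1 v))
        = - 4 * ((LBINT v. \<Phi> u v * deta m v0 v1 v) * deta n u0 u1 u)"
      "(LBINT v. eta n u0 u1 u * (nl p (\<Phi> u v) * eta m v0 v1 v))
        = (LBINT v. nl p (\<Phi> u v) * eta m v0 v1 v) * eta n u0 u1 u" for u
      unfolding Bochner_Integration.integral_mult_right_zero by simp_all
    ultimately have "- 4 * (LBINT u. (LBINT v. \<Phi> u v * deta m v0 v1 v) * deta n u0 u1 u)
      = (LBINT u. (LBINT v. nl p (\<Phi> u v) * eta m v0 v1 v) * eta n u0 u1 u)"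
      by (simp only: Bochner_Integration.integral_mult_right_zero)
    moreover have "(LBINT u. (1 / 4 * (LBINT v. nl p (\<Phi> u v) * eta m v0 v1 v)) * eta n u0 u1 u)
      = 1 / 4 * (LBINT u. (LBINT v. nl p (\<Phi> u v) * eta m v0 v1 v) * eta n u0 u1 u)"
      by (simp only: mult.assoc Bochner_Integration.integral_mult_right_zero)
    ultimately show ?thesis by linarith
  qed
  have c1: "continuous_on UNIV (\<lambda>u. LBINT v. \<Phi> u v * deta m v0 v1 v)" if m: "m \<ge> 1" for m
  proof -
    have "continuous_on UNIV (\<lambda>u. LBINT v:{v0..v1 + 1}. \<Phi> u v * deta m v0 v1 v)"
      by (rule set_lebesgue_integral_param_continuous) (intro continuous_on_mult \<Phi>c ef)
    then show ?thesis using eta_supp(2)[OF m v] by (subst (asm) set_integral_eq_LBINT) auto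
  qed
  have c2: "continuous_on UNIV (\<lambda>u. LBINT v. nl p (\<Phi> u v) * eta m v0 v1 v)" if m: "m \<ge> 1" for m
  proof -
    have "continuous_on UNIV (\<lambda>u. LBINT v:{v0..v1 + 1}. nl p (\<Phi> u v) * eta m v0 v1 v)"
      by (rule set_lebesgue_integral_param_continuous) (intro continuous_on_mult Fc ef)
    then show ?thesis using eta_supp(1)[OF m v] by (subst (asm) set_integral_eq_LBINT) auto
  qed
  define g where "g v = - 1 / 4 * (LBINT u:{u0..u1}. nl p (\<Phi> u v))" for v
  have gc: "continuous_on UNIV g"
  proof -
    have "continuous_on UNIV (\<lambda>z. nl p (\<Phi> (snd z) (fst z)))"
      using continuous_on_compose2[OF Fc continuous_on_Pair[OF continuous_on_snd[OF continuous_on_id] continuous_on_fst[OF continuous_on_id]]] by simp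
    from set_lebesgue_integral_param_continuous[of "\<lambda>v u. nl p (\<Phi> u v)", OF this]
    show ?thesis unfolding g_def by (intro continuous_intros)
  qed
  have line: "continuous_on UNIV (\<Phi> u)" for u
    using continuous_on_compose2[OF \<Phi>c continuous_on_Pair[OF continuous_on_const[of _ u] continuous_on_id]] by simp
  have i1: "integrable lborel (\<lambda>v. \<Phi> u v * deta m v0 v1 v)" if m: "m \<ge> 1" for u m
    by (rule integrable_continuous_supp[of _ "{v0..v1 + 1}"])
      (use eta_supp(2)[OF m v] in \<open>auto intro!: continuous_on_mult line deta_continuous\<close>)
  have "(\<Phi> u1 v1 - \<Phi> u0 v1) - (\<Phi> u1 v0 - \<Phi> u0 v0) = (LBINT v:{v0..v1}. g v)"
  proof (rule weak_derivative_on_line[OF _ v])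
    show "continuous_on UNIV (\<lambda>v. \<Phi> u1 v - \<Phi> u0 v)" by (intro continuous_intros line)
    show "g \<in> borel_measurable lborel" using borel_measurable_continuous_onI[OF gc] by simp
    show "set_integrable lborel {v0..v1 + 1} g"
      by (intro set_integrable_continuous continuous_on_subset[OF gc]) auto
    fix m :: real assume m: "m \<ge> 1"
    have "(LBINT v. \<Phi> u1 v * deta m v0 v1 v) - (LBINT v. \<Phi> u0 v * deta m v0 v1 v)
       = (LBINT u:{u0..u1}. 1 / 4 * (LBINT v. nl p (\<Phi> u v) * eta m v0 v1 v))"
    proof (rule weak_derivative_on_line[OF c1[OF m] u])
      have c3: "continuous_on UNIV (\<lambda>u. 1 / 4 * (LBINT v. nl p (\<Phi> u v) * eta m v0 v1 v))"
        by (intro continuous_on_mult continuous_on_const c2 m)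
      then show "(\<lambda>u. 1 / 4 * (LBINT v. nl p (\<Phi> u v) * eta m v0 v1 v)) \<in> borel_measurable lborel"
        using borel_measurable_continuous_onI[OF c3] by simp
      show "set_integrable lborel {u0..u1 + 1} (\<lambda>u. 1 / 4 * (LBINT v. nl p (\<Phi> u v) * eta m v0 v1 v))"
        by (intro set_integrable_continuous continuous_on_subset[OF c3]) auto
    qed (rule weak[OF _ m])
    also have "\<dots> = 1 / 4 * (LBINT u:{u0..u1}. LBINT v:{v0..v1 + 1}. nl p (\<Phi> u v) * eta m v0 v1 v)"
      using eta_supp(1)[OF m v] by (subst set_integral_eq_LBINT[of v0 "v1 + 1"]) auto
    also have "\<dots> = 1 / 4 * (LBINT v:{v0..v1 + 1}. LBINT u:{u0..u1}. nl p (\<Phi> u v) * eta m v0 v1 v)"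
      by (subst set_integral_Fubini_continuous) (auto intro!: continuous_on_mult Fc ef)
    also have "\<dots> = 1 / 4 * (LBINT v. LBINT u:{u0..u1}. nl p (\<Phi> u v) * eta m v0 v1 v)"
      using eta_supp(1)[OF m v] by (subst set_integral_eq_LBINT[of v0 "v1 + 1"]) auto
    also have "\<dots> = - (LBINT v. g v * eta m v0 v1 v)"
      unfolding g_def by (simp add: mult.assoc set_integral_mult_left)
    finally show "(LBINT v. (\<Phi> u1 v - \<Phi> u0 v) * deta m v0 v1 v) = - (LBINT v. g v * eta m v0 v1 v)"
      unfolding left_diff_distrib by (subst Bochner_Integration.integral_diff[OF i1[OF m] i1[OF m]])
  qed
  also have "\<dots> = - 1 / 4 * (LBINT v:{v0..v1}. LBINT u:{u0..u1}. nl p (\<Phi> u v))"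
    unfolding g_def by (rule set_integral_mult_right)
  finally show ?thesis by linarith
qed

end

section \<open>Initial data of the distributional solution\<close>

text \<open>Young's inequality in the role of Cauchy-Schwarz: a \<delta> tuned to the tolerance
  makes the second summand small, and L^2 convergence then takes care of the first.\<close>

lemma abs_integral_mult_le:
  fixes f g :: "'a \<Rightarrow> real"
  assumes f: "f \<in> borel_measurable M" "integrable M (\<lambda>x. (f x)\<^sup>2)"
    and g: "g \<in> borel_measurable M" "integrable M (\<lambda>x. (g x)\<^sup>2)" and \<delta>: "\<delta> > 0"
  shows "integrable M (\<lambda>x. f x * g x)"
    and "\<bar>LINT x|M. f x * g x\<bar> \<le> (LINT x|M. (f x)\<^sup>2) / \<delta> + \<delta> * (LINT x|M. (g x)\<^sup>2)"
proof -
  have pt: "\<bar>f x * g x\<bar> \<le> (f x)\<^sup>2 / \<delta> + \<delta> * (g x)\<^sup>2" for x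
  proof -
    have "2 * \<bar>f x\<bar> * (\<delta> * \<bar>g x\<bar>) \<le> (f x)\<^sup>2 + \<delta>\<^sup>2 * (g x)\<^sup>2"
      using sum_squares_bound[of "\<bar>f x\<bar>" "\<delta> * \<bar>g x\<bar>"] by (simp add: power_mult_distrib)
    then have "2 * \<bar>f x * g x\<bar> \<le> (f x)\<^sup>2 / \<delta> + \<delta> * (g x)\<^sup>2"
      using \<delta> by (simp add: abs_mult field_simps power2_eq_square)
    moreover have "0 \<le> \<bar>f x * g x\<bar>" by simp
    ultimately show ?thesis by linarith
  qed
  have ib: "integrable M (\<lambda>x. (f x)\<^sup>2 / \<delta> + \<delta> * (g x)\<^sup>2)" using f(2) g(2) by simp
  show i: "integrable M (\<lambda>x. f x * g x)"
  proof (rule Bochner_Integration.integrable_bound[OF ib])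
    show "(\<lambda>x. f x * g x) \<in> borel_measurable M" using f(1) g(1) by simp
    show "AE x in M. norm (f x * g x) \<le> norm ((f x)\<^sup>2 / \<delta> + \<delta> * (g x)\<^sup>2)"
      unfolding real_norm_def by (intro AE_I2 order_trans[OF pt abs_ge_self])
  qed
  have "\<bar>LINT x|M. f x * g x\<bar> \<le> (LINT x|M. \<bar>f x * g x\<bar>)"
    using integral_norm_bound[of M "\<lambda>x. f x * g x"] by simp
  also have "\<dots> \<le> (LINT x|M. (f x)\<^sup>2 / \<delta> + \<delta> * (g x)\<^sup>2)"
    using i ib pt by (intro integral_mono) auto
  also have "\<dots> = (LINT x|M. (f x)\<^sup>2) / \<delta> + \<delta> * (LINT x|M. (g x)\<^sup>2)" using f(2) g(2) by simp
  finally show "\<bar>LINT x|M. f x * g x\<bar> \<le> (LINT x|M. (f x)\<^sup>2) / \<delta> + \<delta> * (LINT x|M. (g x)\<^sup>2)" .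
qed

lemma in_L2_iff: "in_Lq 2 f \<longleftrightarrow> f \<in> borel_measurable lborel \<and> integrable lborel (\<lambda>x. (f x)\<^sup>2)"
  by (simp add: in_Lq_def)

lemma Lq_norm_2_square: "(Lq_norm 2 f)\<^sup>2 = (LBINT x. (f x)\<^sup>2)"
  by (simp add: Lq_norm_def powr_half_sqrt)

lemma C_t_L2_pairing_tendsto:
  assumes u: "C_t_Lq 2 u" and \<eta>: "\<eta> \<in> borel_measurable lborel" "integrable lborel (\<lambda>x. (\<eta> x)\<^sup>2)"
  shows "((\<lambda>s. LBINT x. u (s, x) * \<eta> x) \<longlongrightarrow> (LBINT x. u (t, x) * \<eta> x)) (at t)"
proof -
  have um: "(\<lambda>x. u (s, x)) \<in> borel_measurable lborel" and ui: "integrable lborel (\<lambda>x. (u (s, x))\<^sup>2)" for s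
    using u by (auto simp: C_t_Lq_def in_L2_iff)
  have di: "integrable lborel (\<lambda>x. (u (s, x) - u (t, x))\<^sup>2)" for s
  proof (rule Bochner_Integration.integrable_bound)
    show "integrable lborel (\<lambda>x. 2 * (u (s, x))\<^sup>2 + 2 * (u (t, x))\<^sup>2)" using ui by simp
    show "(\<lambda>x. (u (s, x) - u (t, x))\<^sup>2) \<in> borel_measurable lborel" using um by simp
    show "AE x in lborel. norm ((u (s, x) - u (t, x))\<^sup>2) \<le> norm (2 * (u (s, x))\<^sup>2 + 2 * (u (t, x))\<^sup>2)"
    proof (rule AE_I2)
      fix x
      have "(u (s, x) - u (t, x))\<^sup>2 \<le> 2 * (u (s, x))\<^sup>2 + 2 * (u (t, x))\<^sup>2"
        using zero_le_power2[of "u (s, x) + u (t, x)"] by (simp add: power2_sum power2_diff)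
      then show "norm ((u (s, x) - u (t, x))\<^sup>2) \<le> norm (2 * (u (s, x))\<^sup>2 + 2 * (u (t, x))\<^sup>2)" by simp
    qed
  qed
  define E where "E = (LBINT x. (\<eta> x)\<^sup>2)"
  have E: "0 \<le> E" unfolding E_def by simp
  show ?thesis unfolding tendsto_iff
  proof (intro allI impI)
    fix e :: real assume e: "e > 0"
    define \<delta> where "\<delta> = e / (2 * (E + 1))"
    have \<delta>: "\<delta> > 0" using e E by (simp add: \<delta>_def)
    have \<delta>E: "\<delta> * E < e / 2" unfolding \<delta>_def using e E by (simp add: field_simps)
    have "((\<lambda>s. (Lq_norm 2 (\<lambda>x. u (s, x) - u (t, x)))\<^sup>2) \<longlongrightarrow> 0\<^sup>2) (at t)"
      using u by (intro tendsto_power) (auto simp: C_t_Lq_def)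
    then have "\<forall>\<^sub>F s in at t. (LBINT x. (u (s, x) - u (t, x))\<^sup>2) < e / 2 * \<delta>"
      using \<delta> e by (intro order_tendstoD(2)) (auto simp: Lq_norm_2_square)
    then show "\<forall>\<^sub>F s in at t. dist (LBINT x. u (s, x) * \<eta> x) (LBINT x. u (t, x) * \<eta> x) < e"
    proof eventually_elim
      case (elim s)
      have "(LBINT x. u (s, x) * \<eta> x) - (LBINT x. u (t, x) * \<eta> x) = (LBINT x. (u (s, x) - u (t, x)) * \<eta> x)"
        unfolding left_diff_distrib
        by (rule Bochner_Integration.integral_diff[symmetric]) (rule abs_integral_mult_le(1)[OF um ui \<eta> \<delta>])+
      then have "dist (LBINT x. u (s, x) * \<eta> x) (LBINT x. u (t, x) * \<eta> x) = \<bar>LBINT x. (u (s, x) - u (t, x)) * \<eta> x\<bar>"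
        by (simp add: dist_real_def)
      also have "\<dots> \<le> (LBINT x. (u (s, x) - u (t, x))\<^sup>2) / \<delta> + \<delta> * E"
        unfolding E_def using um by (intro abs_integral_mult_le(2)[OF _ di \<eta> \<delta>]) simp
      also have "\<dots> < e / 2 + e / 2"
        using elim \<delta> \<delta>E by (intro add_strict_mono) (simp_all add: field_simps)
      finally show ?case by simp
    qed
  qed
qed

context smooth_step
begin

text \<open>Pairing with \<open>eta\<close> in x leaves a problem in t: the pairing m of \<phi> is a
  primitive of the pairing N of \<phi>t, and N is continuous at 0 because \<phi>t is continuous in
  time with values in L^2. So the difference quotients of m tend to N 0, which is the pairing with
  \<phi>1.\<close>

lemma initial_velocity_limit:
  fixes \<phi> \<phi>t :: "real \<times> real \<Rightarrow> real"
  assumes \<phi>: "continuous_on UNIV \<phi>" and w: "has_weak_deriv (1, 0) \<phi> \<phi>t" and L2: "C_t_Lq 2 \<phi>t"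
    and ae: "AE x in lborel. \<phi>t (0, x) = \<phi>1 x" and \<phi>1: "\<phi>1 \<in> borel_measurable lborel"
    and n: "n \<ge> 1" and cd: "c \<le> d"
  shows "(\<lambda>k. (LBINT x. (\<phi> (1 / real (Suc k), x) - \<phi> (0, x)) * eta n c d x) / (1 / real (Suc k)))
     \<longlonglongrightarrow> (LBINT x. \<phi>1 x * eta n c d x)"
proof -
  let ?\<eta> = "eta n c d"
  have lt: "locally_integrable \<phi>t" using w by (simp add: has_weak_deriv_def)
  then have tm: "\<phi>t \<in> borel_measurable borel" by (simp add: locally_integrable_def)
  have ec: "continuous_on UNIV (\<lambda>z::real\<times>real. ?\<eta> (snd z))" "continuous_on UNIV (\<lambda>z::real\<times>real. deta m a b (fst z))"
    "continuous_on UNIV (\<lambda>z::real\<times>real. eta m a b (fst z))" for m a b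
    by (rule continuous_on_compose2[OF eta_continuous[of UNIV]] continuous_on_compose2[OF deta_continuous[of UNIV]];
        auto intro!: continuous_intros)+
  define m where "m t = (LBINT x. \<phi> (t, x) * ?\<eta> x)" for t
  define N where "N t = (LBINT x. \<phi>t (t, x) * ?\<eta> x)" for t
  have mc: "continuous_on UNIV m"
  proof -
    have "continuous_on UNIV (\<lambda>t. LBINT x:{c..d + 1}. \<phi> (t, x) * ?\<eta> x)"
      by (rule set_lebesgue_integral_param_continuous) (auto intro!: continuous_on_mult \<phi> ec(1))
    then show ?thesis unfolding m_def[abs_def] using eta_supp(1)[OF n cd] by (subst (asm) set_integral_eq_LBINT) auto
  qed
  have box: "set_integrable lborel ({a..b} \<times> {c..d + 1}) \<phi>t" for a b
    using lt by (auto simp: locally_integrable_def intro!: compact_Times)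
  have boxe: "set_integrable lborel ({a..b} \<times> {c..d + 1}) (\<lambda>z. \<phi>t z * ?\<eta> (snd z))" for a b
    using set_integrable_mult_continuous[OF box _ continuous_on_subset[OF ec(1)], of a b]
    by (simp add: compact_Times mult.commute)
  have Nm: "N \<in> borel_measurable lborel"
  proof -
    have "(\<lambda>z. \<phi>t z * ?\<eta> (snd z)) \<in> borel_measurable borel"
      using tm borel_measurable_continuous_onI[OF ec(1)] by simp
    then have "(\<lambda>(t, x). \<phi>t (t, x) * ?\<eta> x) \<in> borel_measurable (lborel \<Otimes>\<^sub>M lborel)"
      by (simp add: case_prod_beta' lborel_prod)
    then show ?thesis unfolding N_def[abs_def] by (rule lborel.borel_measurable_lebesgue_integral)
  qed
  have Ni: "set_integrable lborel {a..b} N" for a b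
  proof -
    have i: "integrable (lborel \<Otimes>\<^sub>M lborel) (\<lambda>z. indicator ({a..b} \<times> {c..d + 1}) z *\<^sub>R (\<phi>t z * ?\<eta> (snd z)))"
      using boxe[of a b] by (simp add: set_integrable_def lborel_prod)
    have eq: "(LBINT x. indicator ({a..b} \<times> {c..d + 1}) (t, x) *\<^sub>R (\<phi>t (t, x) * ?\<eta> (snd (t, x)))) = indicator {a..b} t *\<^sub>R N t" for t
    proof -
      have "(LBINT x. indicator ({a..b} \<times> {c..d + 1}) (t, x) *\<^sub>R (\<phi>t (t, x) * ?\<eta> (snd (t, x))))
        = (LBINT x. indicator {a..b} t * (\<phi>t (t, x) * ?\<eta> x))"
        by (rule Bochner_Integration.integral_cong) (use eta_supp(1)[OF n cd] in \<open>auto simp: indicator_def\<close>)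
      then show ?thesis by (simp add: N_def)
    qed
    show ?thesis using lborel_pair.integrable_fst'[OF i] unfolding eq set_integrable_def .
  qed
  have prim: "m b - m 0 = (LBINT t:{0..b}. N t)" if b: "0 \<le> b" for b
  proof (rule weak_derivative_on_line[OF mc b Nm Ni])
    fix k :: real assume k: "k \<ge> 1"
    let ?\<psi> = "\<lambda>z::real\<times>real. eta k 0 b (fst z) * ?\<eta> (snd z)"
    have D: "dir_deriv (1, 0) ?\<psi> = (\<lambda>z. deta k 0 b (fst z) * ?\<eta> (snd z))"
      using dir_deriv_eqI[OF eta_tensor_deriv[OF bounded_linear_fst bounded_linear_snd], of "(1,0)"] by simp
    have "test_function ?\<psi>"
      by (rule tensor_test_function[OF bounded_linear_fst bounded_linear_snd k n b cd, where K = "{0..b + 1} \<times> {c..d + 1}"])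
        (auto intro!: compact_Times simp: mem_Times_iff)
    then have "(LBINT z. \<phi> z * dir_deriv (1, 0) ?\<psi> z) = - (LBINT z. \<phi>t z * ?\<psi> z)"
      using w unfolding has_weak_deriv_def by blast
    then have e: "(LBINT z. \<phi> z * (deta k 0 b (fst z) * ?\<eta> (snd z))) = - (LBINT z. \<phi>t z * ?\<psi> z)"
      by (simp only: D)
    have supp: "eta k 0 b (fst z) * ?\<eta> (snd z) = 0" "deta k 0 b (fst z) * ?\<eta> (snd z) = 0"
      if "z \<notin> {0..b + 1} \<times> {c..d + 1}" for z
      using that eta_supp[OF k b, of "fst z"] eta_supp[OF n cd, of "snd z"] by (auto simp: mem_Times_iff)
    have i1: "integrable (lborel \<Otimes>\<^sub>M lborel) (\<lambda>z. \<phi> z * (deta k 0 b (fst z) * ?\<eta> (snd z)))"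
      unfolding lborel_prod
      by (rule integrable_continuous_supp[where K = "{0..b + 1} \<times> {c..d + 1}"])
        (auto intro!: continuous_on_mult \<phi> ec compact_Times simp: supp simp del: mult_eq_0_iff)
    have i2: "integrable (lborel \<Otimes>\<^sub>M lborel) (\<lambda>z. \<phi>t z * ?\<psi> z)"
      unfolding lborel_prod
      by (rule integrable_mult_continuous_supp[OF box[of 0 "b + 1"]])
        (auto intro!: continuous_on_mult ec compact_Times simp: supp simp del: mult_eq_0_iff)
    have "(LBINT z. \<phi> z * (deta k 0 b (fst z) * ?\<eta> (snd z))) = (LBINT t. LBINT x. deta k 0 b t * (\<phi> (t, x) * ?\<eta> x))"
      using lborel_pair.integral_fst'[OF i1] by (simp add: lborel_prod mult.left_commute)
    also have "\<dots> = (LBINT t. m t * deta k 0 b t)" by (simp add: m_def mult.commute)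
    finally have e1: "(LBINT z. \<phi> z * (deta k 0 b (fst z) * ?\<eta> (snd z))) = (LBINT t. m t * deta k 0 b t)" .
    have "(LBINT z. \<phi>t z * ?\<psi> z) = (LBINT t. LBINT x. eta k 0 b t * (\<phi>t (t, x) * ?\<eta> x))"
      using lborel_pair.integral_fst'[OF i2] by (simp add: lborel_prod mult.left_commute)
    also have "\<dots> = (LBINT t. N t * eta k 0 b t)" by (simp add: N_def mult.commute)
    finally show "(LBINT s. m s * deta k 0 b s) = - (LBINT s. N s * eta k 0 b s)"
      using e e1 by simp
  qed
  have e2: "integrable lborel (\<lambda>x. (?\<eta> x)\<^sup>2)"
    by (rule integrable_continuous_supp[of _ "{c..d + 1}"])
      (use eta_supp(1)[OF n cd] in \<open>auto intro!: continuous_intros eta_continuous\<close>)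
  have N0: "(N \<longlongrightarrow> N 0) (at 0)"
    unfolding N_def[abs_def] using eta_measurable by (intro C_t_L2_pairing_tendsto[OF L2 _ e2]) simp
  have "(\<lambda>x. \<phi>t (0, x)) \<in> borel_measurable borel" using L2 by (auto simp: C_t_Lq_def in_Lq_def)
  then have N0eq: "N 0 = (LBINT x. \<phi>1 x * ?\<eta> x)"
    unfolding N_def using ae \<phi>1 eta_measurable
    by (intro integral_cong_AE) (auto elim: eventually_mono)
  have mi: "integrable lborel (\<lambda>x. \<phi> (t, x) * ?\<eta> x)" for t
  proof (rule integrable_continuous_supp[of _ "{c..d + 1}"])
    have "continuous_on UNIV (\<lambda>x. \<phi> (t, x))"
      by (rule continuous_on_compose2[OF \<phi>]) (auto intro!: continuous_intros)
    then show "continuous_on UNIV (\<lambda>x. \<phi> (t, x) * ?\<eta> x)" by (intro continuous_on_mult eta_continuous)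
  qed (use eta_supp(1)[OF n cd] in auto)
  have diff: "(LBINT x. (\<phi> (t, x) - \<phi> (0, x)) * ?\<eta> x) = m t - m 0" for t
    unfolding m_def left_diff_distrib by (rule Bochner_Integration.integral_diff[OF mi mi])
  have "(\<lambda>k. (m (1 / real (Suc k)) - m 0) / (1 / real (Suc k))) \<longlonglongrightarrow> N 0"
    unfolding tendsto_iff
  proof (intro allI impI)
    fix e :: real assume e: "e > 0"
    have "\<forall>\<^sub>F s in at 0. dist (N s) (N 0) < e / 2" using e by (intro tendstoD[OF N0]) simp
    then obtain \<delta> where \<delta>: "\<delta> > 0" "\<And>s. s \<noteq> 0 \<Longrightarrow> \<bar>s\<bar> < \<delta> \<Longrightarrow> \<bar>N s - N 0\<bar> < e / 2"
      unfolding eventually_at by (auto simp: dist_real_def)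
    have "\<forall>\<^sub>F k in sequentially. 1 / real (Suc k) < \<delta>"
      using order_tendstoD(2)[OF LIMSEQ_Suc[OF lim_1_over_n] \<delta>(1)] .
    then show "\<forall>\<^sub>F k in sequentially. dist ((m (1 / real (Suc k)) - m 0) / (1 / real (Suc k))) (N 0) < e"
    proof eventually_elim
      case (elim k)
      define t where "t = 1 / real (Suc k)"
      have t: "t > 0" "t < \<delta>" using elim by (auto simp: t_def)
      have i0: "set_integrable lborel {0..t} (\<lambda>_. N 0)" by (intro set_integrable_continuous) auto
      have c0: "(LBINT s:{0..t}. C) = C * t" for C using t by (simp add: set_lebesgue_integral_def)
      have id: "set_integrable lborel {0..t} (\<lambda>s. N s - N 0)" by (rule set_integral_diff(1)[OF Ni i0])
      have "m t - m 0 - N 0 * t = (LBINT s:{0..t}. N s - N 0)"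
        using prim[of t] t c0 by (simp add: set_integral_diff(2)[OF Ni i0])
      also have "\<bar>\<dots>\<bar> \<le> (LBINT s:{0..t}. \<bar>N s - N 0\<bar>)"
        using set_integral_norm_bound[OF id] by simp
      also have "\<dots> \<le> (LBINT s:{0..t}. e / 2)"
      proof (rule set_integral_mono)
        show "\<bar>N s - N 0\<bar> \<le> e / 2" if "s \<in> {0..t}" for s
          using that t \<delta>(2)[of s] e by (cases "s = 0") auto
      qed (auto intro!: set_integrable_abs[OF id] set_integrable_continuous)
      also have "\<dots> = e / 2 * t" by (rule c0)
      finally have "\<bar>m t - m 0 - N 0 * t\<bar> \<le> e / 2 * t" .
      moreover have "(m t - m 0) / t - N 0 = (m t - m 0 - N 0 * t) / t" using t by (simp add: field_simps)
      ultimately have "\<bar>(m t - m 0) / t - N 0\<bar> \<le> e / 2" using t by (simp add: field_simps)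
      then show ?case using e by (simp add: t_def dist_real_def)
    qed
  qed
  then show ?thesis unfolding diff N0eq .
qed

text \<open>The profile \<kappa> is merely continuous, so a translation of the variable moves the
  difference quotient onto the smooth \<open>eta\<close>, where dominated convergence applies. The
  sign e is the direction of translation.\<close>

lemma translation_quotient_limit:
  assumes \<kappa>: "continuous_on UNIV \<kappa>" and n: "n \<ge> 1" and cd: "c \<le> d" and e: "e = 1 \<or> e = - 1"
  shows "(\<lambda>k. (LBINT x. (\<kappa> (x + e / real (Suc k)) - \<kappa> x) * eta n c d x) / (1 / real (Suc k)))
     \<longlonglongrightarrow> - e * (LBINT x. \<kappa> x * deta n c d x)"
proof -
  let ?\<eta> = "eta n c d"
  have kc: "continuous_on UNIV (\<lambda>x. \<kappa> (x + h))" for h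
    by (rule continuous_on_compose2[OF \<kappa>]) (auto intro!: continuous_intros)
  have ec: "continuous_on UNIV (\<lambda>x. ?\<eta> (x + h))" for h
    by (rule continuous_on_compose2[OF eta_continuous[of UNIV]]) (auto intro!: continuous_intros)
  have i: "integrable lborel (\<lambda>x. \<kappa> (x + h) * ?\<eta> x)" for h
    by (rule integrable_continuous_supp[of _ "{c..d + 1}"])
      (use eta_supp(1)[OF n cd] in \<open>auto intro!: continuous_on_mult kc eta_continuous\<close>)
  have i': "integrable lborel (\<lambda>x. \<kappa> x * ?\<eta> (x + h))" for h
  proof (rule integrable_continuous_supp[of _ "{c - h..d + 1 - h}"])
    show "continuous_on UNIV (\<lambda>x. \<kappa> x * ?\<eta> (x + h))" by (intro continuous_on_mult \<kappa> ec)
    show "\<kappa> x * ?\<eta> (x + h) = 0" if "x \<notin> {c - h..d + 1 - h}" for x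
      using that eta_supp(1)[OF n cd, of "x + h"] by auto
  qed simp
  have sh: "(LBINT x. (\<kappa> (x + h) - \<kappa> x) * ?\<eta> x) = (LBINT x. \<kappa> x * (?\<eta> (x - h) - ?\<eta> x))" for h
  proof -
    have "(LBINT x. \<kappa> (x + h) * ?\<eta> x) = (LBINT x. \<kappa> x * ?\<eta> (x - h))"
      using lborel_integral_real_affine[of 1 "\<lambda>x. \<kappa> x * ?\<eta> (x - h)" h] by (simp add: add.commute)
    moreover have "(LBINT x. (\<kappa> (x + h) - \<kappa> x) * ?\<eta> x) = (LBINT x. \<kappa> (x + h) * ?\<eta> x) - (LBINT x. \<kappa> x * ?\<eta> x)"
      unfolding left_diff_distrib using Bochner_Integration.integral_diff[OF i[of h] i[of 0]] by simp
    moreover have "(LBINT x. \<kappa> x * (?\<eta> (x - h) - ?\<eta> x)) = (LBINT x. \<kappa> x * ?\<eta> (x - h)) - (LBINT x. \<kappa> x * ?\<eta> x)"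
      unfolding right_diff_distrib using Bochner_Integration.integral_diff[OF i'[of "- h"] i'[of 0]] by simp
    ultimately show ?thesis by simp
  qed
  have "bounded (deta n c d ` {c - 1..d + 2})" "bounded (\<kappa> ` {c - 1..d + 2})"
    by (intro compact_imp_bounded compact_continuous_image deta_continuous continuous_on_subset[OF \<kappa>]; auto)+
  then obtain B1 B2 where B1: "\<And>x. x \<in> {c - 1..d + 2} \<Longrightarrow> \<bar>deta n c d x\<bar> \<le> B1"
    and B2: "\<And>x. x \<in> {c - 1..d + 2} \<Longrightarrow> \<bar>\<kappa> x\<bar> \<le> B2"
    by (fastforce simp: bounded_iff)
  have B1': "\<bar>deta n c d x\<bar> \<le> \<bar>B1\<bar>" for x
  proof (cases "x \<in> {c - 1..d + 2}")
    case False
    then have "deta n c d x = 0" by (intro eta_supp(2)[OF n cd]) auto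
    then show ?thesis by simp
  qed (use B1 in force)
  have Lip: "\<bar>?\<eta> (x - h) - ?\<eta> x\<bar> \<le> \<bar>B1\<bar> * \<bar>h\<bar>" for x h
  proof -
    have "norm (?\<eta> (x - h) - ?\<eta> x) \<le> \<bar>B1\<bar> * norm (x - h - x)"
    proof (rule field_differentiable_bound[OF convex_UNIV])
      show "(?\<eta> has_field_derivative deta n c d z) (at z within UNIV)" for z using eta_deriv[of n c d z] by simp
      show "norm (deta n c d z) \<le> \<bar>B1\<bar>" for z using B1'[of z] by simp
    qed auto
    then show ?thesis by simp
  qed
  have "(\<lambda>k. LBINT x. \<kappa> x * ((?\<eta> (x - e / real (Suc k)) - ?\<eta> x) / (1 / real (Suc k)))) \<longlonglongrightarrow> (LBINT x. \<kappa> x * (- e * deta n c d x))"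
  proof (rule integral_dominated_convergence[where w = "\<lambda>x. indicator {c - 1..d + 2} x * (\<bar>B2\<bar> * \<bar>B1\<bar>)"])
    show "(\<lambda>x. \<kappa> x * (- e * deta n c d x)) \<in> borel_measurable lborel"
      using borel_measurable_continuous_onI[OF continuous_on_mult[OF \<kappa> continuous_on_mult[OF continuous_on_const[of _ "- e"] deta_continuous]]] by simp
    show "(\<lambda>x. \<kappa> x * ((?\<eta> (x - e / real (Suc k)) - ?\<eta> x) / (1 / real (Suc k)))) \<in> borel_measurable lborel" for k
    proof -
      have "continuous_on UNIV (\<lambda>x. \<kappa> x * ((?\<eta> (x + (- (e / real (Suc k)))) - ?\<eta> x) / (1 / real (Suc k))))"
        by (intro continuous_on_mult \<kappa> continuous_on_divide continuous_on_diff ec eta_continuous continuous_on_const) simp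
      from borel_measurable_continuous_onI[OF this] show ?thesis by simp
    qed
    show "integrable lborel (\<lambda>x. indicator {c - 1..d + 2} x * (\<bar>B2\<bar> * \<bar>B1\<bar>))"
      using set_integrable_continuous[of "{c - 1..d + 2}" "\<lambda>_. \<bar>B2\<bar> * \<bar>B1\<bar>"] by (simp add: set_integrable_def)
    show "AE x in lborel. norm (\<kappa> x * ((?\<eta> (x - e / real (Suc k)) - ?\<eta> x) / (1 / real (Suc k)))) \<le> indicator {c - 1..d + 2} x * (\<bar>B2\<bar> * \<bar>B1\<bar>)" for k
    proof (rule AE_I2)
      fix x
      define h where "h = e / real (Suc k)"
      have h: "\<bar>h\<bar> = 1 / real (Suc k)" "\<bar>h\<bar> \<le> 1" using e by (auto simp: h_def)
      show "norm (\<kappa> x * ((?\<eta> (x - e / real (Suc k)) - ?\<eta> x) / (1 / real (Suc k)))) \<le> indicator {c - 1..d + 2} x * (\<bar>B2\<bar> * \<bar>B1\<bar>)"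
        unfolding h_def[symmetric] h(1)[symmetric]
      proof (cases "x \<in> {c - 1..d + 2}")
        case True
        have "\<bar>h\<bar> > 0" unfolding h(1) by simp
        then have "\<bar>(?\<eta> (x - h) - ?\<eta> x) / \<bar>h\<bar>\<bar> \<le> \<bar>B1\<bar>" using Lip[of x h] by (simp add: field_simps)
        moreover have "\<bar>\<kappa> x\<bar> \<le> \<bar>B2\<bar>" using B2[OF True] by linarith
        moreover have "indicator {c - 1..d + 2} x = (1::real)" using True by simp
        ultimately show "norm (\<kappa> x * ((?\<eta> (x - h) - ?\<eta> x) / \<bar>h\<bar>)) \<le> indicator {c - 1..d + 2} x * (\<bar>B2\<bar> * \<bar>B1\<bar>)"
          unfolding real_norm_def abs_mult by (simp only: mult_1_left mult_mono abs_ge_zero)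
      next
        case False
        then have "?\<eta> x = 0" "?\<eta> (x - h) = 0" using h(2) by (auto intro!: eta_supp(1)[OF n cd])
        then show "norm (\<kappa> x * ((?\<eta> (x - h) - ?\<eta> x) / \<bar>h\<bar>)) \<le> indicator {c - 1..d + 2} x * (\<bar>B2\<bar> * \<bar>B1\<bar>)" using False by simp
      qed
    qed
    show "AE x in lborel. (\<lambda>k. \<kappa> x * ((?\<eta> (x - e / real (Suc k)) - ?\<eta> x) / (1 / real (Suc k)))) \<longlonglongrightarrow> \<kappa> x * (- e * deta n c d x)"
    proof (rule AE_I2)
      fix x
      have "((\<lambda>h. (?\<eta> (x + h) - ?\<eta> x) / h) \<longlongrightarrow> deta n c d x) (at 0)"
        using eta_deriv[of n c d x] by (simp add: DERIV_def)
      moreover have "filterlim (\<lambda>k. - e / real (Suc k)) (at 0) sequentially"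
      proof (rule filterlim_atI)
        have "(\<lambda>k. - e * (1 / real (Suc k))) \<longlonglongrightarrow> - e * 0"
          by (intro tendsto_mult tendsto_const LIMSEQ_Suc[OF lim_1_over_n])
        then show "(\<lambda>k. - e / real (Suc k)) \<longlonglongrightarrow> 0" by simp
        show "\<forall>\<^sub>F k in sequentially. - e / real (Suc k) \<noteq> 0" using e by auto
      qed
      ultimately have "(\<lambda>k. (?\<eta> (x + (- e / real (Suc k))) - ?\<eta> x) / (- e / real (Suc k))) \<longlonglongrightarrow> deta n c d x"
        by (rule filterlim_compose)
      from tendsto_mult[OF tendsto_const[of "\<kappa> x"] tendsto_mult[OF tendsto_const[of "- e"] this]]
      show "(\<lambda>k. \<kappa> x * ((?\<eta> (x - e / real (Suc k)) - ?\<eta> x) / (1 / real (Suc k)))) \<longlonglongrightarrow> \<kappa> x * (- e * deta n c d x)"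
      proof (rule Lim_transform_eventually, intro always_eventually allI)
        fix k
        have "- e * ((?\<eta> (x + (- e / real (Suc k))) - ?\<eta> x) / (- e / real (Suc k))) = (?\<eta> (x - e / real (Suc k)) - ?\<eta> x) / (1 / real (Suc k))"
          using e by auto
        then show "\<kappa> x * (- e * ((?\<eta> (x + (- e / real (Suc k))) - ?\<eta> x) / (- e / real (Suc k)))) = \<kappa> x * ((?\<eta> (x - e / real (Suc k)) - ?\<eta> x) / (1 / real (Suc k)))"
          by (simp only:)
      qed
    qed
  qed
  moreover have "(LBINT x. \<kappa> x * ((?\<eta> (x - e / real (Suc k)) - ?\<eta> x) / (1 / real (Suc k))))
     = (LBINT x. (\<kappa> (x + e / real (Suc k)) - \<kappa> x) * ?\<eta> x) / (1 / real (Suc k))" for k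
    unfolding sh by (simp only: times_divide_eq_right Bochner_Integration.integral_divide_zero)
  moreover have "(LBINT x. \<kappa> x * (- e * deta n c d x)) = - e * (LBINT x. \<kappa> x * deta n c d x)"
    by (simp add: mult.left_commute[of _ e])
  ultimately show ?thesis by simp
qed

end

section \<open>d'Alembert decomposition\<close>

text \<open>The signed integral of f from 0 to u, rescaled to a fixed interval: one formula for both
  signs of u, continuous in parameters.\<close>

definition prim :: "(real \<Rightarrow> real) \<Rightarrow> real \<Rightarrow> real" where
  "prim f u = u * (LBINT s:{0..1}. f (u * s))"

lemma set_integral_singleton: "(LBINT s:{a}. f s) = (0::real)"
  unfolding set_lebesgue_integral_def
  by (rule integral_eq_zero_AE) (use AE_lborel_singleton[of a] in \<open>auto elim: eventually_mono\<close>)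

lemma prim_eq:
  shows "0 \<le> u \<Longrightarrow> prim f u = (LBINT s:{0..u}. f s)" and "u \<le> 0 \<Longrightarrow> prim f u = - (LBINT s:{u..0}. f s)"
proof -
  assume u: "0 \<le> u"
  show "prim f u = (LBINT s:{0..u}. f s)"
  proof (cases "u = 0")
    case False
    then have ind: "indicator {0..u} (u * s) = (indicator {0..1} s :: real)" for s
      using u by (auto simp: indicator_def mult_le_cancel_left1 zero_le_mult_iff)
    have "(LBINT s. indicator {0..u} s *\<^sub>R f s) = \<bar>u\<bar> *\<^sub>R (LBINT s. indicator {0..u} (0 + u * s) *\<^sub>R f (0 + u * s))"
      using False by (rule lborel_integral_real_affine)
    then show ?thesis using u by (simp add: prim_def set_lebesgue_integral_def ind)
  qed (simp add: prim_def set_integral_singleton)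
next
  assume u: "u \<le> 0"
  show "prim f u = - (LBINT s:{u..0}. f s)"
  proof (cases "u = 0")
    case False
    then have ind: "indicator {u..0} (u * s) = (indicator {0..1} s :: real)" for s
      using u by (auto simp: indicator_def mult_le_cancel_left1 mult_le_0_iff)
    have "(LBINT s. indicator {u..0} s *\<^sub>R f s) = \<bar>u\<bar> *\<^sub>R (LBINT s. indicator {u..0} (0 + u * s) *\<^sub>R f (0 + u * s))"
      using False by (rule lborel_integral_real_affine)
    then show ?thesis using u by (simp add: prim_def set_lebesgue_integral_def ind)
  qed (simp add: prim_def set_integral_singleton)
qed

lemma prim_diff:
  assumes f: "continuous_on UNIV f" and xy: "x \<le> y"
  shows "prim f y - prim f x = (LBINT s:{x..y}. f s)"
proof -
  have i: "set_integrable lborel {a..b} f" for a b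
    by (intro set_integrable_continuous continuous_on_subset[OF f]) auto
  consider "0 \<le> x" | "x \<le> 0" "0 \<le> y" | "y \<le> 0" using xy by linarith
  then show ?thesis
  proof cases
    case 1
    then show ?thesis using xy set_integral_combine_Icc[OF i, of 0 x y] by (simp add: prim_eq(1))
  next
    case 2
    then show ?thesis using set_integral_combine_Icc[OF i, of x 0 y] by (simp add: prim_eq)
  next
    case 3
    then show ?thesis using xy set_integral_combine_Icc[OF i, of x y 0] by (simp add: prim_eq(2))
  qed
qed

lemma prim_continuous:
  fixes K :: "'a::euclidean_space \<Rightarrow> real \<Rightarrow> real"
  assumes K: "continuous_on UNIV (\<lambda>z. K (fst z) (snd z))" and g: "continuous_on UNIV g"
  shows "continuous_on UNIV (\<lambda>x. prim (K x) (g x))"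
proof -
  have gf: "continuous_on UNIV (\<lambda>z::'a \<times> real. g (fst z))"
    by (rule continuous_on_compose2[OF g]) (auto intro!: continuous_intros)
  have "continuous_on UNIV (\<lambda>z::'a \<times> real. K (fst z) (g (fst z) * snd z))"
    using continuous_on_compose2[OF K continuous_on_Pair[OF continuous_on_fst[OF continuous_on_id] continuous_on_mult[OF gf continuous_on_snd[OF continuous_on_id]]]]
    by simp
  then have "continuous_on UNIV (\<lambda>x. LBINT s:{0..1}. K x (g x * s))"
    by (rule set_lebesgue_integral_param_continuous[of "\<lambda>x s. K x (g x * s)"])
  then show ?thesis unfolding prim_def by (intro continuous_on_mult g)
qed

lemma abs_set_integral_le:
  fixes f :: "real \<Rightarrow> real"
  assumes f: "set_integrable lborel {a..b} f" and ab: "a \<le> b" and B: "\<And>x. x \<in> {a..b} \<Longrightarrow> \<bar>f x\<bar> \<le> B"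
  shows "\<bar>LBINT x:{a..b}. f x\<bar> \<le> B * (b - a)"
proof -
  have "\<bar>LBINT x:{a..b}. f x\<bar> \<le> (LBINT x:{a..b}. \<bar>f x\<bar>)"
    using set_integral_norm_bound[OF f] by simp
  also have "\<dots> \<le> (LBINT x:{a..b}. B)"
    using B by (intro set_integral_mono set_integrable_abs f set_integrable_continuous) auto
  also have "\<dots> = B * (b - a)" using ab by (simp add: set_lebesgue_integral_def)
  finally show ?thesis .
qed

section \<open>Profiles and Duhamel term from the rectangle identity\<close>

locale rect_wave =
  fixes p :: real and \<Phi> :: "real \<Rightarrow> real \<Rightarrow> real"
  assumes p: "p > 1" and cont: "continuous_on UNIV (\<lambda>z. \<Phi> (fst z) (snd z))"
    and rect: "u0 \<le> u1 \<Longrightarrow> v0 \<le> v1 \<Longrightarrow>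
      \<Phi> u1 v1 - \<Phi> u1 v0 - \<Phi> u0 v1 + \<Phi> u0 v0 = - 1 / 4 * (LBINT v:{v0..v1}. LBINT u:{u0..u1}. nl p (\<Phi> u v))"
begin

lemma \<Phi>_compose:
  assumes "continuous_on S f" "continuous_on S g"
  shows "continuous_on S (\<lambda>x. \<Phi> (f x) (g x))"
  using continuous_on_compose2[OF cont continuous_on_Pair[OF assms]] by simp

lemma nl_compose:
  assumes "continuous_on S f" "continuous_on S g"
  shows "continuous_on S (\<lambda>x. nl p (\<Phi> (f x) (g x)))"
  by (rule continuous_on_compose2[OF nl_continuous[OF p, of UNIV] \<Phi>_compose[OF assms]]) simp

lemma swap: "rect_wave p (\<lambda>u v. \<Phi> v u)"
proof
  fix u0 u1 v0 v1 :: real assume le: "u0 \<le> u1" "v0 \<le> v1"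
  have "(LBINT v:{v0..v1}. LBINT u:{u0..u1}. nl p (\<Phi> v u)) = (LBINT u:{u0..u1}. LBINT v:{v0..v1}. nl p (\<Phi> v u))"
    by (rule set_integral_Fubini_continuous) (intro nl_compose continuous_intros)
  then show "\<Phi> v1 u1 - \<Phi> v0 u1 - \<Phi> v1 u0 + \<Phi> v0 u0 = - 1 / 4 * (LBINT v:{v0..v1}. LBINT u:{u0..u1}. nl p (\<Phi> v u))"
    using rect[OF le(2,1)] by simp
qed (use p in \<open>auto intro!: \<Phi>_compose continuous_intros\<close>)

text \<open>The signed integral of the nonlinearity over s from - v to u, so from the line t = 0
  along the characteristic with this v. Starting at t = 0 makes S vanish there and be O(|u + v|)
  nearby, so that only the profiles carry the data.\<close>

definition S :: "real \<Rightarrow> real \<Rightarrow> real" where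
  "S u v = prim (\<lambda>s. nl p (\<Phi> s v)) u - prim (\<lambda>s. nl p (\<Phi> s v)) (- v)"

text \<open>By the rectangle identity, the v-increments of \<Phi> u v plus 1 / 4 of a v-primitive of
  S u do not depend on u; the profile in v is this common function, read off at u = 0.\<close>

definition \<kappa> :: "real \<Rightarrow> real" where "\<kappa> v = \<Phi> 0 v + 1 / 4 * prim (S 0) v"

lemma S_continuous: "continuous_on UNIV (\<lambda>z. S (fst z) (snd z))"
  unfolding S_def
  by (intro continuous_on_diff prim_continuous[where K = "\<lambda>z s. nl p (\<Phi> s (snd z))"]) (intro nl_compose continuous_intros)+

lemma S_line: "continuous_on A (S u)"
  using continuous_on_compose2[OF S_continuous continuous_on_Pair[OF continuous_on_const[of _ u] continuous_on_id]] by simp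

lemma S_diff: "u0 \<le> u1 \<Longrightarrow> S u1 v - S u0 v = (LBINT u:{u0..u1}. nl p (\<Phi> u v))"
  unfolding S_def using prim_diff[of "\<lambda>s. nl p (\<Phi> s v)" u0 u1] by (simp add: nl_compose)

lemma S_diagonal: "S (- v) v = 0" by (simp add: S_def)

lemma S_bound:
  obtains B where "B \<ge> 0" "\<And>u v. \<bar>u\<bar> \<le> R \<Longrightarrow> \<bar>v\<bar> \<le> R \<Longrightarrow> \<bar>S u v\<bar> \<le> B * \<bar>u + v\<bar>"
proof -
  have "bounded ((\<lambda>z. nl p (\<Phi> (fst z) (snd z))) ` ({-R..R} \<times> {-R..R}))"
    by (intro compact_imp_bounded compact_continuous_image compact_Times nl_compose continuous_intros) auto
  then obtain B where B: "\<And>u v. u \<in> {-R..R} \<Longrightarrow> v \<in> {-R..R} \<Longrightarrow> \<bar>nl p (\<Phi> u v)\<bar> \<le> B"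
    by (fastforce simp: bounded_iff)
  have i: "set_integrable lborel {a..b} (\<lambda>s. nl p (\<Phi> s v))" for a b v
    by (intro set_integrable_continuous nl_compose continuous_intros) auto
  show ?thesis
  proof (rule that[of "\<bar>B\<bar>"])
    fix u v :: real assume uv: "\<bar>u\<bar> \<le> R" "\<bar>v\<bar> \<le> R"
    have b: "\<bar>nl p (\<Phi> s v)\<bar> \<le> \<bar>B\<bar>" if "s \<in> {-R..R}" for s using B[OF that, of v] uv by fastforce
    show "\<bar>S u v\<bar> \<le> \<bar>B\<bar> * \<bar>u + v\<bar>"
    proof (cases "- v \<le> u")
      case True
      have "S u v = (LBINT s:{- v..u}. nl p (\<Phi> s v))" using S_diff[OF True, of v] by (simp add: S_diagonal)
      moreover have "\<bar>LBINT s:{- v..u}. nl p (\<Phi> s v)\<bar> \<le> \<bar>B\<bar> * (u - (- v))"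
        by (rule abs_set_integral_le[OF i True b]) (use uv in auto)
      ultimately show ?thesis using True by simp
    next
      case False
      then have le: "u \<le> - v" by simp
      have "S u v = - (LBINT s:{u..- v}. nl p (\<Phi> s v))" using S_diff[OF le, of v] by (simp add: S_diagonal)
      moreover have "\<bar>LBINT s:{u..- v}. nl p (\<Phi> s v)\<bar> \<le> \<bar>B\<bar> * (- v - u)"
        by (rule abs_set_integral_le[OF i le b]) (use uv in auto)
      moreover have "\<bar>u + v\<bar> = - v - u" using le by simp
      ultimately show ?thesis by (simp only: abs_minus_cancel)
    qed
  qed simp
qed

lemma \<kappa>_continuous: "continuous_on UNIV \<kappa>"
  unfolding \<kappa>_def
  by (intro continuous_intros \<Phi>_compose prim_continuous[where K = "\<lambda>v s. S 0 s"]
      continuous_on_compose2[OF S_line[of UNIV 0]]) auto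

lemma \<Phi>_increment:
  assumes v: "v0 \<le> v1"
  shows "\<Phi> u v1 - \<Phi> u v0 = \<kappa> v1 - \<kappa> v0 - 1 / 4 * (LBINT v:{v0..v1}. S u v)"
proof -
  have iS: "set_integrable lborel {v0..v1} (S u)" for u by (intro set_integrable_continuous S_line) simp
  have 0: "\<kappa> v1 - \<kappa> v0 = \<Phi> 0 v1 - \<Phi> 0 v0 + 1 / 4 * (LBINT v:{v0..v1}. S 0 v)"
    unfolding \<kappa>_def using prim_diff[OF S_line v, of 0] by (simp add: right_diff_distrib[symmetric])
  have d: "(\<Phi> u1 v1 - \<Phi> u1 v0) - (\<Phi> u0 v1 - \<Phi> u0 v0) = - 1 / 4 * ((LBINT v:{v0..v1}. S u1 v) - (LBINT v:{v0..v1}. S u0 v))"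
    if u: "u0 \<le> u1" for u0 u1
    using rect[OF u v] unfolding S_diff[OF u, symmetric] set_integral_diff(2)[OF iS iS] by simp
  show ?thesis
    using 0 d[of 0 u] d[of u 0] by (cases "0 \<le> u") (simp_all add: field_simps)
qed

end

context rect_wave
begin

interpretation swap: rect_wave p "\<lambda>u v. \<Phi> v u"
  by (rule swap)

text \<open>The profile in u, obtained by exchanging u and v; it is not the derivative of
  \<kappa>.\<close>

definition \<kappa>' :: "real \<Rightarrow> real" where "\<kappa>' = swap.\<kappa>"

lemma \<kappa>'_continuous: "continuous_on UNIV \<kappa>'"
  unfolding \<kappa>'_def by (rule swap.\<kappa>_continuous)

lemma both_bounds:
  obtains B where "B \<ge> 0" "\<And>u v. \<bar>u\<bar> \<le> R \<Longrightarrow> \<bar>v\<bar> \<le> R \<Longrightarrow> \<bar>S u v\<bar> \<le> B * \<bar>u + v\<bar>"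
    "\<And>u v. \<bar>u\<bar> \<le> R \<Longrightarrow> \<bar>v\<bar> \<le> R \<Longrightarrow> \<bar>swap.S v u\<bar> \<le> B * \<bar>u + v\<bar>"
proof -
  obtain B1 where B1: "B1 \<ge> 0" "\<And>u v. \<bar>u\<bar> \<le> R \<Longrightarrow> \<bar>v\<bar> \<le> R \<Longrightarrow> \<bar>S u v\<bar> \<le> B1 * \<bar>u + v\<bar>"
    using S_bound[of R] by blast
  obtain B2 where B2: "B2 \<ge> 0" "\<And>u v. \<bar>u\<bar> \<le> R \<Longrightarrow> \<bar>v\<bar> \<le> R \<Longrightarrow> \<bar>swap.S u v\<bar> \<le> B2 * \<bar>u + v\<bar>"
    using swap.S_bound[of R] by blast
  show ?thesis
  proof (rule that[of "max B1 B2"])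
    show "\<bar>S u v\<bar> \<le> max B1 B2 * \<bar>u + v\<bar>" if "\<bar>u\<bar> \<le> R" "\<bar>v\<bar> \<le> R" for u v
      using B1(2)[OF that] mult_right_mono[of B1 "max B1 B2" "\<bar>u + v\<bar>"] by linarith
    show "\<bar>swap.S v u\<bar> \<le> max B1 B2 * \<bar>u + v\<bar>" if "\<bar>u\<bar> \<le> R" "\<bar>v\<bar> \<le> R" for u v
      using B2(2)[OF that(2,1)] mult_right_mono[of B2 "max B1 B2" "\<bar>v + u\<bar>"] by (simp add: add.commute)
  qed (use B1 in simp)
qed

text \<open>At time $0$ the corner terms are quadratically small, so the sum of the two profiles
  differs from the initial value by a function with vanishing derivative.\<close>

lemma profile_sum:
  "\<kappa> d + \<kappa>' (- d) - \<Phi> (- d) d = \<kappa> c + \<kappa>' (- c) - \<Phi> (- c) c"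
proof -
  define Z where "Z x = \<kappa> x + \<kappa>' (- x) - \<Phi> (- x) x" for x
  have "(Z has_real_derivative 0) (at x)" for x
  proof -
    obtain B where B: "B \<ge> 0" "\<And>u v. \<bar>u\<bar> \<le> \<bar>x\<bar> + 1 \<Longrightarrow> \<bar>v\<bar> \<le> \<bar>x\<bar> + 1 \<Longrightarrow> \<bar>S u v\<bar> \<le> B * \<bar>u + v\<bar>"
      "\<And>u v. \<bar>u\<bar> \<le> \<bar>x\<bar> + 1 \<Longrightarrow> \<bar>v\<bar> \<le> \<bar>x\<bar> + 1 \<Longrightarrow> \<bar>swap.S v u\<bar> \<le> B * \<bar>u + v\<bar>"
      using both_bounds[of "\<bar>x\<bar> + 1"] by blast
    have inc: "\<bar>Z d - Z c\<bar> \<le> B * (d - c)\<^sup>2" if cd: "c \<le> d" "\<bar>c\<bar> \<le> \<bar>x\<bar> + 1" "\<bar>d\<bar> \<le> \<bar>x\<bar> + 1" for c d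
    proof -
      have i1: "set_integrable lborel {c..d} (S (- d))" by (intro set_integrable_continuous S_line) simp
      have i2: "set_integrable lborel {- d..- c} (swap.S c)" by (intro set_integrable_continuous swap.S_line) simp
      have "\<bar>LBINT v:{c..d}. S (- d) v\<bar> \<le> (B * (d - c)) * (d - c)"
      proof (rule abs_set_integral_le[OF i1 cd(1)])
        fix v assume v: "v \<in> {c..d}"
        have "\<bar>S (- d) v\<bar> \<le> B * \<bar>- d + v\<bar>" using v cd by (intro B(2)) auto
        also have "\<dots> \<le> B * (d - c)" using v B(1) by (intro mult_left_mono) auto
        finally show "\<bar>S (- d) v\<bar> \<le> B * (d - c)" .
      qed
      moreover have "\<bar>LBINT u:{- d..- c}. swap.S c u\<bar> \<le> (B * (d - c)) * (- c - (- d))"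
      proof (rule abs_set_integral_le[OF i2])
        fix u assume u: "u \<in> {- d..- c}"
        have "\<bar>swap.S c u\<bar> \<le> B * \<bar>u + c\<bar>" using u cd by (intro B(3)) auto
        also have "\<dots> \<le> B * (d - c)" using u B(1) by (intro mult_left_mono) auto
        finally show "\<bar>swap.S c u\<bar> \<le> B * (d - c)" .
      qed (use cd in simp)
      \<comment> \<open>The points (- c, c) and (- d, d) of the line t = 0 are joined along two
        characteristics through the corner (- d, c). Each leg has length d - c, and the Duhamel term
        on it is at most B (d - c).\<close>
      moreover have "Z d - Z c = 1 / 4 * (LBINT v:{c..d}. S (- d) v) - 1 / 4 * (LBINT u:{- d..- c}. swap.S c u)"
        using \<Phi>_increment[OF cd(1), of "- d"] swap.\<Phi>_increment[of "- d" "- c" c] cd(1) by (simp add: Z_def \<kappa>'_def)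
      moreover have "0 \<le> B * (d - c)\<^sup>2" using B(1) by simp
      ultimately show ?thesis by (simp add: power2_eq_square mult.assoc)
    qed
    have "((\<lambda>h. (Z (x + h) - Z x) / h) \<longlongrightarrow> 0) (at 0)"
    proof (rule Lim_null_comparison)
      show "((\<lambda>h. B * \<bar>h\<bar>) \<longlongrightarrow> 0) (at 0)"
        by (rule tendsto_eq_intros refl)+ simp
      have "\<forall>\<^sub>F h in at (0::real). \<bar>h\<bar> < 1"
        unfolding eventually_at by (intro exI[of _ 1]) (auto simp: dist_real_def)
      moreover have "\<forall>\<^sub>F h in at (0::real). h \<noteq> 0" by (simp add: eventually_at_filter)
      ultimately show "\<forall>\<^sub>F h in at 0. norm ((Z (x + h) - Z x) / h) \<le> B * \<bar>h\<bar>"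
      proof eventually_elim
        case (elim h)
        have "\<bar>Z (x + h) - Z x\<bar> \<le> B * h\<^sup>2"
          using inc[of x "x + h"] inc[of "x + h" x] elim by (cases "0 \<le> h") (auto simp: abs_minus_commute)
        then have "\<bar>Z (x + h) - Z x\<bar> / \<bar>h\<bar> \<le> B * \<bar>h\<bar> * \<bar>h\<bar> / \<bar>h\<bar>"
          by (intro divide_right_mono) (auto simp: power2_eq_square mult.assoc)
        then show ?case using elim by simp
      qed
    qed
    then show ?thesis by (simp add: DERIV_def)
  qed
  then have "Z d = Z c" by (intro DERIV_isconst_all) auto
  then show ?thesis by (simp add: Z_def)
qed

text \<open>Up to first order in t the solution moves like the free wave with profiles \<kappa> and
  \<kappa>'. The path from (- x, x) through the corner (t - x, x) to (t - x, t + x) has legs of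
  length t, along which the Duhamel terms are O(t).\<close>

lemma time_expansion:
  obtains B where "B \<ge> 0" "\<And>x t. \<bar>x\<bar> \<le> R \<Longrightarrow> 0 < t \<Longrightarrow> t \<le> 1 \<Longrightarrow>
    \<bar>\<Phi> (t - x) (t + x) - \<Phi> (- x) x - (\<kappa> (x + t) - \<kappa> x) - (\<kappa>' (- (x - t)) - \<kappa>' (- x))\<bar> \<le> B * t\<^sup>2"
proof -
  obtain B where B: "B \<ge> 0" "\<And>u v. \<bar>u\<bar> \<le> R + 1 \<Longrightarrow> \<bar>v\<bar> \<le> R + 1 \<Longrightarrow> \<bar>S u v\<bar> \<le> B * \<bar>u + v\<bar>"
    "\<And>u v. \<bar>u\<bar> \<le> R + 1 \<Longrightarrow> \<bar>v\<bar> \<le> R + 1 \<Longrightarrow> \<bar>swap.S v u\<bar> \<le> B * \<bar>u + v\<bar>"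
    using both_bounds[of "R + 1"] by blast
  show ?thesis
  proof (rule that[OF B(1)])
    fix x t :: real assume xt: "\<bar>x\<bar> \<le> R" "0 < t" "t \<le> 1"
    have i1: "set_integrable lborel {x..x + t} (S (t - x))" by (intro set_integrable_continuous S_line) simp
    have i2: "set_integrable lborel {- x..t - x} (swap.S x)" by (intro set_integrable_continuous swap.S_line) simp
    have "\<bar>LBINT v:{x..x + t}. S (t - x) v\<bar> \<le> (B * (2 * t)) * (x + t - x)"
    proof (rule abs_set_integral_le[OF i1])
      fix v assume v: "v \<in> {x..x + t}"
      have "\<bar>S (t - x) v\<bar> \<le> B * \<bar>t - x + v\<bar>" using v xt by (intro B(2)) auto
      also have "\<dots> \<le> B * (2 * t)" using v B(1) xt by (intro mult_left_mono) auto
      finally show "\<bar>S (t - x) v\<bar> \<le> B * (2 * t)" .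
    qed (use xt in simp)
    moreover have "\<bar>LBINT u:{- x..t - x}. swap.S x u\<bar> \<le> (B * t) * (t - x - (- x))"
    proof (rule abs_set_integral_le[OF i2])
      fix u assume u: "u \<in> {- x..t - x}"
      have "\<bar>swap.S x u\<bar> \<le> B * \<bar>u + x\<bar>" using u xt by (intro B(3)) auto
      also have "\<dots> \<le> B * t" using u B(1) xt by (intro mult_left_mono) auto
      finally show "\<bar>swap.S x u\<bar> \<le> B * t" .
    qed (use xt in simp)
    moreover have "\<Phi> (t - x) (t + x) - \<Phi> (- x) x - (\<kappa> (x + t) - \<kappa> x) - (\<kappa>' (- (x - t)) - \<kappa>' (- x))
        = - 1 / 4 * (LBINT v:{x..x + t}. S (t - x) v) - 1 / 4 * (LBINT u:{- x..t - x}. swap.S x u)"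
      using \<Phi>_increment[of x "x + t" "t - x"] swap.\<Phi>_increment[of "- x" "t - x" x] xt
      by (simp add: \<kappa>'_def add.commute)
    moreover have "0 \<le> B * t\<^sup>2" using B(1) by simp
    ultimately show "\<bar>\<Phi> (t - x) (t + x) - \<Phi> (- x) x - (\<kappa> (x + t) - \<kappa> x) - (\<kappa>' (- (x - t)) - \<kappa>' (- x))\<bar> \<le> B * t\<^sup>2"
      by (simp add: power2_eq_square mult.assoc mult.left_commute[of B])
  qed
qed

text \<open>The densities g, h are rough but depend on one variable each, while the Duhamel terms
  are continuous and have a multiple of the nonlinearity as derivative in the other variable. On t =
  0 these terms vanish, so the energy of the data is that of g and h.\<close>

lemma wave_of_profiles:
  assumes gm: "g \<in> borel_measurable borel" and hm: "h \<in> borel_measurable borel"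
    and g2: "integrable lborel (\<lambda>x. (g x)\<^sup>2)" and h2: "integrable lborel (\<lambda>x. (h x)\<^sup>2)"
    and \<kappa>g: "\<And>c d. c \<le> d \<Longrightarrow> \<kappa> d - \<kappa> c = (LBINT x:{c..d}. g x)"
    and \<kappa>h: "\<And>c d. c \<le> d \<Longrightarrow> \<kappa>' d - \<kappa>' c = (LBINT x:{c..d}. h x)"
    and di: "integrable lborel (\<lambda>x. (1 + \<bar>x\<bar>) * (2 * (g x)\<^sup>2 + 2 * (h (- x))\<^sup>2 + pot p (\<Phi> (- x) x)))"
    and db: "(LBINT x. (1 + \<bar>x\<bar>) * (2 * (g x)\<^sup>2 + 2 * (h (- x))\<^sup>2 + pot p (\<Phi> (- x) x))) \<le> M"
  shows "wave p M \<Phi> (\<lambda>u v. g v - 1 / 4 * S u v) (\<lambda>u v. h u - 1 / 4 * swap.S v u)"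
proof -
  have gi: "set_integrable lborel {a..b} (\<lambda>x. (f x)\<^sup>2)" "set_integrable lborel {a..b} f"
    if f: "f \<in> borel_measurable borel" "integrable lborel (\<lambda>x. (f x)\<^sup>2)" for f :: "real \<Rightarrow> real" and a b
  proof -
    show i: "set_integrable lborel {a..b} (\<lambda>x. (f x)\<^sup>2)"
      using f(2) unfolding set_integrable_def by (intro integrable_mult_indicator) auto
    have 1: "set_integrable lborel {a..b} (\<lambda>_. 1::real)" by (intro set_integrable_continuous) auto
    show "set_integrable lborel {a..b} f"
    proof (rule set_integrable_dominated[OF set_integral_add(1)[OF 1 i] f(1)])
      show "\<bar>f x\<bar> \<le> 1 + (f x)\<^sup>2" for x
        using zero_le_power2[of "\<bar>f x\<bar> - 1"] by (simp add: power2_diff)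
    qed simp
  qed
  have sq: "set_integrable lborel {a..b} (\<lambda>x. (f x - 1 / 4 * k x)\<^sup>2)"
    if f: "f \<in> borel_measurable borel" "integrable lborel (\<lambda>x. (f x)\<^sup>2)" and k: "continuous_on UNIV k"
    for f k :: "real \<Rightarrow> real" and a b
  proof -
    have k2: "set_integrable lborel {a..b} (\<lambda>x. 2 * (k x)\<^sup>2)"
      by (intro set_integrable_continuous continuous_intros continuous_on_subset[OF k]) auto
    have km: "k \<in> borel_measurable borel" by (rule borel_measurable_continuous_onI[OF k])
    show ?thesis
    proof (rule set_integrable_dominated[OF set_integral_add(1)[OF set_integrable_mult_right[OF gi(1)[OF f]] k2]])
      show "(\<lambda>x. (f x - 1 / 4 * k x)\<^sup>2) \<in> borel_measurable borel" using f(1) km by simp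
      show "\<bar>(f x - 1 / 4 * k x)\<^sup>2\<bar> \<le> 2 * (f x)\<^sup>2 + 2 * (k x)\<^sup>2" for x
      proof -
        have "(f x - 1 / 4 * k x)\<^sup>2 + (f x + 1 / 4 * k x)\<^sup>2 = 2 * (f x)\<^sup>2 + 1 / 8 * (k x)\<^sup>2"
          by (simp add: power2_eq_square algebra_simps)
        moreover have "0 \<le> (f x + 1 / 4 * k x)\<^sup>2" "0 \<le> (k x)\<^sup>2" by simp_all
        ultimately have "(f x - 1 / 4 * k x)\<^sup>2 \<le> 2 * (f x)\<^sup>2 + 2 * (k x)\<^sup>2" by linarith
        then show ?thesis by simp
      qed
    qed simp
  qed
  have ac: "ac_deriv \<Psi> (\<lambda>x. f x - 1 / 4 * k x) a b"
    if f: "f \<in> borel_measurable borel" "integrable lborel (\<lambda>x. (f x)\<^sup>2)" and k: "continuous_on UNIV k"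
      and \<Psi>: "\<And>c d. c \<le> d \<Longrightarrow> \<Psi> d - \<Psi> c = (LBINT x:{c..d}. f x) - 1 / 4 * (LBINT x:{c..d}. k x)"
    for f k \<Psi> :: "real \<Rightarrow> real" and a b
  proof -
    have ki: "set_integrable lborel {c..d} (\<lambda>x. 1 / 4 * k x)" for c d
      by (intro set_integrable_continuous continuous_intros continuous_on_subset[OF k]) auto
    show ?thesis unfolding ac_deriv_def
    proof (intro conjI allI impI)
      show "set_integrable lborel {a..b} (\<lambda>x. f x - 1 / 4 * k x)"
        by (rule set_integral_diff(1)[OF gi(2)[OF f] ki])
      fix x y :: real assume "x \<le> y"
      then show "\<Psi> y - \<Psi> x = (LBINT s:{x..y}. f s - 1 / 4 * k s)"
        unfolding set_integral_diff(2)[OF gi(2)[OF f] ki] set_integral_mult_right by (rule \<Psi>)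
    qed
  qed
  have acS: "ac_deriv (\<lambda>x. C - 1 / 4 * k x) (\<lambda>x. - f x / 4) a b"
    if f: "continuous_on UNIV f" and k: "\<And>c d. c \<le> d \<Longrightarrow> k d - k c = (LBINT x:{c..d}. f x)"
    for f k :: "real \<Rightarrow> real" and a b C
  proof -
    have fi: "set_integrable lborel {c..d} (\<lambda>x. - 1 / 4 * f x)" for c d
      by (intro set_integrable_continuous continuous_intros continuous_on_subset[OF f]) auto
    have e: "- f x / 4 = - 1 / 4 * f x" for x by simp
    show ?thesis unfolding ac_deriv_def e
    proof (intro conjI allI impI fi)
      fix x y :: real assume "x \<le> y"
      from k[OF this] show "C - 1 / 4 * k y - (C - 1 / 4 * k x) = (LBINT s:{x..y}. - 1 / 4 * f s)"
        unfolding set_integral_mult_right by simp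
    qed
  qed
  have sS: "continuous_on UNIV (\<lambda>z. swap.S (snd z) (fst z))"
    using continuous_on_compose2[OF swap.S_continuous continuous_on_Pair[OF continuous_on_snd[OF continuous_on_id] continuous_on_fst[OF continuous_on_id]]] by simp
  show ?thesis
  proof
    show "p > 1" by (rule p)
    show "continuous_on UNIV (\<lambda>z. \<Phi> (fst z) (snd z))" by (rule cont)
    have "(\<lambda>z::real\<times>real. g (snd z)) \<in> borel_measurable borel" "(\<lambda>z::real\<times>real. h (fst z)) \<in> borel_measurable borel"
      using measurable_compose[OF measurable_snd, of g lborel borel lborel] measurable_compose[OF measurable_fst, of h lborel borel lborel] gm hm
      by (simp_all add: lborel_prod)
    then show "(\<lambda>z. g (snd z) - 1 / 4 * S (fst z) (snd z)) \<in> borel_measurable borel"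
      "(\<lambda>z. h (fst z) - 1 / 4 * swap.S (snd z) (fst z)) \<in> borel_measurable borel"
      using borel_measurable_continuous_onI[OF S_continuous] borel_measurable_continuous_onI[OF sS] by simp_all
    show "set_integrable lborel {a..b} (\<lambda>v. (g v - 1 / 4 * S u v)\<^sup>2)" for a b u
      by (rule sq[OF gm g2 S_line])
    show "set_integrable lborel {a..b} (\<lambda>u. (h u - 1 / 4 * swap.S v u)\<^sup>2)" for a b v
      by (rule sq[OF hm h2 swap.S_line])
    show "ac_deriv (\<Phi> u) (\<lambda>v. g v - 1 / 4 * S u v) a b" for u a b
      by (rule ac[OF gm g2 S_line]) (simp add: \<Phi>_increment \<kappa>g)
    show "ac_deriv (\<lambda>u. \<Phi> u v) (\<lambda>u. h u - 1 / 4 * swap.S v u) a b" for v a b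
      by (rule ac[OF hm h2 swap.S_line]) (simp add: swap.\<Phi>_increment \<kappa>h[unfolded \<kappa>'_def])
    show "ac_deriv (\<lambda>u. g v - 1 / 4 * S u v) (\<lambda>u. - nl p (\<Phi> u v) / 4) a b" for v a b
      by (rule acS[OF _ S_diff]) (intro nl_compose continuous_intros)
    show "ac_deriv (\<lambda>v. h u - 1 / 4 * swap.S v u) (\<lambda>v. - nl p (\<Phi> u v) / 4) a b" for u a b
      by (rule acS[OF _ swap.S_diff]) (intro nl_compose continuous_intros)
  qed (use di db S_diagonal swap.S_diagonal[of "- x" for x] in simp_all)
qed

end

section \<open>Decay estimates\<close>

text \<open>The argument of d'Alembert for merely continuous profiles. With \<mu> x = \<kappa>' (-
  x), the sum \<kappa> + \<mu> has density d\<phi>0 by \<open>profile_sum\<close>, and \<kappa> -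
  \<mu> has density \<phi>1 by the expansion at t = 0; half sum and half difference give the
  densities of \<kappa> and \<mu>.\<close>

lemma solution_is_wave:
  fixes \<phi> :: "real \<times> real \<Rightarrow> real"
  assumes p: "p > 1" and E: "E < \<infinity>"
    and \<phi>1: "\<phi>1 \<in> borel_measurable lborel" and w: "has_weak_deriv 1 \<phi>0 d\<phi>0"
    and en: "weighted_energy p \<phi>0 d\<phi>0 \<phi>1 = E" and sol: "energy_solution p \<phi>0 \<phi>1 \<phi>"
  shows "\<exists>P Q. wave p (enn2real E) (\<lambda>u v. \<phi> ((u + v) / 2, (v - u) / 2)) P Q"
proof -
  obtain H \<rho> where H: "smooth_step H \<rho>"
  proof -
    obtain H \<rho> :: "real \<Rightarrow> real" where "\<And>k. C_k k H" "\<And>k. C_k k \<rho>" "\<And>x. (H has_real_derivative \<rho> x) (at x)"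
      "\<And>x. 0 \<le> \<rho> x" "\<And>x. x \<notin> {0<..<1} \<Longrightarrow> \<rho> x = 0" "(LBINT x. \<rho> x) = 1"
      "\<And>x. x \<le> 0 \<Longrightarrow> H x = 0" "\<And>x. x \<ge> 1 \<Longrightarrow> H x = 1" "\<And>x. 0 \<le> H x" "\<And>x. H x \<le> 1"
      using smooth_step_exists by blast
    then have "smooth_step H \<rho>" by unfold_locales
    then show ?thesis by (rule that)
  qed
  interpret smooth_step H \<rho> by (rule H)
  have \<phi>: "continuous_on UNIV \<phi>" and nlw: "distributional_nlw p \<phi>"
    and ae0: "AE x in lborel. \<phi> (0, x) = \<phi>0 x"
    using sol by (auto simp: energy_solution_def)
  obtain \<phi>t where \<phi>t: "has_weak_deriv (1, 0) \<phi> \<phi>t" "C_t_Lq 2 \<phi>t" "AE x in lborel. \<phi>t (0, x) = \<phi>1 x"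
    using sol by (auto simp: energy_solution_def)
  define \<Phi> where "\<Phi> = (\<lambda>u v. \<phi> ((u + v) / 2, (v - u) / 2))"
  have \<Phi>tx: "\<Phi> (t - x) (t + x) = \<phi> (t, x)" for t x by (simp add: \<Phi>_def)
  have \<Phi>0: "\<Phi> (- x) x = \<phi> (0, x)" for x by (simp add: \<Phi>_def)
  have rw: "rect_wave p \<Phi>"
  proof
    show "p > 1" by (rule p)
    show "continuous_on UNIV (\<lambda>z. \<Phi> (fst z) (snd z))"
      unfolding \<Phi>_def by (rule continuous_on_compose2[OF \<phi>]) (auto intro!: continuous_intros)
    show "\<Phi> u1 v1 - \<Phi> u1 v0 - \<Phi> u0 v1 + \<Phi> u0 v0 = - 1 / 4 * (LBINT v:{v0..v1}. LBINT u:{u0..u1}. nl p (\<Phi> u v))"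
      if "u0 \<le> u1" "v0 \<le> v1" for u0 u1 v0 v1
      unfolding \<Phi>_def by (rule rectangle_identity[OF p \<phi> nlw that])
  qed
  interpret rect_wave p \<Phi> by (rule rw)
  have \<phi>0c: "continuous_on UNIV (\<lambda>x. \<phi> (0, x))"
    by (rule continuous_on_compose2[OF \<phi>]) (auto intro!: continuous_intros)
  have d0m: "d\<phi>0 \<in> borel_measurable lborel" and d0i: "\<And>a b. set_integrable lborel {a..b} d\<phi>0"
    and \<phi>0m: "\<phi>0 \<in> borel_measurable lborel"
    using w by (auto simp: has_weak_deriv_def locally_integrable_def)
  define e where "e x = (1 + \<bar>x\<bar>) * ((d\<phi>0 x)\<^sup>2 + (\<phi>1 x)\<^sup>2 + pot p (\<phi>0 x))" for x
  have potm: "pot p \<in> borel_measurable borel" by (rule borel_measurable_continuous_onI[OF pot_continuous[OF p]])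
  have em: "e \<in> borel_measurable lborel"
    unfolding e_def using d0m \<phi>1 measurable_compose[OF _ potm, of \<phi>0 lborel] \<phi>0m by simp
  have e0: "0 \<le> e x" for x using pot_nonneg[OF p] by (simp add: e_def)
  have ee: "(\<integral>\<^sup>+ x. ennreal (e x) \<partial>lborel) = E"
    using en by (simp add: weighted_energy_def e_def pot_def)
  have ei: "integrable lborel e"
    using E em e0 by (intro integrableI_nonneg) (auto simp: ee)
  have eE: "(LBINT x. e x) = enn2real E"
    using e0 em by (subst integral_eq_nn_integral) (auto simp: ee)
  have sqi: "integrable lborel (\<lambda>x. (d\<phi>0 x)\<^sup>2)" "integrable lborel (\<lambda>x. (\<phi>1 x)\<^sup>2)"
  proof -
    have le: "(d\<phi>0 x)\<^sup>2 + (\<phi>1 x)\<^sup>2 \<le> e x" for x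
      using pot_nonneg[OF p, of "\<phi>0 x"] mult_right_mono[of 1 "1 + \<bar>x\<bar>" "(d\<phi>0 x)\<^sup>2 + (\<phi>1 x)\<^sup>2 + pot p (\<phi>0 x)"]
      by (simp add: e_def)
    have "(d\<phi>0 x)\<^sup>2 \<le> e x" "(\<phi>1 x)\<^sup>2 \<le> e x" for x
      using le[of x] zero_le_power2[of "d\<phi>0 x"] zero_le_power2[of "\<phi>1 x"] by linarith+
    then show "integrable lborel (\<lambda>x. (d\<phi>0 x)\<^sup>2)" "integrable lborel (\<lambda>x. (\<phi>1 x)\<^sup>2)"
      using d0m \<phi>1 e0 by (auto intro!: Bochner_Integration.integrable_bound[OF ei])
  qed
  have \<phi>1i: "set_integrable lborel {a..b} \<phi>1" for a b
  proof (rule set_integrable_dominated)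
    show "set_integrable lborel {a..b} (\<lambda>x. 1 + (\<phi>1 x)\<^sup>2)"
    proof (rule set_integral_add(1))
      show "set_integrable lborel {a..b} (\<lambda>x. (\<phi>1 x)\<^sup>2)"
        unfolding set_integrable_def using sqi(2) by (intro integrable_mult_indicator) auto
      show "set_integrable lborel {a..b} (\<lambda>_. 1::real)" by (intro set_integrable_continuous) auto
    qed
    show "\<bar>\<phi>1 x\<bar> \<le> 1 + (\<phi>1 x)\<^sup>2" for x
      using zero_le_power2[of "\<bar>\<phi>1 x\<bar> - 1"] by (simp add: power2_diff)
  qed (use \<phi>1 in auto)
  define \<mu> where "\<mu> x = \<kappa>' (- x)" for x
  have \<mu>c: "continuous_on UNIV \<mu>"
    unfolding \<mu>_def by (rule continuous_on_compose2[OF \<kappa>'_continuous]) (auto intro!: continuous_intros)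
  have sum: "(\<kappa> d + \<mu> d) - (\<kappa> c + \<mu> c) = (LBINT x:{c..d}. d\<phi>0 x)" if "c \<le> d" for c d
    using profile_sum[of d c] initial_value_primitive[OF w ae0 \<phi>0c that] by (simp add: \<mu>_def \<Phi>0)
  have weak: "(LBINT x. (\<kappa> x - \<mu> x) * deta n c d x) = - (LBINT x. \<phi>1 x * eta n c d x)"
    if n: "n \<ge> 1" and cd: "c \<le> d" for n c d
  proof -
    define t where "t k = 1 / real (Suc k)" for k
    have t: "0 < t k" "t k \<le> 1" for k by (auto simp: t_def)
    have t0: "t \<longlonglongrightarrow> 0" unfolding t_def using LIMSEQ_Suc[OF lim_1_over_n] .
    define L0 where "L0 k = (LBINT x. (\<Phi> (t k - x) (t k + x) - \<Phi> (- x) x) * eta n c d x)" for k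
    define L1 where "L1 k = (LBINT x. (\<kappa> (x + t k) - \<kappa> x) * eta n c d x)" for k
    define L2 where "L2 k = (LBINT x. (\<mu> (x - t k) - \<mu> x) * eta n c d x)" for k
    have l0: "(\<lambda>k. L0 k / t k) \<longlonglongrightarrow> (LBINT x. \<phi>1 x * eta n c d x)"
      using initial_velocity_limit[OF \<phi> \<phi>t \<phi>1 n cd] by (simp add: L0_def t_def \<Phi>tx \<Phi>0)
    have l1: "(\<lambda>k. L1 k / t k) \<longlonglongrightarrow> - (LBINT x. \<kappa> x * deta n c d x)"
      using translation_quotient_limit[OF \<kappa>_continuous n cd, of 1] by (simp add: L1_def t_def)
    have l2: "(\<lambda>k. L2 k / t k) \<longlonglongrightarrow> (LBINT x. \<mu> x * deta n c d x)"
      using translation_quotient_limit[OF \<mu>c n cd, of "- 1"] by (simp add: L2_def t_def)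
    have kc: "continuous_on UNIV (\<lambda>x. \<kappa> (x + h))" "continuous_on UNIV (\<lambda>x. \<mu> (x - h))" for h
      by (rule continuous_on_compose2[OF \<kappa>_continuous] continuous_on_compose2[OF \<mu>c]; auto intro!: continuous_intros)+
    have si: "integrable lborel (\<lambda>x. f x * eta n c d x)" if "continuous_on UNIV f" for f
      by (rule integrable_continuous_supp[of _ "{c..d + 1}"])
        (use that eta_supp(1)[OF n cd] in \<open>auto intro!: continuous_on_mult eta_continuous\<close>)
    have c0: "continuous_on UNIV (\<lambda>x. \<Phi> (s - x) (s + x) - \<Phi> (- x) x)"
      "continuous_on UNIV (\<lambda>x. \<kappa> (x + s) - \<kappa> x)" "continuous_on UNIV (\<lambda>x. \<mu> (x - s) - \<mu> x)" for s
      by (intro continuous_on_diff kc \<kappa>_continuous \<mu>c; intro \<Phi>_compose continuous_intros)+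
    define R where "R = \<bar>c\<bar> + \<bar>d\<bar> + 1"
    obtain B where B: "B \<ge> 0" "\<And>x t. \<bar>x\<bar> \<le> R \<Longrightarrow> 0 < t \<Longrightarrow> t \<le> 1 \<Longrightarrow>
      \<bar>\<Phi> (t - x) (t + x) - \<Phi> (- x) x - (\<kappa> (x + t) - \<kappa> x) - (\<kappa>' (- (x - t)) - \<kappa>' (- x))\<bar> \<le> B * t\<^sup>2"
      using time_expansion[of R] by blast
    \<comment> \<open>On the support of \<open>eta\<close> the increment of the solution differs
      from those of the profiles by O(t^2), which disappears after division by t. The limit of the
      quotients is then the weak form of \<phi>1 being the derivative of \<kappa> - \<mu>.\<close>
    have rem: "\<bar>L0 k - L1 k - L2 k\<bar> \<le> B * (t k)\<^sup>2 * (d + 1 - c)" for k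
    proof -
      define r where "r x = (\<Phi> (t k - x) (t k + x) - \<Phi> (- x) x) * eta n c d x
         - (\<kappa> (x + t k) - \<kappa> x) * eta n c d x - (\<mu> (x - t k) - \<mu> x) * eta n c d x" for x
      have "L0 k - L1 k - L2 k = (LBINT x. r x)"
        unfolding L0_def L1_def L2_def r_def
        using Bochner_Integration.integral_diff[OF Bochner_Integration.integrable_diff[OF si[OF c0(1)] si[OF c0(2)]] si[OF c0(3)], of "t k" "t k" "t k"]
          Bochner_Integration.integral_diff[OF si[OF c0(1)] si[OF c0(2)], of "t k" "t k"] by simp
      also have "\<dots> = (LBINT x:{c..d + 1}. r x)"
        by (rule set_integral_eq_LBINT[symmetric]) (use eta_supp(1)[OF n cd] in \<open>auto simp: r_def\<close>)
      also have "\<bar>\<dots>\<bar> \<le> B * (t k)\<^sup>2 * (d + 1 - c)"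
      proof (rule abs_set_integral_le)
        show "set_integrable lborel {c..d + 1} r"
          unfolding r_def by (intro set_integrable_continuous continuous_on_diff continuous_on_mult eta_continuous continuous_on_subset[OF c0(1)] continuous_on_subset[OF c0(2)[unfolded atomize_eq]] continuous_on_subset[OF kc(1)] continuous_on_subset[OF kc(2)] continuous_on_subset[OF \<kappa>_continuous] continuous_on_subset[OF \<mu>c] \<Phi>_compose continuous_intros) auto
        fix x assume x: "x \<in> {c..d + 1}"
        have "r x = (\<Phi> (t k - x) (t k + x) - \<Phi> (- x) x - (\<kappa> (x + t k) - \<kappa> x) - (\<kappa>' (- (x - t k)) - \<kappa>' (- x))) * eta n c d x"
          by (simp add: r_def \<mu>_def left_diff_distrib)
        then have "\<bar>r x\<bar> \<le> B * (t k)\<^sup>2 * 1"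
          unfolding abs_mult using B(2)[of x "t k"] t[of k] x B(1) eta_abs_le[of n c d x]
          by (simp only: abs_mult) (intro mult_mono, auto simp: R_def)
        then show "\<bar>r x\<bar> \<le> B * (t k)\<^sup>2" by simp
      qed (use cd in simp)
      finally show ?thesis .
    qed
    have "(\<lambda>k. (L0 k - L1 k - L2 k) / t k) \<longlonglongrightarrow> 0"
    proof (rule Lim_null_comparison)
      show "\<forall>\<^sub>F k in sequentially. norm ((L0 k - L1 k - L2 k) / t k) \<le> B * t k * (d + 1 - c)"
      proof (intro always_eventually allI)
        fix k
        have "\<bar>L0 k - L1 k - L2 k\<bar> / t k \<le> B * (t k)\<^sup>2 * (d + 1 - c) / t k"
          using rem[of k] t[of k] by (intro divide_right_mono) auto
        also have "\<dots> = B * t k * (d + 1 - c)" using t[of k] by (simp add: power2_eq_square)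
        finally show "norm ((L0 k - L1 k - L2 k) / t k) \<le> B * t k * (d + 1 - c)" using t[of k] by simp
      qed
      show "(\<lambda>k. B * t k * (d + 1 - c)) \<longlonglongrightarrow> 0"
        using tendsto_mult[OF tendsto_mult[OF tendsto_const[of B] t0] tendsto_const[of "d + 1 - c"]] by simp
    qed
    moreover have "(\<lambda>k. (L0 k - L1 k - L2 k) / t k) \<longlonglongrightarrow>
       (LBINT x. \<phi>1 x * eta n c d x) - (- (LBINT x. \<kappa> x * deta n c d x)) - (LBINT x. \<mu> x * deta n c d x)"
      unfolding diff_divide_distrib by (intro tendsto_diff l0 l1 l2)
    ultimately have "0 = (LBINT x. \<phi>1 x * eta n c d x) + (LBINT x. \<kappa> x * deta n c d x) - (LBINT x. \<mu> x * deta n c d x)"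
      using LIMSEQ_unique by fastforce
    moreover have sd: "integrable lborel (\<lambda>x. f x * deta n c d x)" if "continuous_on UNIV f" for f
      by (rule integrable_continuous_supp[of _ "{c..d + 1}"])
        (use that eta_supp(2)[OF n cd] in \<open>auto intro!: continuous_on_mult deta_continuous\<close>)
    ultimately show ?thesis
      unfolding left_diff_distrib by (simp add: Bochner_Integration.integral_diff[OF sd[OF \<kappa>_continuous] sd[OF \<mu>c]])
  qed
  have dif: "(\<kappa> d - \<mu> d) - (\<kappa> c - \<mu> c) = (LBINT x:{c..d}. \<phi>1 x)" if cd: "c \<le> d" for c d
    by (rule weak_derivative_on_line[OF _ cd \<phi>1 \<phi>1i weak[OF _ cd]]) (intro continuous_intros \<kappa>_continuous \<mu>c)
  define g where "g x = 1 / 2 * (\<phi>1 x + d\<phi>0 x)" for x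
  define h0 where "h0 x = 1 / 2 * (\<phi>1 x - d\<phi>0 x)" for x
  have \<kappa>g: "\<kappa> d - \<kappa> c = (LBINT x:{c..d}. g x)" if cd: "c \<le> d" for c d
    using sum[OF cd] dif[OF cd] unfolding g_def set_integral_mult_right set_integral_add(2)[OF \<phi>1i d0i] by simp
  have \<mu>h: "\<mu> c - \<mu> d = (LBINT x:{c..d}. h0 x)" if cd: "c \<le> d" for c d
    using sum[OF cd] dif[OF cd] unfolding h0_def set_integral_mult_right set_integral_diff(2)[OF \<phi>1i d0i] by simp
  have \<kappa>h: "\<kappa>' d - \<kappa>' c = (LBINT x:{c..d}. h0 (- x))" if cd: "c \<le> d" for c d
    using \<mu>h[of "- d" "- c"] cd set_integral_reflect(1)[of c d h0] by (simp add: \<mu>_def)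
  have gh2: "2 * (g x)\<^sup>2 + 2 * (h0 x)\<^sup>2 = (d\<phi>0 x)\<^sup>2 + (\<phi>1 x)\<^sup>2" for x
    by (simp add: g_def h0_def power2_eq_square field_simps)
  have g2le: "(g x)\<^sup>2 \<le> (d\<phi>0 x)\<^sup>2 + (\<phi>1 x)\<^sup>2" "(h0 x)\<^sup>2 \<le> (d\<phi>0 x)\<^sup>2 + (\<phi>1 x)\<^sup>2" for x
    using gh2[of x] zero_le_power2[of "g x"] zero_le_power2[of "h0 x"] by linarith+
  have ghm: "g \<in> borel_measurable borel" "h0 \<in> borel_measurable borel"
    unfolding g_def h0_def using d0m \<phi>1 by simp_all
  have ghi: "integrable lborel (\<lambda>x. (g x)\<^sup>2)" "integrable lborel (\<lambda>x. (h0 x)\<^sup>2)"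
    using ghm g2le by (auto intro!: Bochner_Integration.integrable_bound[OF Bochner_Integration.integrable_add[OF sqi]])
  have ghe: "(1 + \<bar>x\<bar>) * (2 * (g x)\<^sup>2 + 2 * (h0 (- (- x)))\<^sup>2 + pot p (\<Phi> (- x) x)) = (1 + \<bar>x\<bar>) * ((d\<phi>0 x)\<^sup>2 + (\<phi>1 x)\<^sup>2 + pot p (\<phi> (0, x)))" for x
    by (simp add: gh2 \<Phi>0)
  have aee: "AE x in lborel. (1 + \<bar>x\<bar>) * ((d\<phi>0 x)\<^sup>2 + (\<phi>1 x)\<^sup>2 + pot p (\<phi> (0, x))) = e x"
    using ae0 by eventually_elim (simp add: e_def)
  have em': "(\<lambda>x. (1 + \<bar>x\<bar>) * ((d\<phi>0 x)\<^sup>2 + (\<phi>1 x)\<^sup>2 + pot p (\<phi> (0, x)))) \<in> borel_measurable lborel"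
    using d0m \<phi>1 measurable_compose[OF borel_measurable_continuous_onI[OF \<phi>0c] potm] by simp
  have "wave p (enn2real E) \<Phi> (\<lambda>u v. g v - 1 / 4 * S u v) (\<lambda>u v. h0 (- u) - 1 / 4 * rect_wave.S p (\<lambda>u v. \<Phi> v u) v u)"
  proof (rule wave_of_profiles[OF ghm(1) _ ghi(1) _ \<kappa>g \<kappa>h])
    show "(\<lambda>u. h0 (- u)) \<in> borel_measurable borel"
      using measurable_compose[OF _ ghm(2), of uminus borel] by simp
    show "integrable lborel (\<lambda>x. (h0 (- x))\<^sup>2)"
      using lborel_integrable_real_affine[OF ghi(2), of "-1" 0] by simp
    show "integrable lborel (\<lambda>x. (1 + \<bar>x\<bar>) * (2 * (g x)\<^sup>2 + 2 * (h0 (- (- x)))\<^sup>2 + pot p (\<Phi> (- x) x)))"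
      unfolding ghe using integrable_cong_AE[OF em' em aee] ei by simp
    show "(LBINT x. (1 + \<bar>x\<bar>) * (2 * (g x)\<^sup>2 + 2 * (h0 (- (- x)))\<^sup>2 + pot p (\<Phi> (- x) x))) \<le> enn2real E"
      unfolding ghe using integral_cong_AE[OF em' em aee] eE by simp
  qed
  then show ?thesis unfolding \<Phi>_def by blast
qed

text \<open>Reflections in t and x move every point to the quadrant t, x >= 0 and keep p and M,
  hence all constants; the decay lemmas for u <= 0 and for u >= 0 are then enough.\<close>

lemma reflected_wave:
  assumes "wave p M \<Phi> P Q"
  obtains \<Phi>' P' Q' where "wave p M \<Phi>' P' Q'" "\<Phi>' (\<bar>t\<bar> - \<bar>x\<bar>) (\<bar>t\<bar> + \<bar>x\<bar>) = \<Phi> (t - x) (t + x)"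
proof -
  note r = wave_reverse[OF assms]
  consider "0 \<le> t" "0 \<le> x" | "0 \<le> t" "x \<le> 0" | "t \<le> 0" "0 \<le> x" | "t \<le> 0" "x \<le> 0" by linarith
  then show ?thesis
  proof cases
    case 1 then show ?thesis using that[OF assms] by simp
  next
    case 2 then show ?thesis using that[OF wave_swap[OF assms]] by simp
  next
    case 3 then show ?thesis using that[OF r] by (simp add: add.commute)
  next
    case 4 then show ?thesis using that[OF wave_swap[OF r]] by (simp add: add.commute)
  qed
qed

lemma root_bound:
  fixes y A B C k a b p :: real
  assumes p: "p > 1" and AB: "A > 0" "B > 0" and C: "C \<ge> 0" and k: "k > 0"
    and y: "\<bar>y\<bar> powr ((p + 3) / 2) \<le> C / sqrt (k * (A powr a * B powr b))"
  shows "\<bar>y\<bar> \<le> (C / sqrt k) powr (2 / (p + 3)) * A powr (- a / (p + 3)) * B powr (- b / (p + 3))"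
proof -
  have "C / sqrt (k * (A powr a * B powr b)) = (C / sqrt k) * (A powr (- a / 2) * B powr (- b / 2))"
  proof -
    have "sqrt (A powr a) = A powr (a / 2)" "sqrt (B powr b) = B powr (b / 2)"
      using AB by (simp_all add: powr_half_sqrt[symmetric] powr_powr)
    then show ?thesis by (simp add: real_sqrt_mult powr_minus_divide)
  qed
  with y have "(\<bar>y\<bar> powr ((p + 3) / 2)) powr (2 / (p + 3)) \<le> ((C / sqrt k) * (A powr (- a / 2) * B powr (- b / 2))) powr (2 / (p + 3))"
    using p by (intro powr_mono2) auto
  also have "\<dots> = (C / sqrt k) powr (2 / (p + 3)) * A powr (- a / (p + 3)) * B powr (- b / (p + 3))"
  proof -
    define c where "c = C / sqrt k"
    have "0 \<le> c" using C k by (simp add: c_def)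
    then show ?thesis unfolding c_def[symmetric] using p by (simp add: powr_mult powr_powr mult.assoc)
  qed
  finally have *: "\<bar>y\<bar> powr ((p + 3) / 2 * (2 / (p + 3))) \<le> (C / sqrt k) powr (2 / (p + 3)) * A powr (- a / (p + 3)) * B powr (- b / (p + 3))"
    by (simp only: powr_powr)
  have "(p + 3) / 2 * (2 / (p + 3)) = 1" using p by simp
  from *[unfolded this] show ?thesis by simp
qed

text \<open>Since \<alpha> < 1 makes the first factor positive, so must be the second. The value
  \<beta> = 0 is excluded too, because 1 / 0 = 0 would make that factor negative.\<close>

lemma admissible_intro:
  assumes p: "p > 1" and h: "(1 / \<alpha> - 1) * (1 / \<beta> - 1) = 4 / (p + 1)\<^sup>2" "1 / 2 \<le> \<alpha>" "\<alpha> < 1"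
  shows "admissible p \<alpha> \<beta>"
proof -
  have "0 < 4 / (p + 1)\<^sup>2" using p by simp
  then have "0 < (1 / \<alpha> - 1) * (1 / \<beta> - 1)" using h(1) by simp
  moreover have "0 < 1 / \<alpha> - 1" using h by simp
  ultimately have b: "1 < 1 / \<beta>" by (simp add: zero_less_mult_iff)
  then have "0 < \<beta>" by (metis less_trans zero_less_divide_1_iff zero_less_one)
  then show ?thesis using p h b by (simp add: admissible_def)
qed

text \<open>The energy is prescribed as E and the constants are chosen before the data and the
  solution; this expresses that they depend only on p, \<alpha>, \<beta> and the weighted
  energy.\<close>

theorem theorem2:
  fixes p :: real and E :: ennreal
  assumes "p > 1" and "E < \<infinity>"
  shows "\<exists>(C1 :: real) (C2 :: real \<Rightarrow> real \<Rightarrow> real) (C3 :: real).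
    \<forall>(\<phi>0 :: real \<Rightarrow> real) (d\<phi>0 :: real \<Rightarrow> real) (\<phi>1 :: real \<Rightarrow> real) (\<phi> :: real \<times> real \<Rightarrow> real).
      \<phi>1 \<in> borel_measurable lborel \<longrightarrow>
      has_weak_deriv 1 \<phi>0 d\<phi>0 \<longrightarrow>
      weighted_energy p \<phi>0 d\<phi>0 \<phi>1 = E \<longrightarrow>
      energy_solution p \<phi>0 \<phi>1 \<phi> \<longrightarrow>
      (\<forall>t x. \<bar>x\<bar> \<ge> \<bar>t\<bar> \<longrightarrow>
         \<bar>\<phi> (t, x)\<bar> \<le> C1 * (1 + \<bar>t\<bar> + \<bar>x\<bar>) powr (- (1 / (p + 3)))
                       * (1 + \<bar>x\<bar> - \<bar>t\<bar>) powr (- (1 / (p + 3)))) \<and>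
      (\<forall>\<alpha> \<beta>. (1 / \<alpha> - 1) * (1 / \<beta> - 1) = 4 / (p + 1)\<^sup>2 \<and> 1 / 2 \<le> \<alpha> \<and> \<alpha> < 1 \<longrightarrow>
         (\<forall>t x. \<bar>x\<bar> < \<bar>t\<bar> \<longrightarrow>
            \<bar>\<phi> (t, x)\<bar> \<le> C2 \<alpha> \<beta> * (1 + \<bar>t\<bar> + \<bar>x\<bar>) powr ((1 - 2 * \<alpha>) / (p + 3))
                              * (1 + \<bar>t\<bar> - \<bar>x\<bar>) powr ((1 - 2 * \<beta>) / (p + 3)))) \<and>
      (\<forall>t. esssup lborel (\<lambda>x. ereal \<bar>\<phi> (t, x)\<bar>)
             \<le> ereal (C3 * (1 + \<bar>t\<bar>) powr (- ((p - 1) / ((p + 1)\<^sup>2 + 4)))))"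
proof -
  define M where "M = enn2real E"
  \<comment> \<open>The constants have the shape delivered by \<open>root_bound\<close>, here with k
    = 1.\<close>
  define C1 where "C1 = ((p + 3) * (p + 1) / 4 * (2 * M) / sqrt 1) powr (2 / (p + 3))"
  define C2 where "C2 \<alpha> \<beta> = ((p + 3) * (p + 1) / 4 * (8 * M + 8 * wave.sup_sq p M * (1 / (1 - \<alpha>) + 1 / (1 - \<beta>)))
      / sqrt (4 * \<sigma>w p \<alpha> * \<alpha> * \<beta>)) powr (2 / (p + 3))" for \<alpha> \<beta>
  \<comment> \<open>The partner of \<beta> = 1/2: there 1 / \<beta> - 1 = 1, so the relation reads 1
    / \<alpha> - 1 = 4 / (p + 1)^2. For this \<beta> the exponent of 1 + |t| - |x| is 0, and the
    bound becomes uniform in x.\<close>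
  define \<alpha>0 where "\<alpha>0 = (p + 1)\<^sup>2 / ((p + 1)\<^sup>2 + 4)"
  define \<gamma> where "\<gamma> = (p - 1) / ((p + 1)\<^sup>2 + 4)"
  define C3 where "C3 = max C1 (C2 \<alpha>0 (1 / 2))"
  have p: "p > 1" by (rule assms)
  have q0: "(p + 1)\<^sup>2 + 4 > 0" by (simp add: add_nonneg_pos)
  show ?thesis
  proof (rule exI[of _ C1], rule exI[of _ C2], rule exI[of _ C3], intro allI impI)
    fix \<phi>0 d\<phi>0 \<phi>1 :: "real \<Rightarrow> real" and \<phi> :: "real \<times> real \<Rightarrow> real"
    assume \<phi>1: "\<phi>1 \<in> borel_measurable lborel" and w: "has_weak_deriv 1 \<phi>0 d\<phi>0"
      and en: "weighted_energy p \<phi>0 d\<phi>0 \<phi>1 = E" and sol: "energy_solution p \<phi>0 \<phi>1 \<phi>"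
    define \<Phi> where "\<Phi> = (\<lambda>u v. \<phi> ((u + v) / 2, (v - u) / 2))"
    have \<Phi>tx: "\<Phi> (t - x) (t + x) = \<phi> (t, x)" for t x by (simp add: \<Phi>_def)
    obtain P Q where wv: "wave p M \<Phi> P Q"
      using solution_is_wave[OF assms \<phi>1 w en sol] by (auto simp: M_def \<Phi>_def)
    have M0: "0 \<le> M" by (simp add: M_def)
    have ext: "\<bar>\<phi> (t, x)\<bar> \<le> C1 * (1 + \<bar>t\<bar> + \<bar>x\<bar>) powr (- (1 / (p + 3))) * (1 + \<bar>x\<bar> - \<bar>t\<bar>) powr (- (1 / (p + 3)))"
      if tx: "\<bar>x\<bar> \<ge> \<bar>t\<bar>" for t x
    proof -
      obtain \<Phi>' P' Q' where w': "wave p M \<Phi>' P' Q'" "\<Phi>' (\<bar>t\<bar> - \<bar>x\<bar>) (\<bar>t\<bar> + \<bar>x\<bar>) = \<Phi> (t - x) (t + x)"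
        using reflected_wave[OF wv, of t x] by blast
      have "\<bar>\<phi> (t, x)\<bar> powr ((p + 3) / 2) \<le> (p + 3) * (p + 1) / 4 * (2 * M) / sqrt ((1 + (\<bar>t\<bar> + \<bar>x\<bar>)) * (1 - (\<bar>t\<bar> - \<bar>x\<bar>)))"
        using wave.exterior_decay[OF w'(1), of "\<bar>t\<bar> - \<bar>x\<bar>" "\<bar>t\<bar> + \<bar>x\<bar>"] tx unfolding w'(2) \<Phi>tx by simp
      also have "\<dots> = (p + 3) * (p + 1) / 4 * (2 * M) / sqrt (1 * ((1 + \<bar>t\<bar> + \<bar>x\<bar>) powr 1 * (1 + \<bar>x\<bar> - \<bar>t\<bar>) powr 1))"
        using tx by (simp add: add.assoc)
      finally have "\<bar>\<phi> (t, x)\<bar> \<le> C1 * (1 + \<bar>t\<bar> + \<bar>x\<bar>) powr (- 1 / (p + 3)) * (1 + \<bar>x\<bar> - \<bar>t\<bar>) powr (- 1 / (p + 3))"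
        unfolding C1_def by (rule root_bound[OF p, rotated -1]) (use tx p M0 in auto)
      then show ?thesis by simp
    qed
    have int: "\<bar>\<phi> (t, x)\<bar> \<le> C2 \<alpha> \<beta> * (1 + \<bar>t\<bar> + \<bar>x\<bar>) powr ((1 - 2 * \<alpha>) / (p + 3)) * (1 + \<bar>t\<bar> - \<bar>x\<bar>) powr ((1 - 2 * \<beta>) / (p + 3))"
      if ab: "(1 / \<alpha> - 1) * (1 / \<beta> - 1) = 4 / (p + 1)\<^sup>2" "1 / 2 \<le> \<alpha>" "\<alpha> < 1" and tx: "\<bar>x\<bar> < \<bar>t\<bar>" for \<alpha> \<beta> t x
    proof -
      have ad: "admissible p \<alpha> \<beta>" by (rule admissible_intro[OF p ab])
      have ab0: "0 < \<alpha>" "\<alpha> < 1" "0 < \<beta>" "\<beta> < 1" using ad by (auto simp: admissible_def)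
      obtain \<Phi>' P' Q' where w': "wave p M \<Phi>' P' Q'" "\<Phi>' (\<bar>t\<bar> - \<bar>x\<bar>) (\<bar>t\<bar> + \<bar>x\<bar>) = \<Phi> (t - x) (t + x)"
        using reflected_wave[OF wv, of t x] by blast
      have s0: "0 \<le> wave.sup_sq p M" by (simp add: wave.sup_sq_def[OF w'(1)])
      have "\<bar>\<phi> (t, x)\<bar> powr ((p + 3) / 2) \<le> (p + 3) * (p + 1) / 4 * (8 * M + 8 * wave.sup_sq p M * (1 / (1 - \<alpha>) + 1 / (1 - \<beta>)))
        / sqrt (4 * \<sigma>w p \<alpha> * \<alpha> * \<beta> * ((1 + (\<bar>t\<bar> + \<bar>x\<bar>)) powr (2 * \<alpha> - 1) * (1 + (\<bar>t\<bar> - \<bar>x\<bar>)) powr (2 * \<beta> - 1)))"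
        using wave.interior_decay[OF w'(1) ad ab(2), of "\<bar>t\<bar> - \<bar>x\<bar>" "\<bar>t\<bar> + \<bar>x\<bar>"] tx unfolding w'(2) \<Phi>tx by simp
      then have "\<bar>\<phi> (t, x)\<bar> \<le> C2 \<alpha> \<beta> * (1 + (\<bar>t\<bar> + \<bar>x\<bar>)) powr (- (2 * \<alpha> - 1) / (p + 3)) * (1 + (\<bar>t\<bar> - \<bar>x\<bar>)) powr (- (2 * \<beta> - 1) / (p + 3))"
        unfolding C2_def by (rule root_bound[OF p, rotated -1]) (use tx p M0 ab0 s0 admissible_eqs(2)[OF ad] in auto)
      then show ?thesis by (simp add: add.assoc add_diff_eq)
    qed
    have sup: "\<bar>\<phi> (t, x)\<bar> \<le> C3 * (1 + \<bar>t\<bar>) powr (- \<gamma>)" for t x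
    proof (cases "\<bar>x\<bar> \<ge> \<bar>t\<bar>")
      case True
      have C1: "0 \<le> C1" by (simp add: C1_def)
      \<comment> \<open>The identity (p - 1) (p + 3) = (p + 1)^2 - 4 shows that the exterior decay
        is no slower than \<gamma>; below it also identifies the interior exponent with -
        \<gamma>.\<close>
      have "(p - 1) * (p + 3) \<le> (p + 1)\<^sup>2 + 4" by (simp add: power2_eq_square algebra_simps)
      then have g: "\<gamma> \<le> 1 / (p + 3)" unfolding \<gamma>_def using p q0 by (simp add: field_simps)
      have "(1 + \<bar>x\<bar> - \<bar>t\<bar>) powr (- (1 / (p + 3))) \<le> 1"
        using powr_mono[of "- (1 / (p + 3))" 0 "1 + \<bar>x\<bar> - \<bar>t\<bar>"] True p by simp
      moreover have "(1 + \<bar>t\<bar> + \<bar>x\<bar>) powr (- (1 / (p + 3))) \<le> (1 + \<bar>t\<bar>) powr (- (1 / (p + 3)))"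
        using p by (intro powr_mono2') auto
      moreover have "(1 + \<bar>t\<bar>) powr (- (1 / (p + 3))) \<le> (1 + \<bar>t\<bar>) powr (- \<gamma>)"
        using g by (intro powr_mono) auto
      ultimately have "C1 * (1 + \<bar>t\<bar> + \<bar>x\<bar>) powr (- (1 / (p + 3))) * (1 + \<bar>x\<bar> - \<bar>t\<bar>) powr (- (1 / (p + 3)))
          \<le> C1 * (1 + \<bar>t\<bar>) powr (- \<gamma>) * 1"
        using C1 by (intro mult_mono mult_left_mono) auto
      also have "\<dots> \<le> C3 * (1 + \<bar>t\<bar>) powr (- \<gamma>)"
        unfolding C3_def by (simp add: mult_right_mono)
      finally show ?thesis using ext[OF True] by linarith
    next
      case False
      have q4: "4 < (p + 1)\<^sup>2" using p power_strict_mono[of 2 "p + 1" 2] by simp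
      have a1: "1 / \<alpha>0 - 1 = 4 / (p + 1)\<^sup>2"
        using p q0 by (simp add: \<alpha>0_def divide_simps)
      have a2: "1 / 2 \<le> \<alpha>0" "\<alpha>0 < 1" unfolding \<alpha>0_def using q4 q0 by (auto simp: field_simps)
      have ex: "(1 - 2 * \<alpha>0) / (p + 3) = - \<gamma>"
      proof -
        have "1 - 2 * \<alpha>0 = - (\<gamma> * (p + 3))"
          unfolding \<alpha>0_def \<gamma>_def using q0 by (simp add: divide_simps) (simp add: power2_eq_square algebra_simps)
        then show ?thesis using p by simp
      qed
      have "\<gamma> \<ge> 0" using p q0 by (simp add: \<gamma>_def)
      then have "(1 + \<bar>t\<bar> + \<bar>x\<bar>) powr (- \<gamma>) \<le> (1 + \<bar>t\<bar>) powr (- \<gamma>)"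
        by (intro powr_mono2') auto
      moreover have bd: "\<bar>\<phi> (t, x)\<bar> \<le> C2 \<alpha>0 (1 / 2) * (1 + \<bar>t\<bar> + \<bar>x\<bar>) powr (- \<gamma>)"
        using int[of \<alpha>0 "1 / 2" x t] a1 a2 False by (simp add: ex)
      moreover have "C2 \<alpha>0 (1 / 2) \<le> C3" "0 \<le> C2 \<alpha>0 (1 / 2)" by (auto simp: C3_def C2_def)
      ultimately have "C2 \<alpha>0 (1 / 2) * (1 + \<bar>t\<bar> + \<bar>x\<bar>) powr (- \<gamma>) \<le> C3 * (1 + \<bar>t\<bar>) powr (- \<gamma>)"
        by (intro mult_mono) auto
      with bd show ?thesis by linarith
    qed
    have es: "esssup lborel (\<lambda>x. ereal \<bar>\<phi> (t, x)\<bar>) \<le> ereal (C3 * (1 + \<bar>t\<bar>) powr (- ((p - 1) / ((p + 1)\<^sup>2 + 4))))" for t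
    proof (rule esssup_I)
      have "continuous_on UNIV \<phi>" using sol by (simp add: energy_solution_def)
      then have "continuous_on UNIV (\<lambda>x. \<phi> (t, x))"
        by (rule continuous_on_compose2) (auto intro!: continuous_intros)
      then have "(\<lambda>x. \<phi> (t, x)) \<in> borel_measurable borel" by (rule borel_measurable_continuous_onI)
      then show "(\<lambda>x. ereal \<bar>\<phi> (t, x)\<bar>) \<in> borel_measurable lborel" by simp
      show "AE x in lborel. ereal \<bar>\<phi> (t, x)\<bar> \<le> ereal (C3 * (1 + \<bar>t\<bar>) powr (- ((p - 1) / ((p + 1)\<^sup>2 + 4))))"
        using sup unfolding \<gamma>_def by simp
    qed
    show "(\<forall>t x. \<bar>x\<bar> \<ge> \<bar>t\<bar> \<longrightarrow>
         \<bar>\<phi> (t, x)\<bar> \<le> C1 * (1 + \<bar>t\<bar> + \<bar>x\<bar>) powr (- (1 / (p + 3)))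
                       * (1 + \<bar>x\<bar> - \<bar>t\<bar>) powr (- (1 / (p + 3)))) \<and>
      (\<forall>\<alpha> \<beta>. (1 / \<alpha> - 1) * (1 / \<beta> - 1) = 4 / (p + 1)\<^sup>2 \<and> 1 / 2 \<le> \<alpha> \<and> \<alpha> < 1 \<longrightarrow>
         (\<forall>t x. \<bar>x\<bar> < \<bar>t\<bar> \<longrightarrow>
            \<bar>\<phi> (t, x)\<bar> \<le> C2 \<alpha> \<beta> * (1 + \<bar>t\<bar> + \<bar>x\<bar>) powr ((1 - 2 * \<alpha>) / (p + 3))
                              * (1 + \<bar>t\<bar> - \<bar>x\<bar>) powr ((1 - 2 * \<beta>) / (p + 3)))) \<and>
      (\<forall>t. esssup lborel (\<lambda>x. ereal \<bar>\<phi> (t, x)\<bar>)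
             \<le> ereal (C3 * (1 + \<bar>t\<bar>) powr (- ((p - 1) / ((p + 1)\<^sup>2 + 4)))))"
      using ext int es by blast
  qed
qed

end
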